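(* Let $\boldsymbol S^1,\boldsymbol S^2,\boldsymbol S^3\in\boldsymbol H_{\Gamma_{\mathrm N}}(\mathrm{div},\Omega)$. Then, for all $\boldsymbol v\in\boldsymbol H^1_{\Gamma_{\mathrm D}}(\Omega)$, $$(\nabla\times(\boldsymbol A-\boldsymbol A_h),\nabla\times\boldsymbol v)_\Omega=\sum_{k=1}^3\Big\{(\boldsymbol J_k-\nabla\cdot\boldsymbol S^k,\boldsymbol v_k)_\Omega-(\boldsymbol S^k+\boldsymbol u^k\times(\nabla\times\boldsymbol A_h),\nabla\boldsymbol v_k)_\Omega\Big\}.$$ In addition, if for $1\le k\le3$ $$(\nabla\cdot\boldsymbol S^k-\boldsymbol J_k,r_h)_\Omega=0\qquad\forall\,r_h\in\mathcal P_0(\mathcal T_h),$$ then $$\|\nabla\times(\boldsymbol A-\boldsymbol A_h)\|_\Omega\le C_{\mathrm L,\Omega}\Big(\sum_{K\in\mathcal T_h}\sum_{k=1}^3\Big(\frac{h_K}{\pi}\|\boldsymbol J_k-\nabla\cdot\boldsymbol S^k\|_K+\|\boldsymbol S^k+\boldsymbol u^k\times(\nabla\times\boldsymbol A_h)\|_K\Big)^2\Big)^{1/2}.$$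
   Context: Domain and spaces. $\Omega\subset\mathbb R^3$ is a Lipschitz polyhedral domain whose boundary is split into two disjoint relatively open polygonal parts $\Gamma_{\mathrm D},\Gamma_{\mathrm N}$ with $\partial\Omega=\overline{\Gamma_{\mathrm D}}\cup\overline{\Gamma_{\mathrm N}}$ (no topological assumption is made). For open $\omega\subset\Omega$, $(\cdot,\cdot)_\omega$ and $\|\cdot\|_\omega$ are the $L^2(\omega)$ inner product and norm (scalar, vector or matrix valued). $H^1_\Gamma(\omega)$ is the set of $H^1(\omega)$ functions with zero trace on $\Gamma\subset\partial\omega$, and $\boldsymbol H^1_\Gamma(\omega)=(H^1_\Gamma(\omega))^3$. With $\Gamma^{\mathrm c}:=\partial\omega\setminus\overline\Gamma$: $\boldsymbol H_\Gamma(\mathrm{div},\omega)$ is the set of $\boldsymbol v\in\boldsymbol H(\mathrm{div},\omega)$ with $(\boldsymbol v,\nabla q)_\omega+(\nabla\cdot\boldsymbol v,q)_\omega=0$ for all $q\in H^1_{\Gamma^{\mathrm c}}(\omega)$ (zero normal trace on $\Gamma$), and $\boldsymbol H_\Gamma(\mathbf{curl},\omega)$ is the set of $\boldsymbol w\in\boldsymbol H(\mathbf{curl},\omega)$ with $(\boldsymbol w,\nabla\times\boldsymbol p)_\omega-(\nabla\times\boldsymbol w,\boldsymbol p)_\omega=0$ for all $\boldsymbol p\in\boldsymbol H^1_{\Gamma^{\mathrm c}}(\omega)$ (zero tangential trace on $\Gamma$). $\{\boldsymbol u^k\}_{k=1}^3$ is the canonical basis of $\mathbb R^3$, and a subscript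 $k$ on a vector field ($\boldsymbol J_k$, $\boldsymbol v_k$) denotes its $k$-th component. Model problem. $\boldsymbol\Lambda_{\Gamma_{\mathrm D}}(\Omega):=\{\boldsymbol v\in\boldsymbol H_{\Gamma_{\mathrm D}}(\mathbf{curl},\Omega):\nabla\times\boldsymbol v=0\}$. $\boldsymbol J\in\boldsymbol L^2(\Omega)$ is $L^2(\Omega)$-orthogonal to $\boldsymbol\Lambda_{\Gamma_{\mathrm D}}(\Omega)$, and $\boldsymbol A\in\boldsymbol H_{\Gamma_{\mathrm D}}(\mathbf{curl},\Omega)$ is the unique field that is $L^2(\Omega)$-orthogonal to $\boldsymbol\Lambda_{\Gamma_{\mathrm D}}(\Omega)$ and satisfies $(\nabla\times\boldsymbol A,\nabla\times\boldsymbol v)_\Omega=(\boldsymbol J,\boldsymbol v)_\Omega$ for all $\boldsymbol v\in\boldsymbol H_{\Gamma_{\mathrm D}}(\mathbf{curl},\Omega)$. Mesh. $\mathcal T_h$ is a conforming mesh of $\Omega$ by open tetrahedra (two distinct closed elements meet in the empty set or in a full common face, edge or vertex), each boundary face being contained in $\Gamma_{\mathrm D}$ or in $\Gamma_{\mathrm N}$; $\mathcal E_h$ is its set of edges; $h_K$ is the diameter of $K\in\mathcal T_h$; $\mathcal P_0(\mathcal T_h)$ is the space of piecewise constant functions. For $\ell\in\mathcal E_h$ with vertices $\boldsymbol a,\boldsymbol b$ (in a fixed order), $\mathcal T_h^\ell$ is the set of elements having $\ell$ as an edge, $\omega_\ell$ the open domain they cover, and $\boldsymbol\psi_\ell:=|\boldsymbol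 b-\boldsymbol a|(\psi_{\boldsymbol a}\nabla\psi_{\boldsymbol b}-\psi_{\boldsymbol b}\nabla\psi_{\boldsymbol a})$, where $\psi_{\boldsymbol a},\psi_{\boldsymbol b}$ are the continuous piecewise affine hat functions of the vertices. Discrete field. $\boldsymbol A_h\in\boldsymbol H_{\Gamma_{\mathrm D}}(\mathbf{curl},\Omega)$ is such that for every $\ell\in\mathcal E_h$ there is an integer $p_\ell\ge0$ with $\boldsymbol A_h|_K\in\boldsymbol x\times(\mathcal P_{p_\ell}(K))^3+(\mathcal P_{p_\ell}(K))^3$ for all $K\in\mathcal T_h^\ell$ ($\mathcal P_q(K)$ being the polynomials of degree $\le q$ on $K$), and $(\nabla\times\boldsymbol A_h,\nabla\times\boldsymbol\psi_\ell)_\Omega=(\boldsymbol J,\boldsymbol\psi_\ell)_\Omega$ for every $\ell\in\mathcal E_h$ with $\ell\not\subset\overline{\Gamma_{\mathrm D}}$. Constant. $C_{\mathrm L,\Omega}$ is a constant such that for every $\boldsymbol v\in\boldsymbol H_{\Gamma_{\mathrm D}}(\mathbf{curl},\Omega)$ there is $\boldsymbol w\in\boldsymbol H^1_{\Gamma_{\mathrm D}}(\Omega)$ with $\nabla\times\boldsymbol w=\nabla\times\boldsymbol v$ and $\|\nabla\boldsymbol w\|_\Omega\le C_{\mathrm L,\Omega}\|\nabla\times\boldsymbol v\|_\Omega$ (such a constant is known to exist, and one can take $C_{\mathrm L,\Omega}=1$ if $\Omega$ is convex and $\Gamma_{\mathrm D}$ or $\Gamma_{\mathrm N}$ is empty).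 *)

theory Defs
  imports "HOL-Analysis.Analysis"
begin

section \<open>Square-integrable functions\<close>

text \<open>
  Elements of function spaces over \<open>\<omega>\<close> are represented by total functions, of which only the
  restriction to \<open>\<omega>\<close>, up to null sets, is relevant. The inner product of \<^typ>\<open>real^3\<close> is the
  Euclidean one, and that of \<^typ>\<open>real^3^3\<close> is the Frobenius one.
\<close>

definition L2 :: "(real^3) set \<Rightarrow> (real^3 \<Rightarrow> 'b::euclidean_space) set" where
  "L2 \<omega> = {f. f \<in> borel_measurable (lebesgue_on \<omega>) \<and>
              integrable (lebesgue_on \<omega>) (\<lambda>x. (norm (f x))\<^sup>2)}"

definition l2_inner ::
  "(real^3) set \<Rightarrow> (real^3 \<Rightarrow> 'b::euclidean_space) \<Rightarrow> (real^3 \<Rightarrow> 'b) \<Rightarrow> real" where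
  "l2_inner \<omega> f g = (\<integral>x. f x \<bullet> g x \<partial>lebesgue_on \<omega>)"

definition l2_norm :: "(real^3) set \<Rightarrow> (real^3 \<Rightarrow> 'b::euclidean_space) \<Rightarrow> real" where
  "l2_norm \<omega> f = sqrt (l2_inner \<omega> f f)"


section \<open>Classical derivatives and test functions\<close>

definition pderiv3 :: "3 \<Rightarrow> (real^3 \<Rightarrow> real) \<Rightarrow> real^3 \<Rightarrow> real" where
  "pderiv3 i f x = frechet_derivative f (at x) (axis i 1)"

definition grad :: "(real^3 \<Rightarrow> real) \<Rightarrow> real^3 \<Rightarrow> real^3" where
  "grad f x = (\<chi> i. pderiv3 i f x)"

definition curl :: "(real^3 \<Rightarrow> real^3) \<Rightarrow> real^3 \<Rightarrow> real^3" where
  "curl v x = vector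
     [pderiv3 2 (\<lambda>y. v y $ 3) x - pderiv3 3 (\<lambda>y. v y $ 2) x,
      pderiv3 3 (\<lambda>y. v y $ 1) x - pderiv3 1 (\<lambda>y. v y $ 3) x,
      pderiv3 1 (\<lambda>y. v y $ 2) x - pderiv3 2 (\<lambda>y. v y $ 1) x]"

primrec C_k :: "nat \<Rightarrow> (real^3 \<Rightarrow> real) \<Rightarrow> bool" where
  "C_k 0 f \<longleftrightarrow> continuous_on UNIV f"
| "C_k (Suc m) f \<longleftrightarrow> f differentiable_on UNIV \<and> (\<forall>i. C_k m (pderiv3 i f))"

definition smooth :: "(real^3 \<Rightarrow> real) \<Rightarrow> bool" where
  "smooth f \<longleftrightarrow> (\<forall>m. C_k m f)"

definition test_functions :: "(real^3) set \<Rightarrow> (real^3 \<Rightarrow> real) set" where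
  "test_functions \<omega> =
     {\<phi>. smooth \<phi> \<and> (\<exists>C. compact C \<and> C \<subseteq> \<omega> \<and> (\<forall>x. x \<notin> C \<longrightarrow> \<phi> x = 0))}"


section \<open>Weak derivatives\<close>

definition has_weak_grad ::
  "(real^3) set \<Rightarrow> (real^3 \<Rightarrow> real) \<Rightarrow> (real^3 \<Rightarrow> real^3) \<Rightarrow> bool" where
  "has_weak_grad \<omega> f G \<longleftrightarrow> G \<in> L2 \<omega> \<and>
     (\<forall>\<phi>\<in>test_functions \<omega>. \<forall>i. l2_inner \<omega> f (pderiv3 i \<phi>) = - l2_inner \<omega> (\<lambda>x. G x $ i) \<phi>)"

definition has_weak_div ::
  "(real^3) set \<Rightarrow> (real^3 \<Rightarrow> real^3) \<Rightarrow> (real^3 \<Rightarrow> real) \<Rightarrow> bool" where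
  "has_weak_div \<omega> v d \<longleftrightarrow> d \<in> L2 \<omega> \<and>
     (\<forall>\<phi>\<in>test_functions \<omega>. l2_inner \<omega> v (grad \<phi>) = - l2_inner \<omega> d \<phi>)"

definition has_weak_curl ::
  "(real^3) set \<Rightarrow> (real^3 \<Rightarrow> real^3) \<Rightarrow> (real^3 \<Rightarrow> real^3) \<Rightarrow> bool" where
  "has_weak_curl \<omega> v c \<longleftrightarrow> c \<in> L2 \<omega> \<and>
     (\<forall>\<phi>. (\<forall>i. (\<lambda>x. \<phi> x $ i) \<in> test_functions \<omega>) \<longrightarrow> l2_inner \<omega> v (curl \<phi>) = l2_inner \<omega> c \<phi>)"

text \<open>
  Weak derivatives are unique only up to null sets; the operators below pick a representative.
  They are used only through integrals or almost-everywhere statements.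
\<close>

definition weak_grad :: "(real^3) set \<Rightarrow> (real^3 \<Rightarrow> real) \<Rightarrow> real^3 \<Rightarrow> real^3" where
  "weak_grad \<omega> f = (SOME G. has_weak_grad \<omega> f G)"

definition weak_div :: "(real^3) set \<Rightarrow> (real^3 \<Rightarrow> real^3) \<Rightarrow> real^3 \<Rightarrow> real" where
  "weak_div \<omega> v = (SOME d. has_weak_div \<omega> v d)"

definition weak_curl :: "(real^3) set \<Rightarrow> (real^3 \<Rightarrow> real^3) \<Rightarrow> real^3 \<Rightarrow> real^3" where
  "weak_curl \<omega> v = (SOME c. has_weak_curl \<omega> v c)"

definition weak_grad_vec :: "(real^3) set \<Rightarrow> (real^3 \<Rightarrow> real^3) \<Rightarrow> real^3 \<Rightarrow> real^3^3" where
  "weak_grad_vec \<omega> v x = (\<chi> i. weak_grad \<omega> (\<lambda>y. v y $ i) x)"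

definition H1 :: "(real^3) set \<Rightarrow> (real^3 \<Rightarrow> real) set" where
  "H1 \<omega> = {f \<in> L2 \<omega>. \<exists>G. has_weak_grad \<omega> f G}"

definition Hdiv :: "(real^3) set \<Rightarrow> (real^3 \<Rightarrow> real^3) set" where
  "Hdiv \<omega> = {v \<in> L2 \<omega>. \<exists>d. has_weak_div \<omega> v d}"

definition Hcurl :: "(real^3) set \<Rightarrow> (real^3 \<Rightarrow> real^3) set" where
  "Hcurl \<omega> = {v \<in> L2 \<omega>. \<exists>c. has_weak_curl \<omega> v c}"


section \<open>Surface measure, traces and boundary conditions\<close>

text \<open>
  The surface measure is the two-dimensional Hausdorff measure, normalised to agree with the area
  on planes. Boundedness of the covering sets is required because \<^const>\<open>diameter\<close> is \<open>0\<close> on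
  unbounded sets.
\<close>

definition hausdorff2_outer :: "(real^3) set \<Rightarrow> ennreal" where
  "hausdorff2_outer A =
     (SUP \<delta>\<in>{0<..}.
        INF U\<in>{U :: nat \<Rightarrow> (real^3) set.
                 A \<subseteq> (\<Union>i. U i) \<and> (\<forall>i. bounded (U i) \<and> diameter (U i) \<le> \<delta>)}.
          (\<Sum>i. ennreal (pi / 4 * (diameter (U i))\<^sup>2)))"

definition hausdorff2 :: "(real^3) measure" where
  "hausdorff2 = measure_of UNIV (sets borel) hausdorff2_outer"

definition surface :: "(real^3) set \<Rightarrow> (real^3) measure" where
  "surface \<omega> = restrict_space hausdorff2 (frontier \<omega>)"

text \<open>
  The trace operator on a Lipschitz domain is the continuous extension, from \<open>H1\<close> to the
  square-integrable functions on the boundary, of the restriction map \<open>\<phi> \<mapsto> \<phi>|\<partial>\<omega>\<close> defined on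
  smooth functions.
\<close>

definition has_trace ::
  "(real^3) set \<Rightarrow> (real^3 \<Rightarrow> real) \<Rightarrow> (real^3 \<Rightarrow> real) \<Rightarrow> bool" where
  "has_trace \<omega> v g \<longleftrightarrow>
     g \<in> borel_measurable (surface \<omega>) \<and> integrable (surface \<omega>) (\<lambda>x. (g x)\<^sup>2) \<and>
     (\<exists>\<phi> :: nat \<Rightarrow> real^3 \<Rightarrow> real.
        (\<forall>n. \<phi> n \<in> test_functions UNIV) \<and>
        (\<lambda>n. l2_norm \<omega> (\<lambda>x. \<phi> n x - v x)) \<longlonglongrightarrow> 0 \<and>
        (\<lambda>n. l2_norm \<omega> (\<lambda>x. grad (\<phi> n) x - weak_grad \<omega> v x)) \<longlonglongrightarrow> 0 \<and>
        (\<lambda>n. \<integral>\<^sup>+x. ennreal ((\<phi> n x - g x)\<^sup>2) \<partial>surface \<omega>) \<longlonglongrightarrow> 0)"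

definition H1_0 :: "(real^3) set \<Rightarrow> (real^3) set \<Rightarrow> (real^3 \<Rightarrow> real) set" where
  "H1_0 \<Gamma> \<omega> = {v \<in> H1 \<omega>. \<exists>g. has_trace \<omega> v g \<and> (AE x in surface \<omega>. x \<in> \<Gamma> \<longrightarrow> g x = 0)}"

definition H1_0_vec :: "(real^3) set \<Rightarrow> (real^3) set \<Rightarrow> (real^3 \<Rightarrow> real^3) set" where
  "H1_0_vec \<Gamma> \<omega> = {v. \<forall>k. (\<lambda>x. v x $ k) \<in> H1_0 \<Gamma> \<omega>}"

definition Hdiv_0 :: "(real^3) set \<Rightarrow> (real^3) set \<Rightarrow> (real^3 \<Rightarrow> real^3) set" where
  "Hdiv_0 \<Gamma> \<omega> = {v \<in> Hdiv \<omega>. \<forall>q\<in>H1_0 (frontier \<omega> - closure \<Gamma>) \<omega>.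
     l2_inner \<omega> v (weak_grad \<omega> q) + l2_inner \<omega> (weak_div \<omega> v) q = 0}"

definition Hcurl_0 :: "(real^3) set \<Rightarrow> (real^3) set \<Rightarrow> (real^3 \<Rightarrow> real^3) set" where
  "Hcurl_0 \<Gamma> \<omega> = {w \<in> Hcurl \<omega>. \<forall>p\<in>H1_0_vec (frontier \<omega> - closure \<Gamma>) \<omega>.
     l2_inner \<omega> w (weak_curl \<omega> p) - l2_inner \<omega> (weak_curl \<omega> w) p = 0}"

definition curl_free :: "(real^3) set \<Rightarrow> (real^3) set \<Rightarrow> (real^3 \<Rightarrow> real^3) set" where
  "curl_free \<Gamma> \<omega> = {v \<in> Hcurl_0 \<Gamma> \<omega>. AE x in lebesgue_on \<omega>. weak_curl \<omega> v x = 0}"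


section \<open>Domain and boundary splitting\<close>

text \<open>
  Near each boundary point the domain is, in suitable Cartesian coordinates, the strict epigraph of
  a Lipschitz function.
\<close>

definition lipschitz_boundary :: "(real^3) set \<Rightarrow> bool" where
  "lipschitz_boundary \<Omega> \<longleftrightarrow>
     (\<forall>x\<in>frontier \<Omega>. \<exists>U (Q :: real^3 \<Rightarrow> real^3) (\<gamma> :: real^2 \<Rightarrow> real) L.
        open U \<and> x \<in> U \<and> orthogonal_transformation Q \<and> L-lipschitz_on UNIV \<gamma> \<and>
        \<Omega> \<inter> U = {z \<in> U. \<gamma> (vector [Q z $ 1, Q z $ 2]) < Q z $ 3})"

text \<open>No topological assumption is made; in particular, connectedness is not required.\<close>

definition lipschitz_polyhedral_domain :: "(real^3) set \<Rightarrow> bool" where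
  "lipschitz_polyhedral_domain \<Omega> \<longleftrightarrow>
     open \<Omega> \<and> \<Omega> \<noteq> {} \<and> lipschitz_boundary \<Omega> \<and>
     (\<exists>F. finite F \<and> (\<forall>P\<in>F. polytope P) \<and> closure \<Omega> = \<Union>F)"

text \<open>
  For a subset of the boundary of a polyhedral domain, the relatively open polytopes below are
  polygons, segments and points. Prescribing only the closure of a boundary part would not do:
  a relatively open set with polygonal closure may miss a set of positive surface measure.
\<close>

definition polygonal :: "(real^3) set \<Rightarrow> bool" where
  "polygonal \<Gamma> \<longleftrightarrow> (\<exists>F. finite F \<and> (\<forall>P\<in>F. polytope P) \<and> \<Gamma> = (\<Union>P\<in>F. rel_interior P))"

definition boundary_split :: "(real^3) set \<Rightarrow> (real^3) set \<Rightarrow> (real^3) set \<Rightarrow> bool" where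
  "boundary_split \<Omega> \<Gamma>D \<Gamma>N \<longleftrightarrow>
     openin (top_of_set (frontier \<Omega>)) \<Gamma>D \<and> openin (top_of_set (frontier \<Omega>)) \<Gamma>N \<and>
     polygonal \<Gamma>D \<and> polygonal \<Gamma>N \<and> \<Gamma>D \<inter> \<Gamma>N = {} \<and> frontier \<Omega> = closure \<Gamma>D \<union> closure \<Gamma>N"


section \<open>Meshes and discrete fields\<close>

definition open_tetrahedron :: "(real^3) set \<Rightarrow> bool" where
  "open_tetrahedron K \<longleftrightarrow> (\<exists>C. 3 simplex C \<and> K = interior C)"

text \<open>
  \<^const>\<open>face_of\<close> includes the empty face. A common face of two distinct closed elements is
  necessarily a proper one, i.e. empty or a common vertex, edge or triangular face. Triangular faces
  are closed here, hence the closures of the boundary parts.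
\<close>

definition conforming_mesh ::
  "(real^3) set \<Rightarrow> (real^3) set \<Rightarrow> (real^3) set \<Rightarrow> (real^3) set set \<Rightarrow> bool" where
  "conforming_mesh \<Omega> \<Gamma>D \<Gamma>N T \<longleftrightarrow>
     finite T \<and> (\<forall>K\<in>T. open_tetrahedron K) \<and> (\<Union>K\<in>T. closure K) = closure \<Omega> \<and>
     (\<forall>K\<in>T. \<forall>K'\<in>T. K \<noteq> K' \<longrightarrow>
        (closure K \<inter> closure K') face_of closure K \<and>
        (closure K \<inter> closure K') face_of closure K') \<and>
     (\<forall>K\<in>T. \<forall>F. F facet_of closure K \<and> F \<subseteq> frontier \<Omega> \<longrightarrow> F \<subseteq> closure \<Gamma>D \<or> F \<subseteq> closure \<Gamma>N)"

definition mesh_vertices :: "(real^3) set set \<Rightarrow> (real^3) set" where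
  "mesh_vertices T = {a. \<exists>K\<in>T. a extreme_point_of closure K}"

definition mesh_edges :: "(real^3) set set \<Rightarrow> (real^3) set set" where
  "mesh_edges T = {l. \<exists>K\<in>T. l edge_of closure K}"

definition edge_patch :: "(real^3) set set \<Rightarrow> (real^3) set \<Rightarrow> (real^3) set set" where
  "edge_patch T l = {K\<in>T. l edge_of closure K}"

definition piecewise_constant :: "(real^3) set set \<Rightarrow> (real^3 \<Rightarrow> real) set" where
  "piecewise_constant T = {r. \<forall>K\<in>T. \<exists>c. \<forall>x\<in>K. r x = c}"

definition is_hat_function :: "(real^3) set set \<Rightarrow> real^3 \<Rightarrow> (real^3 \<Rightarrow> real) \<Rightarrow> bool" where
  "is_hat_function T a f \<longleftrightarrow>
     continuous_on (\<Union>K\<in>T. closure K) f \<and>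
     (\<forall>K\<in>T. \<exists>m c. \<forall>x\<in>closure K. f x = m \<bullet> x + c) \<and>
     (\<forall>b\<in>mesh_vertices T. f b = (if b = a then 1 else 0))"

text \<open>The hat function of a mesh vertex is unique on the meshed set, and arbitrary outside.\<close>

definition hat_function :: "(real^3) set set \<Rightarrow> real^3 \<Rightarrow> real^3 \<Rightarrow> real" where
  "hat_function T a = (SOME f. is_hat_function T a f)"

definition edge_function ::
  "(real^3) set \<Rightarrow> (real^3) set set \<Rightarrow> real^3 \<Rightarrow> real^3 \<Rightarrow> real^3 \<Rightarrow> real^3" where
  "edge_function \<Omega> T a b x = norm (b - a) *\<^sub>R
     (hat_function T a x *\<^sub>R weak_grad \<Omega> (hat_function T b) x
      - hat_function T b x *\<^sub>R weak_grad \<Omega> (hat_function T a) x)"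

definition poly_deg_le :: "nat \<Rightarrow> (real^3 \<Rightarrow> real) \<Rightarrow> bool" where
  "poly_deg_le q f \<longleftrightarrow> (\<exists>c :: nat \<Rightarrow> nat \<Rightarrow> nat \<Rightarrow> real. \<forall>x.
     f x = (\<Sum>(i, j, k) | i + j + k \<le> q. c i j k * x $ 1 ^ i * x $ 2 ^ j * x $ 3 ^ k))"

definition nedelec_on :: "nat \<Rightarrow> (real^3) set \<Rightarrow> (real^3 \<Rightarrow> real^3) \<Rightarrow> bool" where
  "nedelec_on p K w \<longleftrightarrow>
     (\<exists>r s. (\<forall>k. poly_deg_le p (\<lambda>x. r x $ k) \<and> poly_deg_le p (\<lambda>x. s x $ k)) \<and>
            (AE x in lebesgue_on K. w x = cross3 x (r x) + s x))"

end

theory Submission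
  imports Defs
begin

text \<open>
  The identity is Green's formula and the estimate a Poincare inequality on each element. Each half rests on one
  analytic fact.

  The identity. Since \<open>curl v\<close> is the sum over k of the vectors \<open>grad v\<^sub>k \<times> u\<^sup>k\<close>, one has
  \<open>(curl Ah, curl v) = \<Sum>\<^sub>k (u\<^sup>k \<times> curl Ah, grad v\<^sub>k)\<close>, and Green's formula for \<open>S\<^sup>k\<close> inserts
  \<open>(div S\<^sup>k, v\<^sub>k) + (S\<^sup>k, grad v\<^sub>k) = 0\<close>. To use the equation satisfied by \<open>A\<close>, the test field v must
  belong to \<open>H\<^sub>\<Gamma>\<^sub>D(curl)\<close>, where the boundary condition is expressed by duality, whereas v has vanishing
  traces. This is an integration by parts for two functions in \<open>H1\<close> the product of whose traces is zero
  (\<open>integration_by_parts_traces\<close>). It is reduced to smooth functions by \<open>trace_inequality\<close>: the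
  integral of a partial derivative of f over the domain is bounded by a multiple of the integral of
  \<open>\<bar>f\<bar>\<close> over the boundary. Indeed, the integrated derivative is a limit of
  n times the difference between the integrals of f over the domain and over its translate by \<open>e / n\<close>;
  only the symmetric difference of the two sets matters, and it consists of cylinders of length \<open>1 / n\<close>
  over pieces of the boundary, whose volume is controlled by the two-dimensional Hausdorff measure
  (\<open>cylinder_le_hausdorff2\<close>). That this Hausdorff measure is a measure on the Borel sets is
  Caratheodory's criterion.

  The estimate. Applying the identity to a field w with the curl of the error, each residual has mean zero
  on each element, so \<open>w\<^sub>k\<close> may be replaced by \<open>w\<^sub>k\<close> minus a constant. What is needed is the Poincare
  inequality with constant \<open>h\<^sub>K / \<pi>\<close> on a tetrahedron. For general convex sets this is the theorem of
  Payne and Weinberger; on a tetrahedron the better constant \<open>h\<^sub>K / 4\<close> follows from the spectral gap of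
  the Wright-Fisher diffusion, for which the uniform distribution on the simplex is reversible. Its carre
  du champ at x is the covariance of linear functionals of a random vertex with mean x, hence at most
  \<open>(h\<^sub>K)\<^sup>2 / 4\<close> times the squared length of the gradient. Its generator maps polynomials of degree at
  most d to themselves and acts on them as \<open>- d (d + 3)\<close> modulo lower degree, so that by orthogonal
  projection and density of polynomials its spectral gap is 4, the value at \<open>d = 1\<close> (\<open>spectral_gap\<close>).

  Weak derivatives enter through chosen representatives. They are identified almost everywhere by the
  fundamental lemma of the calculus of variations (\<open>L2_orthogonal_test_functions_imp_0\<close>).
\<close>

section \<open>Continuously differentiable functions and translations\<close>

text \<open>
  The gradient is carried along as a second argument, so that the rules below compute the gradients of
  composite expressions and no derivative operator has to be simplified.
\<close>

definition C1_grad :: "(real^3 \<Rightarrow> real) \<Rightarrow> (real^3 \<Rightarrow> real^3) \<Rightarrow> bool" where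
  "C1_grad f g \<longleftrightarrow>
     (\<forall>x. (f has_derivative (\<lambda>h. g x \<bullet> h)) (at x)) \<and> continuous_on UNIV g"

lemma C1_gradD:
  assumes "C1_grad f g"
  shows "(f has_derivative (\<lambda>h. g x \<bullet> h)) (at x)" and "continuous_on UNIV g"
    and "continuous_on UNIV f"
proof -
  show *: "(f has_derivative (\<lambda>h. g x \<bullet> h)) (at x)" for x
    using assms by (auto simp: C1_grad_def)
  show "continuous_on UNIV g" using assms by (auto simp: C1_grad_def)
  show "continuous_on UNIV f"
    using * has_derivative_continuous by (blast intro: continuous_at_imp_continuous_on)
qed

lemma C1_grad_const: "C1_grad (\<lambda>x. c) (\<lambda>x. 0)"
  unfolding C1_grad_def by (auto intro!: derivative_eq_intros)

lemma C1_grad_affine: "C1_grad (\<lambda>x. a \<bullet> x + c) (\<lambda>x. a)"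
  unfolding C1_grad_def by (auto intro!: derivative_eq_intros)

lemma C1_grad_add:
  assumes "C1_grad f f'" and "C1_grad g g'"
  shows "C1_grad (\<lambda>x. f x + g x) (\<lambda>x. f' x + g' x)"
  using assms unfolding C1_grad_def
  by (auto intro!: derivative_eq_intros continuous_intros simp: inner_add_left)

lemma C1_grad_mult:
  assumes "C1_grad f f'" and "C1_grad g g'"
  shows "C1_grad (\<lambda>x. f x * g x) (\<lambda>x. f x *\<^sub>R g' x + g x *\<^sub>R f' x)"
  unfolding C1_grad_def
proof (intro conjI allI)
  fix x
  show "((\<lambda>x. f x * g x) has_derivative (\<lambda>h. (f x *\<^sub>R g' x + g x *\<^sub>R f' x) \<bullet> h)) (at x)"
    by (rule derivative_eq_intros C1_gradD(1)[OF assms(1)] C1_gradD(1)[OF assms(2)] refl)+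
       (auto simp: inner_add_left)
next
  show "continuous_on UNIV (\<lambda>x. f x *\<^sub>R g' x + g x *\<^sub>R f' x)"
    by (intro continuous_intros C1_gradD[OF assms(1)] C1_gradD[OF assms(2)])
qed

lemma C1_grad_cmult:
  assumes "C1_grad f f'"
  shows "C1_grad (\<lambda>x. c * f x) (\<lambda>x. c *\<^sub>R f' x)"
  using C1_grad_mult[OF C1_grad_const assms, of c] by simp

lemma C1_grad_diff:
  assumes "C1_grad f f'" and "C1_grad g g'"
  shows "C1_grad (\<lambda>x. f x - g x) (\<lambda>x. f' x - g' x)"
  using C1_grad_add[OF assms(1) C1_grad_cmult[OF assms(2), of "-1"]] by simp

lemma integrable_bounded_continuous:
  fixes f :: "real^3 \<Rightarrow> real"
  assumes f: "continuous_on UNIV f" and B: "bounded B" "B \<in> sets lebesgue"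
  shows "integrable (lebesgue_on B) f"
proof -
  obtain a b where ab: "B \<subseteq> cbox a b" using B(1) bounded_subset_cbox_symmetric by blast
  have "f absolutely_integrable_on cbox a b"
    by (rule absolutely_integrable_continuous) (use f continuous_on_subset in auto)
  then have "f absolutely_integrable_on B"
    by (rule set_integrable_subset) (use B ab in auto)
  then show ?thesis
    by (simp add: integrable_restrict_space B set_integrable_def)
qed

lemma C1_grad_lipschitz_on_ball:
  assumes f: "C1_grad f g"
  obtains M where "M \<ge> 0" "\<And>x y. norm x \<le> R \<Longrightarrow> norm y \<le> R \<Longrightarrow> \<bar>f x - f y\<bar> \<le> M * norm (x - y)"
proof -
  have "compact (g ` cball 0 R)"
    by (rule compact_continuous_image) (use C1_gradD(2)[OF f] continuous_on_subset in auto)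
  then obtain M where M: "M > 0" "\<And>x. norm x \<le> R \<Longrightarrow> norm (g x) \<le> M"
    using bounded_pos[of "g ` cball 0 R"] compact_imp_bounded by auto
  have "\<bar>f x - f y\<bar> \<le> M * norm (x - y)" if "norm x \<le> R" "norm y \<le> R" for x y
  proof -
    have "norm (f x - f y) \<le> M * norm (x - y)"
    proof (rule differentiable_bound[where S = "cball 0 R" and f' = "\<lambda>x h. g x \<bullet> h"])
      show "(f has_derivative (\<bullet>) (g x)) (at x within cball 0 R)" for x
        using C1_gradD(1)[OF f] has_derivative_at_withinI by blast
      show "onorm ((\<bullet>) (g x)) \<le> M" if "x \<in> cball 0 R" for x
      proof (rule onorm_bound)
        fix y
        show "norm (g x \<bullet> y) \<le> M * norm y"
          using M(2)[of x] that Cauchy_Schwarz_ineq2[of "g x" y]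
          by (smt (verit) mem_cball_0 mult_right_mono norm_ge_zero real_norm_def)
      qed (use M in auto)
    qed (use that in auto)
    then show ?thesis by simp
  qed
  with M(1) that show ?thesis by (meson less_imp_le)
qed

text \<open>
  Dominated convergence: on a bounded set the difference quotients are bounded by a Lipschitz constant.
  This is the substitute for the divergence theorem throughout, since it expresses an integrated
  derivative by integrals of the function itself.
\<close>

lemma difference_quotient_integral_tendsto:
  assumes f: "C1_grad f g" and B: "bounded B" "B \<in> sets lebesgue"
  shows "(\<lambda>n. real (Suc n) * (\<integral>x. f (x + (1 / real (Suc n)) *\<^sub>R e) - f x \<partial>lebesgue_on B))
           \<longlonglongrightarrow> (\<integral>x. g x \<bullet> e \<partial>lebesgue_on B)"
proof -
  obtain R where R: "\<And>x. x \<in> B \<Longrightarrow> norm x \<le> R" using B(1) bounded_iff by blast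
  obtain M where M: "M \<ge> 0" "\<And>x y. norm x \<le> R + norm e \<Longrightarrow> norm y \<le> R + norm e
       \<Longrightarrow> \<bar>f x - f y\<bar> \<le> M * norm (x - y)"
    using C1_grad_lipschitz_on_ball[OF f] by blast
  let ?q = "\<lambda>n x. real (Suc n) * (f (x + (1 / real (Suc n)) *\<^sub>R e) - f x)"
  have cf: "continuous_on UNIV f" using C1_gradD(3)[OF f] .
  have cs: "continuous_on UNIV (\<lambda>x. f (x + c *\<^sub>R e) - f x)" for c
    by (intro continuous_intros continuous_on_compose2[OF cf]) auto
  have meas: "h \<in> borel_measurable (lebesgue_on B)" if "continuous_on UNIV h" for h :: "real^3 \<Rightarrow> real"
    using integrable_bounded_continuous[OF that B] by (rule borel_measurable_integrable)
  have "(\<lambda>n. \<integral>x. ?q n x \<partial>lebesgue_on B) \<longlonglongrightarrow> (\<integral>x. g x \<bullet> e \<partial>lebesgue_on B)"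
  proof (rule integral_dominated_convergence[where w = "\<lambda>x. M * norm e"])
    show "(\<lambda>x. g x \<bullet> e) \<in> borel_measurable (lebesgue_on B)"
      by (intro meas continuous_intros C1_gradD(2)[OF f])
    show "?q n \<in> borel_measurable (lebesgue_on B)" for n
      by (intro borel_measurable_times borel_measurable_const meas cs)
    show "integrable (lebesgue_on B) (\<lambda>x. M * norm e)"
      by (rule integrable_bounded_continuous[OF _ B]) auto
    show "AE x in lebesgue_on B. (\<lambda>n. ?q n x) \<longlonglongrightarrow> g x \<bullet> e"
    proof (intro AE_I2)
      fix x
      have "((\<lambda>t. f (x + t *\<^sub>R e)) has_derivative (\<lambda>t. g (x + 0 *\<^sub>R e) \<bullet> (t *\<^sub>R e))) (at 0)"
        by (rule has_derivative_compose[OF _ C1_gradD(1)[OF f]]) (auto intro!: derivative_eq_intros)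
      then have "((\<lambda>t. f (x + t *\<^sub>R e)) has_real_derivative (g x \<bullet> e)) (at 0)"
        unfolding has_field_derivative_def by (rule has_derivative_eq_rhs) (auto simp: mult.commute)
      then have "((\<lambda>t. (f (x + t *\<^sub>R e) - f x) / t) \<longlongrightarrow> g x \<bullet> e) (at 0)"
        by (simp add: DERIV_def)
      moreover have "filterlim (\<lambda>n. 1 / real (Suc n)) (at 0) sequentially"
        using lim_1_over_n[where 'a=real, THEN LIMSEQ_Suc] by (auto simp: filterlim_at)
      ultimately have "(\<lambda>n. (f (x + (1 / real (Suc n)) *\<^sub>R e) - f x) / (1 / real (Suc n))) \<longlonglongrightarrow> g x \<bullet> e"
        by (rule filterlim_compose)
      then show "(\<lambda>n. ?q n x) \<longlonglongrightarrow> g x \<bullet> e"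
        by (simp add: mult.commute)
    qed
    show "AE x in lebesgue_on B. norm (?q n x) \<le> M * norm e" for n
    proof (intro AE_I2)
      fix x assume "x \<in> space (lebesgue_on B)"
      then have x: "norm x \<le> R" using R by (auto simp: space_restrict_space)
      have "norm ((1 / real (Suc n)) *\<^sub>R e) \<le> norm e"
        by (simp add: divide_le_eq mult_le_cancel_left1)
      then have "norm (x + (1 / real (Suc n)) *\<^sub>R e) \<le> R + norm e"
        using x norm_triangle_mono by blast
      then have "\<bar>f (x + (1 / real (Suc n)) *\<^sub>R e) - f x\<bar> \<le> M * norm ((1 / real (Suc n)) *\<^sub>R e)"
        using M(2)[of "x + (1 / real (Suc n)) *\<^sub>R e" x] x by (simp add: add_increasing2)
      then have "real (Suc n) * \<bar>f (x + (1 / real (Suc n)) *\<^sub>R e) - f x\<bar>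
          \<le> real (Suc n) * (M * norm ((1 / real (Suc n)) *\<^sub>R e))"
        by (intro mult_left_mono) auto
      also have "\<dots> = M * norm e" by simp
      finally show "norm (?q n x) \<le> M * norm e"
        by (simp add: abs_mult del: of_nat_Suc)
    qed
  qed
  then show ?thesis by simp
qed

text \<open>
  The integral of the translated function is the integral of f over the translated set, and the points
  common to \<open>B\<close> and its translate cancel.
\<close>

lemma difference_integral_le_symdiff:
  fixes f :: "real^3 \<Rightarrow> real"
  assumes f: "continuous_on UNIV f" and B: "bounded B" "B \<in> sets borel"
  shows "\<bar>\<integral>x. f (x + d) - f x \<partial>lebesgue_on B\<bar>
     \<le> (\<integral>x. indicator {x. (x - d \<in> B) \<noteq> (x \<in> B)} x * \<bar>f x\<bar> \<partial>lborel)"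
proof -
  define B' where "B' = {x. x - d \<in> B}"
  have B': "B' \<in> sets borel"
    unfolding B'_def using B(2) by measurable
  have B'eq: "B' = (+) d ` B" by (auto simp: B'_def image_iff) (metis add.commute diff_add_cancel)
  have bB': "bounded B'" unfolding B'eq using B(1) bounded_translation by blast
  have int: "integrable lborel (\<lambda>x. indicator A x * h x)"
    if "continuous_on UNIV h" "bounded A" "A \<in> sets borel" for A and h :: "real^3 \<Rightarrow> real"
  proof -
    have "integrable (lebesgue_on A) h" using integrable_bounded_continuous that by auto
    then have "integrable lebesgue (\<lambda>x. indicator A x * h x)"
      using that by (subst (asm) integrable_restrict_space) auto
    then show ?thesis
      by (subst (asm) integrable_completion)
         (use that borel_measurable_continuous_onI in \<open>auto intro!: borel_measurable_times\<close>)
  qed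
  have eq: "(\<integral>x. h x \<partial>lebesgue_on A) = (\<integral>x. indicator A x * h x \<partial>lborel)"
    if "continuous_on UNIV h" "A \<in> sets borel" for A and h :: "real^3 \<Rightarrow> real"
    using that borel_measurable_continuous_onI[of h]
    by (subst integral_restrict_space) (auto simp: integral_completion)
  have cs: "continuous_on UNIV (\<lambda>x. f (x + d))"
    by (intro continuous_intros continuous_on_compose2[OF f]) auto
  have "(\<integral>x. f (x + d) - f x \<partial>lebesgue_on B)
      = (\<integral>x. f (x + d) \<partial>lebesgue_on B) - (\<integral>x. f x \<partial>lebesgue_on B)"
    by (rule Bochner_Integration.integral_diff) (use integrable_bounded_continuous cs f B in auto)
  also have "(\<integral>x. f (x + d) \<partial>lebesgue_on B) = (\<integral>x. indicator B x * f (x + d) \<partial>lborel)"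
    by (rule eq[OF cs B(2)])
  also have "\<dots> = (\<integral>x. indicator B' (x + d) * f (x + d) \<partial>lborel)"
    by (intro Bochner_Integration.integral_cong) (auto simp: B'_def indicator_def)
  also have "\<dots> = (\<integral>x. indicator B' x * f x \<partial>lborel)"
  proof -
    have "(\<integral>x. indicator B' x * f x \<partial>lborel) = (\<integral>x. indicator B' x * f x \<partial>(distr lborel borel ((+) d)))"
      by (simp add: lborel_distr_plus)
    also have "\<dots> = (\<integral>x. indicator B' (d + x) * f (d + x) \<partial>lborel)"
      by (rule integral_distr) (use B' borel_measurable_continuous_onI[OF f] in \<open>auto intro!: borel_measurable_times\<close>)
    finally show ?thesis by (simp add: add.commute)
  qed
  also have "(\<integral>x. f x \<partial>lebesgue_on B) = (\<integral>x. indicator B x * f x \<partial>lborel)"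
    by (rule eq[OF f B(2)])
  also have "(\<integral>x. indicator B' x * f x \<partial>lborel) - (\<integral>x. indicator B x * f x \<partial>lborel)
     = (\<integral>x. indicator B' x * f x - indicator B x * f x \<partial>lborel)"
    by (rule Bochner_Integration.integral_diff[symmetric]) (use int f B B' bB' in auto)
  finally have "\<bar>\<integral>x. f (x + d) - f x \<partial>lebesgue_on B\<bar>
     = norm (\<integral>x. indicator B' x * f x - indicator B x * f x \<partial>lborel)" by simp
  also have "\<dots> \<le> (\<integral>x. norm (indicator B' x * f x - indicator B x * f x) \<partial>lborel)"
    by (rule integral_norm_bound)
  also have "\<dots> = (\<integral>x. indicator {x. (x - d \<in> B) \<noteq> (x \<in> B)} x * \<bar>f x\<bar> \<partial>lborel)"
    by (intro Bochner_Integration.integral_cong) (auto simp: B'_def indicator_def)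
  finally show ?thesis .
qed

section \<open>Barycentric coordinates on a tetrahedron\<close>

text \<open>
  \<open>S\<close> is the set of vertices. The barycentric coordinates are affine functions on the whole space, which
  makes their products available as test functions without restriction to the tetrahedron.
\<close>

locale tetrahedron =
  fixes S :: "(real^3) set"
  assumes aff_indep: "\<not> affine_dependent S" and card_S: "card S = 4"
begin

definition K :: "(real^3) set" where "K = interior (convex hull S)"

definition bary_grad :: "real^3 \<Rightarrow> real^3" where
  "bary_grad v = (SOME g. \<forall>w\<in>S. g \<bullet> (w - v) = (if w = v then 0 else -1))"

definition bary :: "real^3 \<Rightarrow> real^3 \<Rightarrow> real" where
  "bary v x = bary_grad v \<bullet> (x - v) + 1"

lemma finite_S: "finite S" and S_nonempty: "S \<noteq> {}"
  using card_S card.infinite[of S] by fastforce+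

text \<open>
  The edge vectors issuing from another vertex u are linearly independent, so a linear functional can be
  prescribed on them.
\<close>

lemma bary_grad_vertex:
  assumes v: "v \<in> S" and w: "w \<in> S"
  shows "bary_grad v \<bullet> (w - v) = (if w = v then 0 else -1)"
proof -
  have "card (S - {v}) = 3" using card_S v by (simp add: finite_S)
  then obtain u where u: "u \<in> S" "u \<noteq> v" by (metis DiffE card.empty insertI1 ex_in_conv zero_neq_numeral)
  let ?B = "(\<lambda>x. - u + x) ` (S - {u})"
  have "independent ?B" using aff_indep u(1) affine_dependent_iff_dependent2 by blast
  then obtain g :: "real^3 \<Rightarrow> real" where g: "linear g" "\<forall>x\<in>?B. g x = (if x = v - u then 1 else 0)"
    using linear_independent_extend[of ?B "\<lambda>x. if x = v - u then 1 else (0::real)"] by blast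
  have gi: "g x = adjoint g 1 \<bullet> x" for x
    using adjoint_works[OF g(1), of x 1] by (simp add: inner_commute)
  have gu: "g (w - u) = (if w = v then 1 else 0)" if "w \<in> S" for w
  proof (cases "w = u")
    case True then show ?thesis using u g(1) by (auto simp: linear_0)
  next
    case False
    then have "w - u \<in> ?B" using that by (auto simp: image_iff)
    then show ?thesis using g(2) by auto
  qed
  have "\<forall>w\<in>S. adjoint g 1 \<bullet> (w - v) = (if w = v then 0 else -1)"
  proof
    fix w assume "w \<in> S"
    have "adjoint g 1 \<bullet> (w - v) = g (w - u) - g (v - u)"
      by (simp add: gi[symmetric] linear_diff[OF g(1), symmetric])
    then show "adjoint g 1 \<bullet> (w - v) = (if w = v then 0 else -1)"
      using gu[OF \<open>w \<in> S\<close>] gu[OF v] by auto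
  qed
  then have "\<forall>w\<in>S. bary_grad v \<bullet> (w - v) = (if w = v then 0 else -1)"
    unfolding bary_grad_def by (rule someI)
  then show ?thesis using w by blast
qed

lemma bary_vertex:
  assumes "v \<in> S" "w \<in> S"
  shows "bary v w = (if w = v then 1 else 0)"
  using bary_grad_vertex[OF assms] by (simp add: bary_def)

lemma bary_diff: "bary v x - bary v y = bary_grad v \<bullet> (x - y)"
  by (simp add: bary_def inner_diff_right)

lemma bary_affine_combination:
  assumes v: "v \<in> S" and u: "sum u S = 1"
  shows "bary v (\<Sum>w\<in>S. u w *\<^sub>R w) = u v"
proof -
  have eq: "bary v x = bary_grad v \<bullet> x + bary v 0" for x
    by (simp add: bary_def inner_diff_right)
  have "bary v (\<Sum>w\<in>S. u w *\<^sub>R w) = (\<Sum>w\<in>S. u w * (bary_grad v \<bullet> w)) + bary v 0 * sum u S"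
    by (subst eq) (simp add: inner_sum_right u)
  also have "\<dots> = (\<Sum>w\<in>S. u w * (bary_grad v \<bullet> w + bary v 0))"
    by (simp add: sum_distrib_left sum_distrib_right sum.distrib algebra_simps)
  also have "\<dots> = (\<Sum>w\<in>S. u w * bary v w)"
    by (simp only: eq[symmetric])
  also have "\<dots> = (\<Sum>w\<in>S. if w = v then u w else 0)"
    by (intro sum.cong) (auto simp: bary_vertex v)
  also have "\<dots> = u v" using v finite_S by simp
  finally show ?thesis .
qed

lemma bary_sum: "(\<Sum>v\<in>S. bary v x) = 1"
  and bary_represent: "(\<Sum>v\<in>S. bary v x *\<^sub>R v) = x"
proof -
  have "affine hull S = UNIV"
    using affine_independent_span_eq[OF aff_indep] card_S by simp
  then obtain u where u: "sum u S = 1" "(\<Sum>v\<in>S. u v *\<^sub>R v) = x"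
    using affine_hull_finite[OF finite_S] by auto
  then have "bary v x = u v" if "v \<in> S" for v
    using bary_affine_combination[OF that u(1)] by simp
  with u show "(\<Sum>v\<in>S. bary v x) = 1" "(\<Sum>v\<in>S. bary v x *\<^sub>R v) = x" by (auto cong: sum.cong)
qed

text \<open>
  Choosing the vertex v with probability \<open>bary v x\<close> gives a random point with mean x.
\<close>

lemma bary_moment: "(\<Sum>v\<in>S. bary v x *\<^sub>R (v - x)) = 0"
  by (simp add: scaleR_diff_right sum_subtractf bary_represent bary_sum flip: scaleR_left.sum)

lemma hull_eq: "convex hull S = {x. \<forall>v\<in>S. 0 \<le> bary v x}"
proof (intro set_eqI iffI)
  fix x assume "x \<in> convex hull S"
  then show "x \<in> {x. \<forall>v\<in>S. 0 \<le> bary v x}"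
    unfolding convex_hull_finite[OF finite_S] using bary_affine_combination by auto
next
  fix x assume "x \<in> {x. \<forall>v\<in>S. 0 \<le> bary v x}"
  then show "x \<in> convex hull S"
    unfolding convex_hull_finite[OF finite_S] using bary_sum[of x] bary_represent[of x] by auto
qed

lemma K_eq: "K = {x. \<forall>v\<in>S. 0 < bary v x}"
proof -
  have "K = {y. \<exists>u. (\<forall>x \<in> S. 0 < u x) \<and> sum u S = 1 \<and> (\<Sum>x\<in>S. u x *\<^sub>R x) = y}"
    unfolding K_def using interior_convex_hull_explicit_minimal[OF aff_indep] by (simp add: card_S)
  also have "\<dots> = {x. \<forall>v\<in>S. 0 < bary v x}"
  proof (intro set_eqI iffI)
    fix x assume "x \<in> {x. \<forall>v\<in>S. 0 < bary v x}"
    then show "x \<in> {y. \<exists>u. (\<forall>x \<in> S. 0 < u x) \<and> sum u S = 1 \<and> (\<Sum>x\<in>S. u x *\<^sub>R x) = y}"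
      using bary_sum[of x] bary_represent[of x] by auto
  qed (use bary_affine_combination in auto)
  finally show ?thesis .
qed

lemma open_K: "open K" and bounded_K: "bounded K" and convex_K: "convex K"
  and K_borel: "K \<in> sets borel" and K_lebesgue: "K \<in> sets lebesgue"
proof -
  show "open K" unfolding K_def by simp
  show "convex K" unfolding K_def by simp
  have "bounded (convex hull S)"
    by (simp add: bounded_convex_hull finite_S finite_imp_bounded)
  then show "bounded K" unfolding K_def using bounded_subset interior_subset by blast
  show "K \<in> sets borel" "K \<in> sets lebesgue" unfolding K_def by auto
qed

lemma K_nonempty: "K \<noteq> {}"
proof -
  have "(\<Sum>v\<in>S. (1/4) *\<^sub>R v) \<in> K"
    unfolding K_eq using card_S by (auto simp: bary_affine_combination[of _ "\<lambda>_. 1/4"] )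
  then show ?thesis by auto
qed

lemma closure_K: "closure K = convex hull S"
proof -
  have "closed (convex hull S)"
    by (simp add: compact_convex_hull compact_imp_closed finite_S finite_imp_compact)
  then show ?thesis
    using K_nonempty unfolding K_def by (simp add: convex_closure_interior)
qed

lemma bary_frontier:
  assumes "x \<in> frontier K"
  shows "\<forall>v\<in>S. 0 \<le> bary v x" "\<exists>v\<in>S. bary v x = 0"
proof -
  have "x \<in> closure K" "x \<notin> K"
    using assms open_K by (auto simp: frontier_def interior_open)
  then have *: "\<forall>v\<in>S. 0 \<le> bary v x" "\<not> (\<forall>v\<in>S. 0 < bary v x)"
    unfolding closure_K hull_eq by (auto simp: K_eq)
  then show "\<forall>v\<in>S. 0 \<le> bary v x" "\<exists>v\<in>S. bary v x = 0"
    by force+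
qed

lemma frontier_K_null: "negligible (frontier K)"
  using negligible_convex_frontier[OF convex_K] .

lemma C1_grad_bary: "C1_grad (bary v) (\<lambda>x. bary_grad v)"
proof -
  have "bary v = (\<lambda>x. bary_grad v \<bullet> x + (1 - bary_grad v \<bullet> v))"
    by (auto simp: bary_def inner_diff_right)
  then show ?thesis using C1_grad_affine by metis
qed

lemma continuous_bary: "continuous_on UNIV (bary v)"
  using C1_gradD(3)[OF C1_grad_bary] .

lemma symdiff_norm_le:
  assumes "\<And>x. x \<in> K \<Longrightarrow> norm x \<le> B" and "(x - d \<in> K) \<noteq> (x \<in> K)"
  shows "norm x \<le> B + norm d"
proof -
  have "norm (x - d) \<le> B \<or> norm x \<le> B" using assms by auto
  moreover have "norm x \<le> norm (x - d) + norm d" by (metis diff_add_cancel norm_triangle_ineq)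
  ultimately show ?thesis using norm_ge_zero[of d] by linarith
qed

text \<open>
  Off the null set \<open>frontier K\<close> a point and its small translates lie on the same side of the boundary.
\<close>

lemma symdiff_measure_tendsto_0:
  fixes d :: "nat \<Rightarrow> real^3"
  assumes d: "d \<longlonglongrightarrow> 0" and dR: "\<And>n. norm (d n) \<le> R"
  shows "(\<lambda>n. \<integral>x. indicator {x. (x - d n \<in> K) \<noteq> (x \<in> K)} x \<partial>lborel) \<longlonglongrightarrow> (0::real)"
proof -
  obtain B where B: "\<And>x. x \<in> K \<Longrightarrow> norm x \<le> B" using bounded_K bounded_iff by blast
  let ?D = "\<lambda>n. {x. (x - d n \<in> K) \<noteq> (x \<in> K)}"
  have "(\<lambda>n. \<integral>x. indicator (?D n) x \<partial>lborel) \<longlonglongrightarrow> (\<integral>x. (0::real) \<partial>(lborel :: (real^3) measure))"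
  proof (rule integral_dominated_convergence[where w = "indicator (cball 0 (B + R))"])
    have [measurable]: "K \<in> sets borel" by (rule K_borel)
    have "?D n \<in> sets borel" for n
      by measurable
    then show "(indicator (?D n) :: _ \<Rightarrow> real) \<in> borel_measurable lborel" for n by simp
    show "integrable lborel (indicator (cball 0 (B + R)) :: real^3 \<Rightarrow> real)"
      using emeasure_bounded_finite[OF bounded_cball, of "0::real^3" "B + R"]
      by (intro integrable_real_indicator) auto
    show "AE x in lborel. norm (indicator (?D n) x :: real) \<le> indicator (cball 0 (B + R)) x" for n
    proof (intro AE_I2)
      fix x
      have "norm x \<le> B + R" if "x \<in> ?D n"
        using symdiff_norm_le[OF B, of x "d n"] dR[of n] that by auto
      then show "norm (indicator (?D n) x :: real) \<le> indicator (cball 0 (B + R)) x"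
        by (auto simp: indicator_def)
    qed
    have "AE x in lborel. x \<notin> frontier K"
      using frontier_K_null by (intro AE_not_in) (simp add: negligible_iff_null_sets null_sets_completion_iff)
    then show "AE x in lborel. (\<lambda>n. indicator (?D n) x :: real) \<longlonglongrightarrow> 0"
    proof eventually_elim
      fix x assume x: "x \<notin> frontier K"
      obtain e where e: "e > 0" "ball x e \<subseteq> K \<or> ball x e \<inter> K = {}"
      proof (cases "x \<in> K")
        case True
        then show ?thesis using open_K that by (meson openE)
      next
        case False
        with x have "x \<in> - closure K" using open_K by (auto simp: frontier_def interior_open)
        then obtain e where "e > 0" "ball x e \<subseteq> - closure K" by (meson closed_closure open_Compl openE)
        then show ?thesis using that closure_subset by blast
      qed
      have "\<forall>\<^sub>F n in sequentially. norm (d n) < e"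
        using d e(1) by (simp add: tendsto_iff dist_norm)
      then have "\<forall>\<^sub>F n in sequentially. indicator (?D n) x = (0::real)"
      proof eventually_elim
        case (elim n)
        then have "x - d n \<in> ball x e" "x \<in> ball x e" using e(1) by (auto simp: dist_norm)
        then have "(x - d n \<in> K) = (x \<in> K)" using e(2) by blast
        then show ?case by (simp add: indicator_def)
      qed
      then show "(\<lambda>n. indicator (?D n) x :: real) \<longlonglongrightarrow> 0" by (rule tendsto_eventually)
    qed
  qed auto
  then show ?thesis by simp
qed

text \<open>
  In the direction \<open>v - w\<close> only the coordinates of v and w vary, so a segment in this direction leaves \<open>K\<close>
  through a face on which f vanishes. Hence f is of order \<open>1 / n\<close> on the symmetric difference of \<open>K\<close> and its
  translate by \<open>(v - w) / n\<close>. The factor n is thereby compensated, and the measure of the symmetric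
  difference tends to zero.
\<close>

lemma integral_edge_derivative_zero:
  assumes v: "v \<in> S" and w: "w \<in> S" and f: "C1_grad f f'"
    and zero: "\<And>x. bary v x = 0 \<or> bary w x = 0 \<Longrightarrow> f x = 0"
  shows "(\<integral>x. f' x \<bullet> (v - w) \<partial>lebesgue_on K) = 0"
proof -
  let ?e = "v - w"
  obtain B where B: "\<And>x. x \<in> K \<Longrightarrow> norm x \<le> B" using bounded_K bounded_iff by blast
  obtain M where M: "M \<ge> 0" "\<And>x y. norm x \<le> B + norm ?e \<Longrightarrow> norm y \<le> B + norm ?e
       \<Longrightarrow> \<bar>f x - f y\<bar> \<le> M * norm (x - y)"
    using C1_grad_lipschitz_on_ball[OF f] by blast
  define d where "d = (\<lambda>n. (1 / real (Suc n)) *\<^sub>R ?e)"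
  have nd: "norm (d n) = norm ?e / real (Suc n)" for n by (simp add: d_def del: of_nat_Suc)
  have nd': "norm (d n) \<le> norm ?e" for n
    unfolding nd by (simp add: divide_le_eq mult_le_cancel_left1)
  have d0: "d \<longlonglongrightarrow> 0"
  proof -
    have "(\<lambda>n. (1 / real (Suc n)) *\<^sub>R ?e) \<longlonglongrightarrow> 0 *\<^sub>R ?e"
      by (intro tendsto_intros) (use lim_1_over_n[where 'a=real, THEN LIMSEQ_Suc] in auto)
    then show ?thesis by (simp add: d_def)
  qed
  let ?D = "\<lambda>n. {x. (x - d n \<in> K) \<noteq> (x \<in> K)}"
  have D_bound: "norm x \<le> B + norm ?e" if "x \<in> ?D n" for x n
    using symdiff_norm_le[OF B, of x "d n"] nd'[of n] that by auto
  have small: "\<bar>f x\<bar> \<le> M * norm (d n)" if x: "x \<in> ?D n" for x n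
  proof -
    let ?L = "closed_segment (x - d n) x"
    have "?L \<inter> frontier K \<noteq> {}"
      by (rule connected_Int_frontier) (use x in auto)
    then obtain y where y: "y \<in> ?L" "y \<in> frontier K" by auto
    then obtain t where t: "0 \<le> t" "t \<le> 1" "y = (1 - t) *\<^sub>R (x - d n) + t *\<^sub>R x"
      by (auto simp: closed_segment_def)
    then have yx: "y = x - (1 - t) *\<^sub>R d n" by (simp add: algebra_simps)
    obtain u where u: "u \<in> S" "bary u y = 0" using bary_frontier[OF y(2)] by auto
    have "u = v \<or> u = w"
    proof (rule ccontr)
      assume n: "\<not> (u = v \<or> u = w)"
      have "bary_grad u \<bullet> ?e = 0"
        using bary_vertex[OF u(1) v] bary_vertex[OF u(1) w] n bary_diff[of u v w] by auto
      then have "bary_grad u \<bullet> d n = 0" by (simp add: d_def)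
      then have "bary u x = 0" "bary u (x - d n) = 0"
        using bary_diff[of u x y] bary_diff[of u "x - d n" y] u(2)
        by (auto simp: yx inner_diff_right)
      then show False using x u(1) unfolding K_eq by force
    qed
    then have "f y = 0" using zero u by auto
    have "norm (x - y) = (1 - t) * norm (d n)" using t(2) by (simp add: yx)
    then have n1: "norm (x - y) \<le> norm (d n)" using t by (simp add: mult_left_le_one_le)
    have n2: "norm x \<le> B + norm ?e" by (rule D_bound[OF x])
    have n3: "norm y \<le> B + norm ?e"
    proof -
      have "y \<in> closure K" using y(2) by (simp add: frontier_def)
      moreover have "closure K \<subseteq> cball 0 B" by (rule closure_minimal) (use B in auto)
      ultimately have "norm y \<le> B" by auto
      then show ?thesis using norm_ge_zero[of ?e] by linarith
    qed
    have "\<bar>f x - f y\<bar> \<le> M * norm (x - y)" using M(2) n2 n3 by auto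
    also have "\<dots> \<le> M * norm (d n)" using n1 M(1) by (intro mult_left_mono) auto
    finally show ?thesis using \<open>f y = 0\<close> by simp
  qed
  have ind: "integrable lborel (indicator (?D n) :: _ \<Rightarrow> real)" for n
  proof -
    have [measurable]: "K \<in> sets borel" by (rule K_borel)
    have "?D n \<in> sets borel" by measurable
    moreover have "bounded (?D n)" using D_bound[of _ n] by (intro boundedI)
    ultimately show ?thesis
      using emeasure_bounded_finite by (intro integrable_real_indicator) auto
  qed
  have bound: "\<bar>real (Suc n) * (\<integral>x. f (x + (1 / real (Suc n)) *\<^sub>R ?e) - f x \<partial>lebesgue_on K)\<bar>
      \<le> M * norm ?e * (\<integral>x. indicator (?D n) x \<partial>lborel)" for n
  proof -
    have "\<bar>\<integral>x. f (x + d n) - f x \<partial>lebesgue_on K\<bar> \<le> (\<integral>x. indicator (?D n) x * \<bar>f x\<bar> \<partial>lborel)"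
      by (rule difference_integral_le_symdiff[OF C1_gradD(3)[OF f] bounded_K K_borel])
    also have "\<dots> \<le> (\<integral>x. (M * norm (d n)) * indicator (?D n) x \<partial>lborel)"
    proof (rule integral_mono_AE')
      show "integrable lborel (\<lambda>x. (M * norm (d n)) * indicator (?D n) x)"
        by (intro integrable_mult_right ind)
      have "indicator (?D n) x * \<bar>f x\<bar> \<le> (M * norm (d n)) * indicator (?D n) x" for x
        by (cases "x \<in> ?D n") (use small in \<open>auto simp del: mem_Collect_eq\<close>)
      then show "AE x in lborel. indicator (?D n) x * \<bar>f x\<bar> \<le> (M * norm (d n)) * indicator (?D n) x"
        by blast
    qed (simp add: M(1))
    also have "\<dots> = (M * norm (d n)) * (\<integral>x. indicator (?D n) x \<partial>lborel)" by simp
    finally have "real (Suc n) * \<bar>\<integral>x. f (x + d n) - f x \<partial>lebesgue_on K\<bar>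
      \<le> real (Suc n) * ((M * norm (d n)) * (\<integral>x. indicator (?D n) x \<partial>lborel))"
      by (intro mult_left_mono) auto
    also have "\<dots> = M * norm ?e * (\<integral>x. indicator (?D n) x \<partial>lborel)"
      by (simp add: nd del: of_nat_Suc)
    finally show ?thesis by (simp add: d_def abs_mult del: of_nat_Suc)
  qed
  have "(\<lambda>n. M * norm ?e * (\<integral>x. indicator (?D n) x \<partial>lborel)) \<longlonglongrightarrow> M * norm ?e * 0"
    by (intro tendsto_intros symdiff_measure_tendsto_0[OF d0 nd'])
  then have "(\<lambda>n. real (Suc n) * (\<integral>x. f (x + (1 / real (Suc n)) *\<^sub>R ?e) - f x \<partial>lebesgue_on K)) \<longlonglongrightarrow> 0"
    unfolding mult_zero_right
    by (rule Lim_null_comparison[rotated])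
       (intro always_eventually allI, unfold real_norm_def, rule bound)
  then show ?thesis
    using difference_quotient_integral_tendsto[OF f bounded_K K_lebesgue, of ?e] LIMSEQ_unique by blast
qed

end

section \<open>The Wright-Fisher diffusion on a tetrahedron\<close>

context tetrahedron begin

definition integral_K :: "(real^3 \<Rightarrow> real) \<Rightarrow> real" where
  "integral_K f = (\<integral>x. f x \<partial>lebesgue_on K)"

lemma integrable_K:
  fixes f :: "real^3 \<Rightarrow> real"
  shows "continuous_on UNIV f \<Longrightarrow> integrable (lebesgue_on K) f"
  by (rule integrable_bounded_continuous[OF _ bounded_K K_lebesgue])

lemma integral_K_add: "continuous_on UNIV f \<Longrightarrow> continuous_on UNIV g \<Longrightarrow> integral_K (\<lambda>x. f x + g x) = integral_K f + integral_K g"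
  unfolding integral_K_def by (intro Bochner_Integration.integral_add integrable_K)

lemma integral_K_diff: "continuous_on UNIV f \<Longrightarrow> continuous_on UNIV g \<Longrightarrow> integral_K (\<lambda>x. f x - g x) = integral_K f - integral_K g"
  unfolding integral_K_def by (intro Bochner_Integration.integral_diff integrable_K)

lemma integral_K_cmult: "integral_K (\<lambda>x. c * f x) = c * integral_K f"
  unfolding integral_K_def by simp

lemma integral_K_sum: "(\<And>i. i \<in> I \<Longrightarrow> continuous_on UNIV (f i)) \<Longrightarrow> integral_K (\<lambda>x. \<Sum>i\<in>I. f i x) = (\<Sum>i\<in>I. integral_K (f i))"
  unfolding integral_K_def by (intro Bochner_Integration.integral_sum integrable_K)

lemma integral_K_mono:
  assumes "continuous_on UNIV f" "continuous_on UNIV g" "\<And>x. x \<in> K \<Longrightarrow> f x \<le> g x"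
  shows "integral_K f \<le> integral_K g"
  unfolding integral_K_def using assms
  by (intro integral_mono_AE integrable_K) (auto simp: space_restrict_space intro!: AE_I2)

lemma integral_K_nonneg: "(\<And>x. x \<in> K \<Longrightarrow> 0 \<le> f x) \<Longrightarrow> 0 \<le> integral_K f"
  unfolding integral_K_def by (intro integral_nonneg_AE AE_I2) (auto simp: space_restrict_space)

text \<open>
  The carre du champ of the Wright-Fisher diffusion, evaluated at gradients a and b: the covariance of
  \<open>a \<bullet> V\<close> and \<open>b \<bullet> V\<close> for the random vertex \<open>V\<close> that equals w with probability \<open>bary w x\<close>. In terms of
  derivatives along edges it is the sum of \<open>bary v x * bary w x * (a \<bullet> (v - w)) * (b \<bullet> (v - w))\<close> over the
  six edges.
\<close>

definition carre :: "real^3 \<Rightarrow> real^3 \<Rightarrow> real^3 \<Rightarrow> real" where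
  "carre x a b = (\<Sum>w\<in>S. bary w x * (a \<bullet> (w - x)) * (b \<bullet> (w - x)))"

lemma carre_commute: "carre x a b = carre x b a"
  unfolding carre_def by (intro sum.cong) auto

lemma carre_add: "carre x a (b + c) = carre x a b + carre x a c"
  unfolding carre_def by (simp add: inner_add_left distrib_left sum.distrib)

lemma carre_add_left: "carre x (a + b) c = carre x a c + carre x b c"
  by (metis carre_add carre_commute)

lemma carre_scale: "carre x a (c *\<^sub>R b) = c * carre x a b"
  unfolding carre_def by (simp add: algebra_simps sum_distrib_left)

lemma carre_scale_left: "carre x (c *\<^sub>R a) b = c * carre x a b"
  by (metis carre_scale carre_commute)

lemma carre_diff: "carre x a (b - c) = carre x a b - carre x a c"
  unfolding carre_def by (simp add: inner_diff_left right_diff_distrib sum_subtractf)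

lemma carre_diff_left: "carre x (a - b) c = carre x a c - carre x b c"
  by (metis carre_diff carre_commute)

lemma carre_zero: "carre x a 0 = 0"
  unfolding carre_def by simp

lemma carre_nonneg: "x \<in> K \<Longrightarrow> 0 \<le> carre x a a"
  unfolding carre_def K_eq by (intro sum_nonneg) (simp add: mult.assoc less_imp_le)

lemma continuous_carre:
  "continuous_on UNIV a \<Longrightarrow> continuous_on UNIV b \<Longrightarrow> continuous_on UNIV (\<lambda>x. carre x (a x) (b x))"
  unfolding carre_def by (intro continuous_intros continuous_bary)

lemma bary_moment_inner: "(\<Sum>v\<in>S. bary v x * (a \<bullet> (v - x))) = 0"
  using arg_cong[OF bary_moment[of x], of "\<lambda>y. a \<bullet> y"] by (simp add: inner_sum_right)

lemma carre_bary:
  assumes v: "v \<in> S"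
  shows "carre x a (bary_grad v) = bary v x * (a \<bullet> (v - x))"
proof -
  have "bary_grad v \<bullet> (w - x) = (if w = v then 1 else 0) - bary v x" if "w \<in> S" for w
    using bary_diff[of v w x] bary_vertex[OF v that] by auto
  then have "carre x a (bary_grad v) = (\<Sum>w\<in>S. bary w x * (a \<bullet> (w - x)) * ((if w = v then 1 else 0) - bary v x))"
    unfolding carre_def by (intro sum.cong) auto
  also have "\<dots> = (\<Sum>w\<in>S. (if w = v then bary w x * (a \<bullet> (w - x)) else 0)
      - bary w x * (a \<bullet> (w - x)) * bary v x)"
    by (intro sum.cong) (auto simp: right_diff_distrib)
  also have "\<dots> = (\<Sum>w\<in>S. if w = v then bary w x * (a \<bullet> (w - x)) else 0)
      - (\<Sum>w\<in>S. bary w x * (a \<bullet> (w - x))) * bary v x"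
    by (simp only: sum_subtractf sum_distrib_right)
  also have "\<dots> = bary v x * (a \<bullet> (v - x))"
    using v finite_S by (simp add: bary_moment_inner)
  finally show ?thesis .
qed

lemma carre_bary_bary:
  assumes "v \<in> S" "w \<in> S"
  shows "carre x (bary_grad w) (bary_grad v) = bary v x * ((if w = v then 1 else 0) - bary w x)"
  using carre_bary[OF assms(1)] bary_diff[of w v x] bary_vertex[OF assms(2,1)] by auto

text \<open>
  \<open>carre x a a\<close> is the variance of the numbers \<open>a \<bullet> v\<close> under the weights \<open>bary v x\<close>. The mean square
  deviation from the midrange is at least the variance and at most a quarter of the squared range
  (Popoviciu's inequality).
\<close>

lemma carre_le:
  assumes x: "x \<in> K"
  shows "carre x a a \<le> (diameter K)\<^sup>2 / 4 * (a \<bullet> a)"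
proof -
  have dS: "norm (v - w) \<le> diameter K" if "v \<in> S" "w \<in> S" for v w
  proof -
    have "v \<in> closure K" "w \<in> closure K"
      unfolding closure_K using that by (auto intro: hull_inc)
    then show ?thesis
      using diameter_bounded_bound[of "closure K" v w] bounded_K
      by (simp add: dist_norm diameter_closure bounded_closure)
  qed
  define t where "t = (\<lambda>v. a \<bullet> v)"
  have fin: "finite (t ` S)" "t ` S \<noteq> {}" using finite_S S_nonempty by auto
  \<comment> \<open>The midrange: every value \<open>a \<bullet> v\<close> is within half the range of it.\<close>
  define m where "m = (Max (t ` S) + Min (t ` S)) / 2"
  have "Max (t ` S) \<in> t ` S" "Min (t ` S) \<in> t ` S" using fin Max_in Min_in by auto
  then obtain p q where pq: "p \<in> S" "q \<in> S" "Max (t ` S) = t p" "Min (t ` S) = t q" by auto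
  have "t p - t q \<le> norm a * norm (p - q)"
    unfolding t_def by (simp add: norm_cauchy_schwarz flip: inner_diff_right)
  also have "\<dots> \<le> norm a * diameter K" using dS pq by (intro mult_left_mono) auto
  finally have range: "t p - t q \<le> norm a * diameter K" .
  have near: "(t v - m)\<^sup>2 \<le> (norm a * diameter K / 2)\<^sup>2" if "v \<in> S" for v
  proof -
    have "t v \<le> t p" "t q \<le> t v" using pq that fin by (metis Max_ge Min_le imageI)+
    then have "\<bar>t v - m\<bar> \<le> norm a * diameter K / 2"
      using range unfolding m_def pq by (simp add: abs_le_iff field_simps)
    then show ?thesis by (metis abs_ge_zero power2_abs power_mono)
  qed
  have "carre x a a = (\<Sum>v\<in>S. bary v x * (t v - m)\<^sup>2) - (a \<bullet> x - m)\<^sup>2"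
  proof -
    have "(\<Sum>v\<in>S. bary v x * (t v - m)\<^sup>2)
      = (\<Sum>v\<in>S. bary v x * (a \<bullet> (v - x)) * (a \<bullet> (v - x))
           + 2 * (a \<bullet> x - m) * (bary v x * (a \<bullet> (v - x))) + (a \<bullet> x - m)\<^sup>2 * bary v x)"
      by (intro sum.cong) (auto simp: t_def inner_diff_right power2_eq_square algebra_simps)
    also have "\<dots> = carre x a a + 2 * (a \<bullet> x - m) * (\<Sum>v\<in>S. bary v x * (a \<bullet> (v - x)))
        + (a \<bullet> x - m)\<^sup>2 * (\<Sum>v\<in>S. bary v x)"
      by (simp add: carre_def sum.distrib sum_distrib_left)
    finally show ?thesis using bary_moment_inner bary_sum by simp
  qed
  also have "\<dots> \<le> (\<Sum>v\<in>S. bary v x * (t v - m)\<^sup>2)" by simp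
  also have "\<dots> \<le> (\<Sum>v\<in>S. bary v x * (norm a * diameter K / 2)\<^sup>2)"
    using x near unfolding K_eq by (intro sum_mono mult_left_mono) (auto intro: less_imp_le)
  also have "\<dots> = (norm a * diameter K / 2)\<^sup>2" by (simp add: bary_sum flip: sum_distrib_right)
  also have "\<dots> = (diameter K)\<^sup>2 / 4 * (a \<bullet> a)"
    by (simp add: power_divide power_mult_distrib power2_norm_eq_inner)
  finally show ?thesis .
qed

text \<open>
  r is the image of f under the generator of the diffusion, in the sense of its Dirichlet form. In this weak
  form second derivatives do not occur, and the degeneracy of the diffusion at the boundary of the
  tetrahedron appears as the absence of boundary terms.
\<close>

definition weak_gen :: "(real^3 \<Rightarrow> real) \<Rightarrow> (real^3 \<Rightarrow> real^3) \<Rightarrow> (real^3 \<Rightarrow> real) \<Rightarrow> bool" where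
  "weak_gen f f' r \<longleftrightarrow> C1_grad f f' \<and> continuous_on UNIV r \<and>
     (\<forall>u u'. C1_grad u u' \<longrightarrow> integral_K (\<lambda>x. carre x (u' x) (f' x)) = - integral_K (\<lambda>x. u x * r x))"

lemma weak_gen_const: "weak_gen (\<lambda>x. c) (\<lambda>x. 0) (\<lambda>x. 0)"
  unfolding weak_gen_def by (auto simp: C1_grad_const carre_zero integral_K_def)

lemma weak_gen_add:
  assumes "weak_gen f f' r" "weak_gen g g' s"
  shows "weak_gen (\<lambda>x. f x + g x) (\<lambda>x. f' x + g' x) (\<lambda>x. r x + s x)"
  unfolding weak_gen_def
proof (intro conjI allI impI)
  show "C1_grad (\<lambda>x. f x + g x) (\<lambda>x. f' x + g' x)" "continuous_on UNIV (\<lambda>x. r x + s x)"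
    using assms by (auto simp: weak_gen_def intro!: C1_grad_add continuous_intros)
  fix u u' assume u: "C1_grad u u'"
  have c: "continuous_on UNIV f'" "continuous_on UNIV g'" "continuous_on UNIV r" "continuous_on UNIV s"
    "continuous_on UNIV u" "continuous_on UNIV u'"
    using assms u C1_gradD by (auto simp: weak_gen_def)
  have "integral_K (\<lambda>x. carre x (u' x) (f' x + g' x)) = integral_K (\<lambda>x. carre x (u' x) (f' x)) + integral_K (\<lambda>x. carre x (u' x) (g' x))"
    by (subst integral_K_add[symmetric]) (auto intro!: continuous_carre c simp: carre_add)
  also have "\<dots> = - integral_K (\<lambda>x. u x * r x) - integral_K (\<lambda>x. u x * s x)"
    using assms u by (auto simp: weak_gen_def)
  also have "\<dots> = - integral_K (\<lambda>x. u x * (r x + s x))"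
    by (simp add: distrib_left integral_K_add continuous_intros c)
  finally show "integral_K (\<lambda>x. carre x (u' x) (f' x + g' x)) = - integral_K (\<lambda>x. u x * (r x + s x))" .
qed

text \<open>
  The field \<open>bary v x *\<^sub>R (v - x)\<close>, which represents the carre du champ with the coordinate of v, is the sum
  over w of the fields \<open>(bary v x * bary w x) *\<^sub>R (v - w)\<close>. Each of these can be integrated by parts along its
  edge, and its divergence is \<open>bary w x - bary v x\<close>.
\<close>

lemma weak_gen_bary:
  assumes v: "v \<in> S"
  shows "weak_gen (bary v) (\<lambda>x. bary_grad v) (\<lambda>x. 1 - 4 * bary v x)"
  unfolding weak_gen_def
proof (intro conjI allI impI)
  show "C1_grad (bary v) (\<lambda>x. bary_grad v)" by (rule C1_grad_bary)
  show "continuous_on UNIV (\<lambda>x. 1 - 4 * bary v x)" by (intro continuous_intros continuous_bary)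
  fix u u' assume u: "C1_grad u u'"
  have c: "continuous_on UNIV u" "continuous_on UNIV u'" using C1_gradD[OF u] by auto
  let ?F = "\<lambda>w x. (bary v x * bary w x) * (u' x \<bullet> (v - w)) + u x * (bary w x - bary v x)"
  have F0: "integral_K (?F w) = 0" if w: "w \<in> S" for w
  proof (cases "w = v")
    case True then show ?thesis by (simp add: integral_K_def)
  next
    case False
    let ?f = "\<lambda>x. (bary v x * bary w x) * u x"
    let ?f' = "\<lambda>x. (bary v x * bary w x) *\<^sub>R u' x
        + u x *\<^sub>R (bary v x *\<^sub>R bary_grad w + bary w x *\<^sub>R bary_grad v)"
    have C: "C1_grad ?f ?f'" by (intro C1_grad_mult C1_grad_bary u)
    have "(\<integral>x. ?f' x \<bullet> (v - w) \<partial>lebesgue_on K) = 0"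
      by (rule integral_edge_derivative_zero[OF v w C]) auto
    moreover
    have "bary_grad v \<bullet> (v - w) = 1" "bary_grad w \<bullet> (v - w) = -1"
      using bary_diff[of v v w] bary_diff[of w v w] bary_vertex v w False by auto
    then have "?f' x \<bullet> (v - w) = ?F w x" for x
      by (simp add: inner_add_left distrib_left right_diff_distrib)
    ultimately show ?thesis unfolding integral_K_def by simp
  qed
  have Fsum: "(\<Sum>w\<in>S. ?F w x) = carre x (u' x) (bary_grad v) + u x * (1 - 4 * bary v x)" for x
  proof -
    have "(\<Sum>w\<in>S. bary w x *\<^sub>R (v - w)) = v - x"
      by (simp add: scaleR_diff_right sum_subtractf bary_represent bary_sum flip: scaleR_left.sum)
    then have "u' x \<bullet> (v - x) = (\<Sum>w\<in>S. bary w x * (u' x \<bullet> (v - w)))"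
      by (metis (no_types, lifting) inner_scaleR_right inner_sum_right sum.cong)
    then have "(\<Sum>w\<in>S. (bary v x * bary w x) * (u' x \<bullet> (v - w))) = carre x (u' x) (bary_grad v)"
      by (simp add: carre_bary[OF v] sum_distrib_left mult.assoc)
    moreover have "(\<Sum>w\<in>S. u x * (bary w x - bary v x)) = u x * (1 - 4 * bary v x)"
      by (simp add: sum_distrib_left[symmetric] sum_subtractf bary_sum card_S)
    ultimately show ?thesis by (simp add: sum.distrib)
  qed
  have "0 = (\<Sum>w\<in>S. integral_K (?F w))" using F0 by simp
  also have "\<dots> = integral_K (\<lambda>x. \<Sum>w\<in>S. ?F w x)"
    by (rule integral_K_sum[symmetric]) (intro continuous_intros continuous_bary c)
  also have "\<dots> = integral_K (\<lambda>x. carre x (u' x) (bary_grad v)) + integral_K (\<lambda>x. u x * (1 - 4 * bary v x))"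
    unfolding Fsum by (intro integral_K_add continuous_carre continuous_intros continuous_bary c)
  finally show "integral_K (\<lambda>x. carre x (u' x) (bary_grad v)) = - integral_K (\<lambda>x. u x * (1 - 4 * bary v x))" by simp
qed

text \<open>
  The Leibniz rule \<open>L (f g) = f L g + g L f + 2 \<Gamma>(f, g)\<close> of a diffusion generator. The weak form of \<open>L g\<close> is tested
  with \<open>u f\<close>, that of \<open>L f\<close> with \<open>u g\<close>.
\<close>

lemma weak_gen_mult:
  assumes f: "weak_gen f f' r" and g: "weak_gen g g' s"
  shows "weak_gen (\<lambda>x. f x * g x) (\<lambda>x. f x *\<^sub>R g' x + g x *\<^sub>R f' x)
           (\<lambda>x. f x * s x + g x * r x + 2 * carre x (f' x) (g' x))"
  unfolding weak_gen_def
proof (intro conjI allI impI)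
  have cf: "C1_grad f f'" and cg: "C1_grad g g'" using f g by (auto simp: weak_gen_def)
  note c = C1_gradD(2,3)[OF cf] C1_gradD(2,3)[OF cg]
  have c2: "continuous_on UNIV r" "continuous_on UNIV s" using f g by (auto simp: weak_gen_def)
  show "C1_grad (\<lambda>x. f x * g x) (\<lambda>x. f x *\<^sub>R g' x + g x *\<^sub>R f' x)"
    by (rule C1_grad_mult[OF cf cg])
  show "continuous_on UNIV (\<lambda>x. f x * s x + g x * r x + 2 * carre x (f' x) (g' x))"
    by (intro continuous_intros continuous_carre c c2)
  fix u u' assume u: "C1_grad u u'"
  note cu = C1_gradD(2,3)[OF u]
  have 1: "integral_K (\<lambda>x. carre x (u x *\<^sub>R f' x + f x *\<^sub>R u' x) (g' x)) = - integral_K (\<lambda>x. (u x * f x) * s x)"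
    using g C1_grad_mult[OF u cf] unfolding weak_gen_def by blast
  have 2: "integral_K (\<lambda>x. carre x (u x *\<^sub>R g' x + g x *\<^sub>R u' x) (f' x)) = - integral_K (\<lambda>x. (u x * g x) * r x)"
    using f C1_grad_mult[OF u cg] unfolding weak_gen_def by blast
  have "integral_K (\<lambda>x. carre x (u' x) (f x *\<^sub>R g' x + g x *\<^sub>R f' x))
    = integral_K (\<lambda>x. (carre x (u x *\<^sub>R f' x + f x *\<^sub>R u' x) (g' x) + carre x (u x *\<^sub>R g' x + g x *\<^sub>R u' x) (f' x))
            - 2 * (u x * carre x (f' x) (g' x)))"
    by (intro arg_cong[where f = integral_K])
       (auto simp: carre_add carre_add_left carre_scale carre_scale_left carre_commute[of _ "g' _" "f' _"])
  also have "\<dots> = - integral_K (\<lambda>x. (u x * f x) * s x) - integral_K (\<lambda>x. (u x * g x) * r x)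
      - integral_K (\<lambda>x. 2 * (u x * carre x (f' x) (g' x)))"
    by (subst integral_K_diff integral_K_add; (intro continuous_intros continuous_carre c c2 cu)?)+ (simp add: 1 2)
  also have "\<dots> = - integral_K (\<lambda>x. ((u x * f x) * s x + (u x * g x) * r x) + 2 * (u x * carre x (f' x) (g' x)))"
    by (subst integral_K_add; (intro continuous_intros continuous_carre c c2 cu)?)+ simp
  also have "\<dots> = - integral_K (\<lambda>x. u x * (f x * s x + g x * r x + 2 * carre x (f' x) (g' x)))"
    by (simp add: algebra_simps)
  finally show "integral_K (\<lambda>x. carre x (u' x) (f x *\<^sub>R g' x + g x *\<^sub>R f' x)) = \<dots>" .
qed

end

section \<open>Polynomials on a tetrahedron\<close>

text \<open>
  The linear span of a family of functions, generated one basis element at a time for induction over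
  linear combinations.
\<close>

inductive_set lspan :: "(real^3 \<Rightarrow> real) set \<Rightarrow> (real^3 \<Rightarrow> real) set" for B where
  lspan_zero: "(\<lambda>x. 0) \<in> lspan B"
| lspan_step: "b \<in> B \<Longrightarrow> f \<in> lspan B \<Longrightarrow> (\<lambda>x. c * b x + f x) \<in> lspan B"

lemma lspan_base: "b \<in> B \<Longrightarrow> b \<in> lspan B"
  using lspan_step[OF _ lspan_zero, of b B 1] by simp

lemma lspan_add: "f \<in> lspan B \<Longrightarrow> g \<in> lspan B \<Longrightarrow> (\<lambda>x. f x + g x) \<in> lspan B"
  by (induction rule: lspan.induct) (auto simp: add.assoc intro: lspan_step)

lemma lspan_cmult:
  assumes "f \<in> lspan B"
  shows "(\<lambda>x. c * f x) \<in> lspan B"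
  using assms
proof (induction rule: lspan.induct)
  case (lspan_step b f d)
  then show ?case using lspan.lspan_step[of b B "\<lambda>x. c * f x" "c * d"]
    by (simp add: algebra_simps)
qed (simp add: lspan_zero)

lemma lspan_minus: "f \<in> lspan B \<Longrightarrow> (\<lambda>x. - f x) \<in> lspan B"
  using lspan_cmult[of f B "-1"] by simp

lemma lspan_diff: "f \<in> lspan B \<Longrightarrow> g \<in> lspan B \<Longrightarrow> (\<lambda>x. f x - g x) \<in> lspan B"
  using lspan_add[OF _ lspan_minus, of f B g] by simp

lemma lspan_sum: "(\<And>i. i \<in> I \<Longrightarrow> F i \<in> lspan B) \<Longrightarrow> (\<lambda>x. \<Sum>i\<in>I. F i x) \<in> lspan B"
  by (induction I rule: infinite_finite_induct) (auto intro: lspan_zero lspan_add)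

lemma lspan_mono: "f \<in> lspan B \<Longrightarrow> B \<subseteq> C \<Longrightarrow> f \<in> lspan C"
  by (induction rule: lspan.induct) (auto intro: lspan.intros)

lemma lspan_continuous:
  assumes "f \<in> lspan B" "\<And>b. b \<in> B \<Longrightarrow> continuous_on UNIV b"
  shows "continuous_on UNIV f"
  using assms by (induction rule: lspan.induct) (auto intro!: continuous_intros)

context tetrahedron begin

lemma integral_K_orthogonal_lspan:
  assumes f: "f \<in> lspan B" and u: "continuous_on UNIV u"
    and B: "\<And>b. b \<in> B \<Longrightarrow> continuous_on UNIV b" and o: "\<And>b. b \<in> B \<Longrightarrow> integral_K (\<lambda>x. u x * b x) = 0"
  shows "integral_K (\<lambda>x. u x * f x) = 0"
  using f
proof (induction rule: lspan.induct)
  case lspan_zero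
  then show ?case by (simp add: integral_K_def)
next
  case (lspan_step b f c)
  have cf: "continuous_on UNIV f" using lspan_continuous[OF lspan_step.hyps(2)] B by blast
  then have "integral_K (\<lambda>x. c * (u x * b x) + u x * f x) = integral_K (\<lambda>x. c * (u x * b x)) + integral_K (\<lambda>x. u x * f x)"
    by (intro integral_K_add continuous_intros u cf B[OF lspan_step.hyps(1)])
  then show ?case using o lspan_step by (simp add: integral_K_cmult algebra_simps)
qed

text \<open>
  Gram-Schmidt orthogonalisation: the residual of the new function k after projection onto the span of \<open>B\<close>
  supplies the additional direction.
\<close>

lemma L2_projection:
  assumes "finite B" and "\<And>b. b \<in> B \<Longrightarrow> continuous_on UNIV b" and "continuous_on UNIV u"
  shows "\<exists>p\<in>lspan B. \<forall>f\<in>lspan B. integral_K (\<lambda>x. (u x - p x) * f x) = 0"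
  using assms
proof (induction B arbitrary: u rule: finite_induct)
  case empty
  have "f = (\<lambda>x. 0)" if "f \<in> lspan {}" for f
    using that by (induction rule: lspan.induct) auto
  then show ?case using lspan_zero by (fastforce simp: integral_K_def)
next
  case (insert k B)
  have cB: "\<And>b. b \<in> B \<Longrightarrow> continuous_on UNIV b" and ck: "continuous_on UNIV k"
    and cu: "continuous_on UNIV u" using insert.prems by auto
  obtain p where p: "p \<in> lspan B" "\<forall>f\<in>lspan B. integral_K (\<lambda>x. (u x - p x) * f x) = 0"
    using insert.IH[OF cB cu] by blast
  obtain q where q: "q \<in> lspan B" "\<forall>f\<in>lspan B. integral_K (\<lambda>x. (k x - q x) * f x) = 0"
    using insert.IH[OF cB ck] by blast
  have cp: "continuous_on UNIV p" and cq: "continuous_on UNIV q"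
    using lspan_continuous cB p q by blast+
  define r where "r = (\<lambda>x. k x - q x)"
  define s where "s = (\<lambda>x. u x - p x)"
  have cr: "continuous_on UNIV r" and cs: "continuous_on UNIV s"
    unfolding r_def s_def by (intro continuous_intros cp cq ck cu)+
  \<comment> \<open>If r vanishes almost everywhere, k already lies in the span of B up to a null set; the default value
    \<open>t = 0\<close> of the quotient is then a valid coefficient.\<close>
  define t where "t = integral_K (\<lambda>x. s x * r x) / integral_K (\<lambda>x. r x * r x)"
  have t: "integral_K (\<lambda>x. s x * r x) = t * integral_K (\<lambda>x. r x * r x)"
  proof (cases "integral_K (\<lambda>x. r x * r x) = 0")
    case True
    have "AE x in lebesgue_on K. r x * r x = 0"
      using integral_nonneg_eq_0_iff_AE[of "lebesgue_on K" "\<lambda>x. r x * r x"] True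
      by (auto simp: integral_K_def intro!: integrable_K continuous_intros cr)
    then have "integral_K (\<lambda>x. s x * r x) = integral_K (\<lambda>x. 0)"
      unfolding integral_K_def
      by (intro integral_cong_AE borel_measurable_integrable[OF integrable_K] continuous_intros cr cs) auto
    then show ?thesis using True by (simp add: integral_K_def)
  qed (simp add: t_def)
  define p' where "p' = (\<lambda>x. p x + t * r x)"
  have ins: "lspan B \<subseteq> lspan (insert k B)" using lspan_mono by blast
  have rin: "r \<in> lspan (insert k B)"
    unfolding r_def by (rule lspan_diff) (use q ins in \<open>auto intro: lspan_base\<close>)
  have "p' \<in> lspan (insert k B)"
    unfolding p'_def using p ins rin by (intro lspan_add lspan_cmult) auto
  moreover have "integral_K (\<lambda>x. (u x - p' x) * f x) = 0" if f: "f \<in> lspan (insert k B)" for f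
  proof (rule integral_K_orthogonal_lspan[OF f])
    show "continuous_on UNIV (\<lambda>x. u x - p' x)"
      unfolding p'_def by (intro continuous_intros cu cp cr)
    have split: "integral_K (\<lambda>x. (u x - p' x) * g x) = integral_K (\<lambda>x. s x * g x) - t * integral_K (\<lambda>x. r x * g x)"
      if "continuous_on UNIV g" for g
    proof -
      have "integral_K (\<lambda>x. (u x - p' x) * g x) = integral_K (\<lambda>x. s x * g x - t * (r x * g x))"
        by (simp add: p'_def s_def algebra_simps)
      also have "\<dots> = integral_K (\<lambda>x. s x * g x) - integral_K (\<lambda>x. t * (r x * g x))"
        by (intro integral_K_diff continuous_intros cs cr that)
      finally show ?thesis by (simp add: integral_K_cmult)
    qed
    have B0: "integral_K (\<lambda>x. (u x - p' x) * g x) = 0" if "g \<in> lspan B" for g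
      using split[OF lspan_continuous[OF that cB]] p(2) q(2) that by (simp add: r_def s_def)
    fix b assume b: "b \<in> insert k B"
    show "continuous_on UNIV b" using b cB ck by auto
    show "integral_K (\<lambda>x. (u x - p' x) * b x) = 0"
    proof (cases "b = k")
      case True
      have "integral_K (\<lambda>x. (u x - p' x) * b x) = integral_K (\<lambda>x. (u x - p' x) * r x + (u x - p' x) * q x)"
        by (simp add: True r_def algebra_simps)
      also have "\<dots> = integral_K (\<lambda>x. (u x - p' x) * r x) + integral_K (\<lambda>x. (u x - p' x) * q x)"
        unfolding p'_def by (intro integral_K_add continuous_intros cu cp cr cq)
      also have "\<dots> = 0" using B0[OF q(1)] split[OF cr] t by simp
      finally show ?thesis .
    next
      case False
      then show ?thesis using B0 lspan_base b by auto
    qed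
  qed
  ultimately show ?case by blast
qed

text \<open>
  Products of d barycentric coordinates. As the coordinates sum to 1, they span the polynomials of degree at
  most d and not only the homogeneous ones.
\<close>

primrec bernstein :: "nat \<Rightarrow> (real^3 \<Rightarrow> real) set" where
  "bernstein 0 = {\<lambda>x. 1}"
| "bernstein (Suc d) = (\<lambda>(v, b) x. bary v x * b x) ` (S \<times> bernstein d)"

definition \<P> :: "nat \<Rightarrow> (real^3 \<Rightarrow> real) set" where
  "\<P> d = lspan (bernstein d)"

lemma finite_bernstein: "finite (bernstein d)"
  by (induction d) (auto simp: finite_S)

lemma continuous_bernstein: "b \<in> bernstein d \<Longrightarrow> continuous_on UNIV b"
  by (induction d arbitrary: b) (auto intro!: continuous_intros continuous_bary)

lemma continuous_\<P>: "f \<in> \<P> d \<Longrightarrow> continuous_on UNIV f"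
  unfolding \<P>_def using lspan_continuous continuous_bernstein by blast

lemma \<P>_bary_mult:
  assumes "f \<in> \<P> d" "v \<in> S"
  shows "(\<lambda>x. bary v x * f x) \<in> \<P> (Suc d)"
  using assms(1) unfolding \<P>_def
proof (induction rule: lspan.induct)
  case lspan_zero
  then show ?case by (simp add: lspan.lspan_zero)
next
  case (lspan_step b f c)
  have "(\<lambda>x. bary v x * b x) \<in> bernstein (Suc d)" using lspan_step assms(2) by force
  from lspan.lspan_step[OF this lspan_step.IH, of c] show ?case by (simp add: algebra_simps)
qed

lemma \<P>_Suc: "f \<in> \<P> d \<Longrightarrow> f \<in> \<P> (Suc d)"
proof -
  assume f: "f \<in> \<P> d"
  have "(\<lambda>x. \<Sum>v\<in>S. bary v x * f x) \<in> \<P> (Suc d)"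
    unfolding \<P>_def by (intro lspan_sum) (use \<P>_bary_mult[OF f] in \<open>auto simp: \<P>_def\<close>)
  then show ?thesis by (simp add: bary_sum flip: sum_distrib_right)
qed

lemma \<P>_mono:
  assumes "f \<in> \<P> d" "d \<le> e"
  shows "f \<in> \<P> e"
  using assms(2,1) by (induction e rule: dec_induct) (auto intro: \<P>_Suc)

lemma \<P>_const: "(\<lambda>x. c) \<in> \<P> d"
proof -
  have "(\<lambda>x. c * 1) \<in> \<P> 0" unfolding \<P>_def by (intro lspan_cmult lspan_base) simp
  then show ?thesis using \<P>_mono[of "\<lambda>x. c" 0 d] by simp
qed

lemma \<P>_add: "f \<in> \<P> d \<Longrightarrow> g \<in> \<P> d \<Longrightarrow> (\<lambda>x. f x + g x) \<in> \<P> d"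
  unfolding \<P>_def by (rule lspan_add)

lemma \<P>_diff: "f \<in> \<P> d \<Longrightarrow> g \<in> \<P> d \<Longrightarrow> (\<lambda>x. f x - g x) \<in> \<P> d"
  unfolding \<P>_def by (rule lspan_diff)

lemma \<P>_cmult: "f \<in> \<P> d \<Longrightarrow> (\<lambda>x. c * f x) \<in> \<P> d"
  unfolding \<P>_def by (rule lspan_cmult)

lemma \<P>_mult:
  assumes f: "f \<in> \<P> d" and g: "g \<in> \<P> e"
  shows "(\<lambda>x. f x * g x) \<in> \<P> (d + e)"
proof -
  have b: "(\<lambda>x. b x * g x) \<in> \<P> (d + e)" if "b \<in> bernstein d" for b
    using that
  proof (induction d arbitrary: b)
    case (Suc d)
    then obtain v b' where "v \<in> S" "b' \<in> bernstein d" "b = (\<lambda>x. bary v x * b' x)" by auto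
    then show ?case using \<P>_bary_mult[OF Suc.IH[of b']] by (simp add: mult.assoc)
  qed (simp add: g)
  from f show ?thesis unfolding \<P>_def[of d]
  proof (induction rule: lspan.induct)
    case lspan_zero
    then show ?case by (simp add: \<P>_const)
  next
    case (lspan_step b f c)
    then show ?case using \<P>_add[OF \<P>_cmult[OF b, of b c], of "\<lambda>x. f x * g x"]
      by (simp add: algebra_simps)
  qed
qed

lemma real_polynomial_function_\<P>: "real_polynomial_function f \<Longrightarrow> \<exists>d. f \<in> \<P> d"
proof (induction rule: real_polynomial_function.induct)
  case (linear f)
  then interpret bounded_linear f .
  have eq: "f x = (\<Sum>v\<in>S. f v * bary v x)" for x
    using arg_cong[OF bary_represent[of x], of f] by (simp add: sum scaleR mult.commute)
  have "(\<lambda>x. \<Sum>v\<in>S. f v * bary v x) \<in> \<P> 1"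
  proof -
    have "bary v \<in> \<P> 1" if "v \<in> S" for v
      using \<P>_bary_mult[OF \<P>_const[of 1 0] that] by simp
    then show ?thesis unfolding \<P>_def by (intro lspan_sum lspan_cmult)
  qed
  then have "f \<in> \<P> 1" unfolding eq[symmetric] .
  then show ?case by blast
next
  case (const c)
  then show ?case using \<P>_const by blast
next
  case (add f g)
  then obtain d e where fd: "f \<in> \<P> d" and ge: "g \<in> \<P> e" by blast
  have "f \<in> \<P> (max d e)" "g \<in> \<P> (max d e)"
    by (rule \<P>_mono[OF fd], simp) (rule \<P>_mono[OF ge], simp)
  then show ?case using \<P>_add by blast
next
  case (mult f g)
  then show ?case using \<P>_mult by blast
qed

text \<open>
  For \<open>d = 0\<close> this is the zero space and not, as truncated subtraction would have it, the space of constants.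
\<close>

definition lower_degree :: "nat \<Rightarrow> (real^3 \<Rightarrow> real) set" where
  "lower_degree d = (if d = 0 then {\<lambda>x. 0} else \<P> (d - 1))"

lemma lower_degree_add: "f \<in> lower_degree d \<Longrightarrow> g \<in> lower_degree d \<Longrightarrow> (\<lambda>x. f x + g x) \<in> lower_degree d"
  by (auto simp: lower_degree_def \<P>_add split: if_splits)

lemma lower_degree_cmult: "f \<in> lower_degree d \<Longrightarrow> (\<lambda>x. c * f x) \<in> lower_degree d"
  by (auto simp: lower_degree_def \<P>_cmult split: if_splits)

text \<open>
  The second clause says that the generator acts on f as \<open>- d (d + 3)\<close> modulo polynomials of lower degree.
  Raising the degree by a factor \<open>bary w\<close> with the Leibniz rule produces a carre du champ term; the first clause
  determines it, up to polynomials of degree at most d, as \<open>- d\<close> times the product. The increments add up since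
  \<open>d (d + 3) + 4 + 2 d = (d + 1) (d + 4)\<close>.
\<close>

definition eigen_mod_lower :: "nat \<Rightarrow> (real^3 \<Rightarrow> real) \<Rightarrow> bool" where
  "eigen_mod_lower d f \<longleftrightarrow> (\<exists>f'.
     (\<forall>v\<in>S. (\<lambda>x. carre x (bary_grad v) (f' x) + real d * (bary v x * f x)) \<in> \<P> d) \<and>
     (\<exists>l\<in>lower_degree d. weak_gen f f' (\<lambda>x. l x - real (d * (d + 3)) * f x)))"

lemma eigen_mod_lower_zero: "eigen_mod_lower d (\<lambda>x. 0)"
  unfolding eigen_mod_lower_def
  by (intro exI[of _ "\<lambda>x. 0"] conjI bexI[of _ "\<lambda>x. 0"])
     (auto simp: carre_zero \<P>_const lower_degree_def weak_gen_const)

lemma weak_gen_cmult: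
  assumes "weak_gen f f' r"
  shows "weak_gen (\<lambda>x. c * f x) (\<lambda>x. c *\<^sub>R f' x) (\<lambda>x. c * r x)"
  using weak_gen_mult[OF weak_gen_const[of c] assms] by (simp add: carre_commute[of _ 0] carre_zero)

lemma eigen_mod_lower_step:
  assumes "eigen_mod_lower d f" "eigen_mod_lower d g"
  shows "eigen_mod_lower d (\<lambda>x. c * f x + g x)"
proof -
  obtain f' l where f: "\<And>v. v \<in> S \<Longrightarrow> (\<lambda>x. carre x (bary_grad v) (f' x) + real d * (bary v x * f x)) \<in> \<P> d"
    "l \<in> lower_degree d" "weak_gen f f' (\<lambda>x. l x - real (d * (d + 3)) * f x)"
    using assms(1) unfolding eigen_mod_lower_def by blast
  obtain g' m where g: "\<And>v. v \<in> S \<Longrightarrow> (\<lambda>x. carre x (bary_grad v) (g' x) + real d * (bary v x * g x)) \<in> \<P> d"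
    "m \<in> lower_degree d" "weak_gen g g' (\<lambda>x. m x - real (d * (d + 3)) * g x)"
    using assms(2) unfolding eigen_mod_lower_def by blast
  show ?thesis unfolding eigen_mod_lower_def
  proof (intro exI[of _ "\<lambda>x. c *\<^sub>R f' x + g' x"] conjI ballI bexI[of _ "\<lambda>x. c * l x + m x"])
    fix v assume v: "v \<in> S"
    show "(\<lambda>x. carre x (bary_grad v) (c *\<^sub>R f' x + g' x) + real d * (bary v x * (c * f x + g x))) \<in> \<P> d"
      using \<P>_add[OF \<P>_cmult[OF f(1)[OF v], of c] g(1)[OF v]]
      by (simp add: carre_add carre_scale algebra_simps)
  next
    show "weak_gen (\<lambda>x. c * f x + g x) (\<lambda>x. c *\<^sub>R f' x + g' x)
        (\<lambda>x. (c * l x + m x) - real (d * (d + 3)) * (c * f x + g x))"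
      using weak_gen_add[OF weak_gen_cmult[OF f(3), of c] g(3)] by (simp add: algebra_simps)
    show "(\<lambda>x. c * l x + m x) \<in> lower_degree d" using f g lower_degree_add lower_degree_cmult by blast
  qed
qed

lemma eigen_mod_lower_bernstein: "b \<in> bernstein d \<Longrightarrow> eigen_mod_lower d b"
proof (induction d arbitrary: b)
  case 0
  then show ?case unfolding eigen_mod_lower_def
    by (intro exI[of _ "\<lambda>x. 0"] conjI bexI[of _ "\<lambda>x. 0"])
       (auto simp: carre_zero \<P>_const lower_degree_def weak_gen_const)
next
  case (Suc d)
  then obtain w f where w: "w \<in> S" "f \<in> bernstein d" "b = (\<lambda>x. bary w x * f x)" by auto
  have fP: "f \<in> \<P> d" unfolding \<P>_def using w(2) by (rule lspan_base)
  obtain f' l where f: "\<And>v. v \<in> S \<Longrightarrow> (\<lambda>x. carre x (bary_grad v) (f' x) + real d * (bary v x * f x)) \<in> \<P> d"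
    "l \<in> lower_degree d" "weak_gen f f' (\<lambda>x. l x - real (d * (d + 3)) * f x)"
    using Suc.IH[OF w(2)] unfolding eigen_mod_lower_def by blast
  define m where "m = (\<lambda>v x. carre x (bary_grad v) (f' x) + real d * (bary v x * f x))"
  have m: "\<And>v. v \<in> S \<Longrightarrow> m v \<in> \<P> d" using f(1) by (simp add: m_def)
  have carre_m: "carre x (bary_grad v) (f' x) = m v x - real d * (bary v x * f x)" for v x
    by (simp add: m_def)
  let ?b' = "\<lambda>x. bary w x *\<^sub>R f' x + f x *\<^sub>R bary_grad w"
  let ?l = "\<lambda>x. bary w x * l x + f x + 2 * m w x"
  have lP: "(\<lambda>x. bary w x * l x) \<in> \<P> d"
  proof (cases d)
    case 0
    then show ?thesis using f(2) by (simp add: lower_degree_def \<P>_const)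
  next
    case (Suc e)
    then show ?thesis using f(2) \<P>_bary_mult w(1) by (simp add: lower_degree_def)
  qed
  show ?case unfolding eigen_mod_lower_def
  proof (intro exI[of _ ?b'] conjI ballI bexI[of _ ?l])
    fix v assume v: "v \<in> S"
    let ?c = "if v = w then 1 else (0::real)"
    have "(\<lambda>x. bary w x * m v x + ?c * (bary w x * f x)) \<in> \<P> (Suc d)"
      by (intro \<P>_add \<P>_cmult \<P>_bary_mult m fP w v)
    moreover have "carre x (bary_grad v) (?b' x) + real (Suc d) * (bary v x * b x)
        = bary w x * m v x + ?c * (bary w x * f x)" for x
      unfolding w(3)
      by (cases "v = w") (simp_all add: carre_add carre_scale carre_m carre_bary_bary[OF w(1) v] carre_bary_bary[OF w(1) w(1)] algebra_simps)
    ultimately show "(\<lambda>x. carre x (bary_grad v) (?b' x) + real (Suc d) * (bary v x * b x)) \<in> \<P> (Suc d)"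
      by presburger
  next
    have "weak_gen b ?b' (\<lambda>x. bary w x * (l x - real (d * (d + 3)) * f x) + f x * (1 - 4 * bary w x)
        + 2 * carre x (bary_grad w) (f' x))"
      unfolding w(3) by (rule weak_gen_mult[OF weak_gen_bary[OF w(1)] f(3)])
    moreover have "bary w x * (l x - real (d * (d + 3)) * f x) + f x * (1 - 4 * bary w x)
        + 2 * carre x (bary_grad w) (f' x) = ?l x - real (Suc d * (Suc d + 3)) * b x" for x
      unfolding w(3) carre_m by (simp add: algebra_simps)
    ultimately show "weak_gen b ?b' (\<lambda>x. ?l x - real (Suc d * (Suc d + 3)) * b x)" by (simp only:)
    show "?l \<in> lower_degree (Suc d)"
      unfolding lower_degree_def using \<P>_add[OF \<P>_add[OF lP fP] \<P>_cmult[OF m[OF w(1)]]] by simp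
  qed
qed

lemma eigen_mod_lower_\<P>: "f \<in> \<P> d \<Longrightarrow> eigen_mod_lower d f"
  unfolding \<P>_def
  by (induction rule: lspan.induct)
     (auto intro: eigen_mod_lower_zero eigen_mod_lower_step eigen_mod_lower_bernstein)

lemma \<P>_generator:
  assumes "f \<in> \<P> d"
  obtains f' l where "l \<in> lower_degree d" "weak_gen f f' (\<lambda>x. l x - real (d * (d + 3)) * f x)"
  using eigen_mod_lower_\<P>[OF assms] unfolding eigen_mod_lower_def by blast

lemma lower_degree_subset_\<P>: "l \<in> lower_degree d \<Longrightarrow> l \<in> \<P> d"
  by (cases d) (auto simp: lower_degree_def \<P>_const intro: \<P>_Suc)

end

section \<open>The spectral gap and the Poincare inequality\<close>

lemma C1_grad_unique:
  assumes "C1_grad f g" "C1_grad f h"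
  shows "g = h"
proof
  fix x
  have "(\<bullet>) (g x) = (\<bullet>) (h x)"
    using has_derivative_unique C1_gradD(1)[OF assms(1)] C1_gradD(1)[OF assms(2)] by blast
  then show "g x = h x" by (metis vector_eq_rdot)
qed

context tetrahedron begin

text \<open>
  The \<open>p d\<close> are the projections of u onto the polynomials of degree at most d. The increment
  \<open>r = p (d + 1) - p d\<close> is orthogonal to all polynomials of degree at most d. Therefore neither the lower-order
  part of the generator nor the mixed term contributes to the energy, which grows by
  \<open>(d + 1) (d + 4) \<ge> 4\<close> times the squared norm of r.
\<close>

lemma gap_polynomial:
  assumes u: "continuous_on UNIV u"
    and p: "\<And>d. p d \<in> \<P> d" and o: "\<And>d f. f \<in> \<P> d \<Longrightarrow> integral_K (\<lambda>x. (u x - p d x) * f x) = 0"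
  shows "\<exists>p'. C1_grad (p d) p' \<and>
    4 * (integral_K (\<lambda>x. p d x * p d x) - integral_K (\<lambda>x. p 0 x * p 0 x)) \<le> integral_K (\<lambda>x. carre x (p' x) (p' x))"
proof (induction d)
  case 0
  obtain p' l where "weak_gen (p 0) p' (\<lambda>x. l x - real (0 * (0 + 3)) * p 0 x)"
    using \<P>_generator[OF p] by blast
  then show ?case by (auto simp: weak_gen_def intro!: exI[of _ p'] integral_K_nonneg carre_nonneg)
next
  case (Suc d)
  then obtain p' where p': "C1_grad (p d) p'"
    "4 * (integral_K (\<lambda>x. p d x * p d x) - integral_K (\<lambda>x. p 0 x * p 0 x)) \<le> integral_K (\<lambda>x. carre x (p' x) (p' x))" by blast
  define r where "r = (\<lambda>x. p (Suc d) x - p d x)"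
  have cp: "continuous_on UNIV (p d)" for d using continuous_\<P>[OF p] .
  have rP: "r \<in> \<P> (Suc d)" unfolding r_def by (intro \<P>_diff p \<P>_Suc)
  have cr: "continuous_on UNIV r" using continuous_\<P>[OF rP] .
  have ro: "integral_K (\<lambda>x. r x * f x) = 0" if f: "f \<in> \<P> d" for f
  proof -
    have cf: "continuous_on UNIV f" using continuous_\<P>[OF f] .
    have "integral_K (\<lambda>x. r x * f x) = integral_K (\<lambda>x. (u x - p d x) * f x - (u x - p (Suc d) x) * f x)"
      by (simp add: r_def algebra_simps)
    also have "\<dots> = integral_K (\<lambda>x. (u x - p d x) * f x) - integral_K (\<lambda>x. (u x - p (Suc d) x) * f x)"
      by (intro integral_K_diff continuous_intros u cp cf)
    finally show ?thesis using o f \<P>_Suc by simp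
  qed
  obtain r' l where l: "l \<in> lower_degree (Suc d)"
    and r': "weak_gen r r' (\<lambda>x. l x - real (Suc d * (Suc d + 3)) * r x)"
    using \<P>_generator[OF rP] by blast
  obtain q' m where m: "m \<in> lower_degree d"
    and q': "weak_gen (p d) q' (\<lambda>x. m x - real (d * (d + 3)) * p d x)"
    using \<P>_generator[OF p] by blast
  have lP: "l \<in> \<P> d" using l by (simp add: lower_degree_def)
  have c1r: "C1_grad r r'" and c1q: "C1_grad (p d) q'" using r' q' by (auto simp: weak_gen_def)
  have pq: "p' = q'" by (rule C1_grad_unique[OF p'(1) c1q])
  let ?n = "real (Suc d * (Suc d + 3))"
  have cl: "continuous_on UNIV l" using continuous_\<P>[OF lP] .
  have "integral_K (\<lambda>x. carre x (r' x) (r' x)) = - integral_K (\<lambda>x. r x * (l x - ?n * r x))"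
    using r' c1r unfolding weak_gen_def by blast
  also have "integral_K (\<lambda>x. r x * (l x - ?n * r x)) = integral_K (\<lambda>x. r x * l x - ?n * (r x * r x))"
    by (simp add: algebra_simps)
  also have "\<dots> = integral_K (\<lambda>x. r x * l x) - ?n * integral_K (\<lambda>x. r x * r x)"
    by (subst integral_K_diff) (auto intro!: continuous_intros cr cl simp: integral_K_cmult simp del: of_nat_mult)
  finally have rr: "integral_K (\<lambda>x. carre x (r' x) (r' x)) = ?n * integral_K (\<lambda>x. r x * r x)" using ro[OF lP] by simp
  have "integral_K (\<lambda>x. carre x (r' x) (q' x)) = - integral_K (\<lambda>x. r x * (m x - real (d * (d + 3)) * p d x))"
    using q' c1r unfolding weak_gen_def by blast
  also have "(\<lambda>x. m x - real (d * (d + 3)) * p d x) \<in> \<P> d"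
    by (intro \<P>_diff \<P>_cmult p lower_degree_subset_\<P> m)
  note ro[OF this]
  finally have rq: "integral_K (\<lambda>x. carre x (r' x) (q' x)) = 0" by simp
  have cr': "continuous_on UNIV r'" and cq': "continuous_on UNIV q'"
    using C1_gradD c1r c1q by auto
  have "C1_grad (\<lambda>x. r x + p d x) (\<lambda>x. r' x + q' x)" by (rule C1_grad_add[OF c1r c1q])
  then have c1: "C1_grad (p (Suc d)) (\<lambda>x. r' x + q' x)" by (simp add: r_def)
  have "integral_K (\<lambda>x. carre x (r' x + q' x) (r' x + q' x))
     = integral_K (\<lambda>x. (carre x (r' x) (r' x) + 2 * carre x (r' x) (q' x)) + carre x (q' x) (q' x))"
    by (simp add: carre_add carre_add_left carre_commute[of _ "q' _" "r' _"] algebra_simps)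
  also have "\<dots> = integral_K (\<lambda>x. carre x (r' x) (r' x)) + 2 * integral_K (\<lambda>x. carre x (r' x) (q' x)) + integral_K (\<lambda>x. carre x (q' x) (q' x))"
    unfolding integral_K_cmult[symmetric]
    by (subst integral_K_add integral_K_add; (intro continuous_intros continuous_carre cr' cq')?)+ simp
  also have "\<dots> = ?n * integral_K (\<lambda>x. r x * r x) + integral_K (\<lambda>x. carre x (q' x) (q' x))" using rr rq by simp
  finally have energy: "integral_K (\<lambda>x. carre x (r' x + q' x) (r' x + q' x))
     = ?n * integral_K (\<lambda>x. r x * r x) + integral_K (\<lambda>x. carre x (q' x) (q' x))" .
  have "integral_K (\<lambda>x. p (Suc d) x * p (Suc d) x) = integral_K (\<lambda>x. (r x * r x + 2 * (r x * p d x)) + p d x * p d x)"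
    by (simp add: r_def algebra_simps)
  also have "\<dots> = integral_K (\<lambda>x. r x * r x) + 2 * integral_K (\<lambda>x. r x * p d x) + integral_K (\<lambda>x. p d x * p d x)"
    unfolding integral_K_cmult[symmetric]
    by (subst integral_K_add integral_K_add; (intro continuous_intros cr cp)?)+ simp
  also have "integral_K (\<lambda>x. r x * p d x) = 0" by (rule ro[OF p])
  finally have mass: "integral_K (\<lambda>x. p (Suc d) x * p (Suc d) x) = integral_K (\<lambda>x. r x * r x) + integral_K (\<lambda>x. p d x * p d x)"
    by simp
  have "4 * integral_K (\<lambda>x. r x * r x) \<le> ?n * integral_K (\<lambda>x. r x * r x)"
    by (intro mult_right_mono integral_K_nonneg) auto
  then have "4 * (integral_K (\<lambda>x. p (Suc d) x * p (Suc d) x) - integral_K (\<lambda>x. p 0 x * p 0 x))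
     \<le> integral_K (\<lambda>x. carre x (r' x + q' x) (r' x + q' x))"
    using p'(2) unfolding energy mass pq by simp
  with c1 show ?case by blast
qed

text \<open>
  The energy of the projection \<open>p d\<close> is at most that of u, because the difference \<open>u - p d\<close> is orthogonal to
  \<open>p d\<close> also in the energy: the generator keeps \<open>p d\<close> within the polynomials of degree at most d. The
  projections converge to u by the theorem of Weierstrass. Only uniform approximation of u itself is
  required, not of its gradient.
\<close>

lemma spectral_gap:
  assumes u: "C1_grad u u'"
  shows "\<exists>c. integral_K (\<lambda>x. u x - c) = 0 \<and> 4 * integral_K (\<lambda>x. (u x - c) * (u x - c)) \<le> integral_K (\<lambda>x. carre x (u' x) (u' x))"
proof -
  note cu = C1_gradD(3)[OF u] and cu' = C1_gradD(2)[OF u]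
  have "\<exists>p. p \<in> \<P> d \<and> (\<forall>f\<in>\<P> d. integral_K (\<lambda>x. (u x - p x) * f x) = 0)" for d
    using L2_projection[OF finite_bernstein[of d] _ cu] continuous_bernstein unfolding \<P>_def by blast
  then obtain p where p: "\<And>d. p d \<in> \<P> d" "\<And>d f. f \<in> \<P> d \<Longrightarrow> integral_K (\<lambda>x. (u x - p d x) * f x) = 0"
    by metis
  have cp: "continuous_on UNIV (p d)" for d using continuous_\<P>[OF p(1)] .
  have "\<exists>c. f = (\<lambda>x. c)" if "f \<in> \<P> 0" for f
    using that unfolding \<P>_def by (induction rule: lspan.induct) auto
  then obtain c where c: "p 0 = (\<lambda>x. c)" using p(1) by blast
  have mean: "integral_K (\<lambda>x. u x - c) = 0" using p(2)[OF \<P>_const[of 1 0]] by (simp add: c)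
  let ?E = "integral_K (\<lambda>x. carre x (u' x) (u' x))"
  have E: "4 * (integral_K (\<lambda>x. p d x * p d x) - integral_K (\<lambda>x. p 0 x * p 0 x)) \<le> ?E" for d
  proof -
    obtain p' where p': "C1_grad (p d) p'"
      "4 * (integral_K (\<lambda>x. p d x * p d x) - integral_K (\<lambda>x. p 0 x * p 0 x)) \<le> integral_K (\<lambda>x. carre x (p' x) (p' x))"
      using gap_polynomial[OF cu p] by blast
    obtain q' m where m: "m \<in> lower_degree d"
      and q': "weak_gen (p d) q' (\<lambda>x. m x - real (d * (d + 3)) * p d x)"
      using \<P>_generator[OF p(1)] by blast
    have c1q: "C1_grad (p d) q'" using q' by (auto simp: weak_gen_def)
    have pq: "p' = q'" by (rule C1_grad_unique[OF p'(1) c1q])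
    note cq' = C1_gradD(2)[OF c1q]
    have "C1_grad (\<lambda>x. u x - p d x) (\<lambda>x. u' x - q' x)" by (rule C1_grad_diff[OF u c1q])
    then have "integral_K (\<lambda>x. carre x (u' x - q' x) (q' x)) = - integral_K (\<lambda>x. (u x - p d x) * (m x - real (d * (d + 3)) * p d x))"
      using q' unfolding weak_gen_def by blast
    also have "(\<lambda>x. m x - real (d * (d + 3)) * p d x) \<in> \<P> d"
      by (intro \<P>_diff \<P>_cmult p lower_degree_subset_\<P> m)
    note p(2)[OF this]
    finally have cross: "integral_K (\<lambda>x. carre x (u' x - q' x) (q' x)) = 0" by simp
    have "?E = integral_K (\<lambda>x. (carre x (u' x - q' x) (u' x - q' x) + 2 * carre x (u' x - q' x) (q' x)) + carre x (q' x) (q' x))"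
      by (simp add: carre_diff carre_diff_left carre_commute[of _ "q' _" "u' _"] algebra_simps)
    also have "\<dots> = integral_K (\<lambda>x. carre x (u' x - q' x) (u' x - q' x)) + 2 * integral_K (\<lambda>x. carre x (u' x - q' x) (q' x))
         + integral_K (\<lambda>x. carre x (q' x) (q' x))"
      unfolding integral_K_cmult[symmetric]
      by (subst integral_K_add integral_K_add; (intro continuous_intros continuous_carre cu' cq')?)+ simp
    also have "\<dots> \<ge> integral_K (\<lambda>x. carre x (q' x) (q' x))"
      using cross by (simp add: integral_K_nonneg carre_nonneg)
    finally show ?thesis using p'(2) pq by simp
  qed
  let ?V = "integral_K (\<lambda>x. (u x - c) * (u x - c))"
  let ?m = "integral_K (\<lambda>x. 1)"
  have m0: "0 \<le> ?m" by (rule integral_K_nonneg) simp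
  have approx: "4 * ?V \<le> ?E + 4 * (e * e * ?m)" if e: "e > 0" for e
  proof -
    have "compact (closure K)" using bounded_K by (simp add: compact_eq_bounded_closed bounded_closure)
    then obtain q where q: "real_polynomial_function q" "\<And>x. x \<in> closure K \<Longrightarrow> \<bar>u x - q x\<bar> < e"
      using Stone_Weierstrass_real_polynomial_function[of "closure K" u e] cu e continuous_on_subset by blast
    obtain d where d: "q \<in> \<P> d" using real_polynomial_function_\<P> q(1) by blast
    have cq: "continuous_on UNIV q" using continuous_\<P>[OF d] .
    let ?r = "\<lambda>x. u x - p d x"
    have pyth: "integral_K (\<lambda>x. (u x - f x) * (u x - f x))
       = integral_K (\<lambda>x. ?r x * ?r x) + integral_K (\<lambda>x. (p d x - f x) * (p d x - f x))" if f: "f \<in> \<P> d" for f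
    proof -
      have cf: "continuous_on UNIV f" using continuous_\<P>[OF f] .
      have "integral_K (\<lambda>x. (u x - f x) * (u x - f x))
        = integral_K (\<lambda>x. (?r x * ?r x + 2 * (?r x * (p d x - f x))) + (p d x - f x) * (p d x - f x))"
        by (intro arg_cong[where f = integral_K] ext) algebra
      also have "\<dots> = integral_K (\<lambda>x. ?r x * ?r x) + 2 * integral_K (\<lambda>x. ?r x * (p d x - f x))
          + integral_K (\<lambda>x. (p d x - f x) * (p d x - f x))"
        unfolding integral_K_cmult[symmetric]
        by (subst integral_K_add integral_K_add; (intro continuous_intros cu cp cf)?)+ simp
      finally show ?thesis using p(2)[OF \<P>_diff[OF p(1) f]] by simp
    qed
    have "integral_K (\<lambda>x. (u x - q x) * (u x - q x)) \<le> integral_K (\<lambda>x. e * e * 1)"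
    proof (rule integral_K_mono)
      fix x assume "x \<in> K"
      then have "\<bar>u x - q x\<bar> \<le> \<bar>e\<bar>" using q(2)[of x] closure_subset e by fastforce
      then have "(u x - q x)\<^sup>2 \<le> e\<^sup>2" by (simp add: abs_le_square_iff)
      then show "(u x - q x) * (u x - q x) \<le> e * e * 1" by (simp add: power2_eq_square)
    qed (intro continuous_intros cu cq)+
    also have "\<dots> = e * e * ?m" by (rule integral_K_cmult)
    finally have small: "integral_K (\<lambda>x. ?r x * ?r x) \<le> e * e * ?m"
      using pyth[OF d] integral_K_nonneg[of "\<lambda>x. (p d x - q x) * (p d x - q x)"] by simp
    have "?V = integral_K (\<lambda>x. ?r x * ?r x) + integral_K (\<lambda>x. (p d x - c) * (p d x - c))"
      using pyth[OF \<P>_const[of c d]] .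
    also have "integral_K (\<lambda>x. (p d x - c) * (p d x - c)) = integral_K (\<lambda>x. p d x * p d x) - integral_K (\<lambda>x. p 0 x * p 0 x)"
    proof -
      have z: "integral_K (\<lambda>x. p d x - c) = 0"
      proof -
        have "integral_K (\<lambda>x. p d x - c) = integral_K (\<lambda>x. (u x - c) - ?r x * 1)" by simp
        also have "\<dots> = integral_K (\<lambda>x. u x - c) - integral_K (\<lambda>x. ?r x * 1)"
          by (intro integral_K_diff continuous_intros cu cp)
        finally show ?thesis using mean p(2)[OF \<P>_const[of 1 d]] by simp
      qed
      have "integral_K (\<lambda>x. p d x * p d x) = integral_K (\<lambda>x. ((p d x - c) * (p d x - c) + (2 * c) * (p d x - c)) + c * c)"
        by (intro arg_cong[where f = integral_K] ext) algebra
      also have "\<dots> = integral_K (\<lambda>x. (p d x - c) * (p d x - c)) + (2 * c) * integral_K (\<lambda>x. p d x - c) + integral_K (\<lambda>x. c * c)"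
        unfolding integral_K_cmult[symmetric]
        by (subst integral_K_add integral_K_add; (intro continuous_intros cp)?)+ simp
      finally show ?thesis using z c by simp
    qed
    finally show ?thesis using small E[of d] by simp
  qed
  have "4 * ?V \<le> ?E"
  proof (rule field_le_epsilon)
    fix e :: real assume e: "e > 0"
    \<comment> \<open>The accuracy s is such that \<open>4 * s\<^sup>2\<close> times the volume of \<open>K\<close> is at most e; the summand 1
      excludes a zero denominator.\<close>
    define s where "s = sqrt (e / (4 * (?m + 1)))"
    have s: "s > 0" "s * s = e / (4 * (?m + 1))"
      using e m0 by (auto simp: s_def)
    have "4 * (s * s * ?m) = e * (?m / (?m + 1))"
      unfolding s(2) using m0 by (simp add: field_simps)
    also have "\<dots> \<le> e * 1" using e m0 by (intro mult_left_mono) auto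
    finally show "4 * ?V \<le> ?E + e" using approx[OF s(1)] by simp
  qed
  with mean show ?thesis by blast
qed

lemma poincare:
  assumes u: "C1_grad u u'"
  shows "\<exists>c. integral_K (\<lambda>x. (u x - c)\<^sup>2) \<le> (diameter K / 4)\<^sup>2 * integral_K (\<lambda>x. u' x \<bullet> u' x)"
proof -
  obtain c where c: "4 * integral_K (\<lambda>x. (u x - c) * (u x - c)) \<le> integral_K (\<lambda>x. carre x (u' x) (u' x))"
    using spectral_gap[OF u] by blast
  note cu' = C1_gradD(2)[OF u]
  have "integral_K (\<lambda>x. carre x (u' x) (u' x)) \<le> integral_K (\<lambda>x. (diameter K)\<^sup>2 / 4 * (u' x \<bullet> u' x))"
    by (intro integral_K_mono continuous_carre continuous_intros cu' carre_le)
  also have "\<dots> = (diameter K)\<^sup>2 / 4 * integral_K (\<lambda>x. u' x \<bullet> u' x)" by (rule integral_K_cmult)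
  finally show ?thesis using c by (auto simp: power2_eq_square intro!: exI[of _ c])
qed

end

section \<open>The two-dimensional Hausdorff measure\<close>

lemma subadditive_Un:
  fixes f :: "'a set \<Rightarrow> ennreal"
  assumes empty: "f {} = 0"
    and sub: "\<And>A :: nat \<Rightarrow> 'a set. f (\<Union>n. A n) \<le> (\<Sum>n. f (A n))"
  shows "f (A \<union> B) \<le> f A + f B"
proof -
  define E where "E = (\<lambda>n::nat. if n = 0 then A else if n = 1 then B else {})"
  have "(\<Union>n. E n) = A \<union> B" by (auto simp: E_def split: if_splits)
  moreover have "(\<Sum>n. f (E n)) = (\<Sum>n\<in>{0,1}. f (E n))"
    by (intro suminf_finite) (auto simp: E_def empty)
  ultimately show ?thesis using sub[of E] by (simp add: E_def)
qed

text \<open>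
  Caratheodory's criterion. The part of \<open>A\<close> at distance at least \<open>1 / (n + 1)\<close> from \<open>C\<close> is separated from
  \<open>A \<inter> C\<close>. The remaining part of \<open>A - C\<close> is covered by thin annuli around \<open>C\<close>; those with even index, and those with
  odd index, are separated, so the series of their measures converges and its tails vanish.
\<close>

lemma metric_outer_measure_closed_split:
  fixes f :: "'a::metric_space set \<Rightarrow> ennreal"
  assumes empty: "f {} = 0" and mono: "\<And>A B. A \<subseteq> B \<Longrightarrow> f A \<le> f B"
    and sub: "\<And>A :: nat \<Rightarrow> 'a set. f (\<Union>n. A n) \<le> (\<Sum>n. f (A n))"
    and sep: "\<And>A B \<rho>. 0 < \<rho> \<Longrightarrow> (\<And>a b. a \<in> A \<Longrightarrow> b \<in> B \<Longrightarrow> \<rho> \<le> dist a b) \<Longrightarrow> f A + f B \<le> f (A \<union> B)"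
    and C: "closed C"
  shows "f (A \<inter> C) + f (A - C) = f A"
proof (rule antisym)
  have un: "f (A \<union> B) \<le> f A + f B" for A B by (rule subadditive_Un[OF empty sub])
  show "f A \<le> f (A \<inter> C) + f (A - C)"
    using un[of "A \<inter> C" "A - C"] by (simp add: Int_Diff_Un)
  show "f (A \<inter> C) + f (A - C) \<le> f A"
  proof (cases "C = {} \<or> f A = top")
    case True
    then show ?thesis using empty by auto
  next
    case False
    then have C0: "C \<noteq> {}" and fin: "f A < top" by (auto simp: less_top)
    define g where "g = (\<lambda>x. infdist x C)"
    have g_dist: "g x - g y \<le> dist x y" for x y
      using infdist_triangle[of x C y] by (simp add: g_def)
    define B where "B = (\<lambda>n. {x\<in>A. 1 / real (Suc n) \<le> g x})"
    define R where "R = (\<lambda>n. B (Suc n) - B n)"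
    have B_out: "B n \<subseteq> A - C" for n
    proof
      fix x assume x: "x \<in> B n"
      have "g x \<noteq> 0" using x unfolding B_def by (auto simp del: of_nat_Suc simp: divide_le_0_iff)
      then show "x \<in> A - C" using x by (auto simp: g_def B_def)
    qed
    have gR: "1 / real (n + 2) \<le> g x" "g x < 1 / real (Suc n)" if "x \<in> R n" for x n
      using that by (auto simp: R_def B_def)
    have RA: "R n \<subseteq> A" for n by (auto simp: R_def B_def)
    \<comment> \<open>Annuli with distinct indices of the same parity are at positive distance from each other.\<close>
    have parity: "(\<Sum>k<N. f (R (2 * k + s))) \<le> f (\<Union>k<N. R (2 * k + s))" for N s
    proof (induction N)
      case 0 then show ?case by simp
    next
      case (Suc N)
      let ?D = "\<Union>k<N. R (2 * k + s)"
      show ?case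
      proof (cases "N = 0")
        case True then show ?thesis by (simp add: lessThan_Suc)
      next
        case False
        let ?\<rho> = "1 / real (2 * N + s) - 1 / real (Suc (2 * N + s))"
        have "f ?D + f (R (2 * N + s)) \<le> f (?D \<union> R (2 * N + s))"
        proof (rule sep[of ?\<rho>])
          have "1 / real (Suc (2 * N + s)) < 1 / real (2 * N + s)"
            by (rule divide_strict_left_mono) (use False in auto)
          then show "0 < ?\<rho>" by simp
          fix a b assume a: "a \<in> ?D" and b: "b \<in> R (2 * N + s)"
          then obtain k where k: "k < N" "a \<in> R (2 * k + s)" by auto
          have "1 / real (2 * N + s) \<le> 1 / real (2 * k + s + 2)"
            using k(1) by (intro divide_left_mono) auto
          also have "\<dots> \<le> g a" using gR(1)[OF k(2)] by simp
          finally show "?\<rho> \<le> dist a b" using gR(2)[OF b] g_dist[of a b] by linarith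
        qed
        then show ?thesis using Suc.IH
          by (simp add: lessThan_Suc Un_commute add.commute) (meson add_left_mono order_trans)
      qed
    qed
    have le: "(\<Sum>k<N. f (R (2 * k + s))) \<le> f A" for N s
      using parity[of s N] mono[of "\<Union>k<N. R (2 * k + s)" A] RA by (meson UN_least order_trans)
    have "(\<Sum>n<N. f (R n)) \<le> 2 * f A" for N
    proof -
      have "(\<Sum>n<2 * N. f (R n)) = (\<Sum>k<N. f (R (2 * k + 0))) + (\<Sum>k<N. f (R (2 * k + 1)))"
        by (induction N) (auto simp: algebra_simps)
      also have "\<dots> \<le> f A + f A" by (intro add_mono le)
      finally have "(\<Sum>n<2 * N. f (R n)) \<le> 2 * f A" by (simp add: mult_2)
      moreover have "(\<Sum>n<N. f (R n)) \<le> (\<Sum>n<2 * N. f (R n))"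
        by (intro sum_mono2) auto
      ultimately show ?thesis by (rule order_trans[rotated])
    qed
    then have "(\<Sum>n. f (R n)) \<le> 2 * f A" by (intro suminf_le_const) auto
    moreover have "2 * f A < top" using fin by (simp add: ennreal_mult_less_top)
    ultimately have sfin: "(\<Sum>n. f (R n)) < top" by (rule le_less_trans)
    define a where "a = (\<lambda>n. enn2real (f (R n)))"
    have fa: "f (R n) = ennreal (a n)" and a0: "0 \<le> a n" for n
      using ennreal_suminf_lessD[OF sfin, of n] by (auto simp: a_def)
    have suma: "summable a"
      using sfin by (intro summable_suminf_not_top a0) (simp add: fa less_top)
    show ?thesis
    proof (rule ennreal_le_epsilon)
      fix e :: real assume "0 < e"
      obtain N where N: "\<And>n. n \<ge> N \<Longrightarrow> norm (\<Sum>i. a (i + n)) < e"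
        using suminf_exist_split[OF \<open>0 < e\<close> suma] by blast
      have cover: "A - C \<subseteq> B N \<union> (\<Union>k. R (k + N))"
      proof
        fix x assume x: "x \<in> A - C"
        then have "g x > 0" using C C0 unfolding g_def
          by (metis DiffD2 in_closed_iff_infdist_zero infdist_nonneg less_eq_real_def)
        then obtain m where m: "1 / real (Suc m) \<le> g x"
          by (meson less_imp_le nat_approx_posE)
        define l where "l = (LEAST m. x \<in> B m)"
        have l: "x \<in> B l" unfolding l_def by (rule LeastI[of _ m]) (use x m in \<open>auto simp: B_def\<close>)
        show "x \<in> B N \<union> (\<Union>k. R (k + N))"
        proof (cases "l \<le> N")
          case True
          then have "1 / real (Suc N) \<le> 1 / real (Suc l)" by (simp add: frac_le)
          then show ?thesis using l by (auto simp: B_def simp del: of_nat_Suc)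
        next
          case False
          then obtain k where k: "l = Suc (k + N)" by (metis add.commute less_imp_Suc_add not_le)
          have "x \<notin> B (k + N)" using not_less_Least[of "k + N" "\<lambda>m. x \<in> B m"] k by (simp add: l_def)
          then show ?thesis using l k by (auto simp: R_def)
        qed
      qed
      have tail: "(\<Sum>k. f (R (k + N))) \<le> ennreal e"
      proof -
        have "summable (\<lambda>k. a (k + N))" using suma by (simp add: summable_iff_shift)
        then have "(\<Sum>k. f (R (k + N))) = ennreal (\<Sum>k. a (k + N))"
          unfolding fa by (intro suminf_ennreal2 a0)
        then show ?thesis using N[of N] by (auto intro!: ennreal_leI)
      qed
      have "f (A \<inter> C) + f (A - C) \<le> f (A \<inter> C) + (f (B N) + f (\<Union>k. R (k + N)))"
        by (intro add_left_mono order_trans[OF mono[OF cover] un])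
      also have "\<dots> \<le> f (A \<inter> C) + (f (B N) + ennreal e)"
        by (intro add_left_mono order_trans[OF sub tail])
      also have "\<dots> = (f (A \<inter> C) + f (B N)) + ennreal e" by (simp add: add.assoc)
      also have "f (A \<inter> C) + f (B N) \<le> f (A \<inter> C \<union> B N)"
      proof (rule sep[of "1 / real (Suc N)"])
        fix a b assume "a \<in> A \<inter> C" "b \<in> B N"
        then show "1 / real (Suc N) \<le> dist a b"
          using g_dist[of b a] by (simp add: g_def B_def dist_commute)
      qed simp
      also have "f (A \<inter> C \<union> B N) \<le> f A" by (rule mono) (use B_out in auto)
      finally show "f (A \<inter> C) + f (A - C) \<le> f A + ennreal e"
        by (simp add: add_right_mono)
    qed
  qed
qed

lemma metric_outer_measure_borel:
  fixes f :: "'a::metric_space set \<Rightarrow> ennreal"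
  assumes empty: "f {} = 0" and mono: "\<And>A B. A \<subseteq> B \<Longrightarrow> f A \<le> f B"
    and sub: "\<And>A :: nat \<Rightarrow> 'a set. f (\<Union>n. A n) \<le> (\<Sum>n. f (A n))"
    and sep: "\<And>A B \<rho>. 0 < \<rho> \<Longrightarrow> (\<And>a b. a \<in> A \<Longrightarrow> b \<in> B \<Longrightarrow> \<rho> \<le> dist a b) \<Longrightarrow> f A + f B \<le> f (A \<union> B)"
  shows "measure_space UNIV (sets borel) f"
proof -
  interpret sigma_algebra "UNIV :: 'a set" "Pow UNIV" by (rule sigma_algebra_Pow)
  let ?L = "lambda_system UNIV (Pow UNIV) f"
  have "outer_measure_space (Pow UNIV) f"
    unfolding outer_measure_space_def positive_def increasing_def countably_subadditive_def
    using empty mono sub by auto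
  then have L: "measure_space UNIV ?L f" by (rule caratheodory_lemma)
  have "Collect closed \<subseteq> ?L"
    using metric_outer_measure_closed_split[OF empty mono sub sep]
    by (auto simp: lambda_system_def Int_commute Diff_eq)
  then have "sets borel \<subseteq> ?L"
    using L unfolding borel_eq_closed measure_space_def
    by (simp add: sigma_algebra.sigma_sets_subset)
  then show ?thesis
    using measure_down[OF L] sets.sigma_algebra_axioms[of "borel :: 'a measure"] by simp
qed

text \<open>
  The definition of the outer measure is broken up into the admissible covers, the area of a cover and the
  premeasure at a fixed scale \<open>\<delta>\<close>, on which subadditivity and additivity for separated sets are proved.
\<close>

definition covers :: "real \<Rightarrow> (real^3) set \<Rightarrow> (nat \<Rightarrow> (real^3) set) set" where
  "covers \<delta> A = {U. A \<subseteq> (\<Union>i. U i) \<and> (\<forall>i. bounded (U i) \<and> diameter (U i) \<le> \<delta>)}"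

definition cover_area :: "(nat \<Rightarrow> (real^3) set) \<Rightarrow> ennreal" where
  "cover_area U = (\<Sum>i. ennreal (pi / 4 * (diameter (U i))\<^sup>2))"

definition hausdorff2_pre :: "real \<Rightarrow> (real^3) set \<Rightarrow> ennreal" where
  "hausdorff2_pre \<delta> A = (INF U\<in>covers \<delta> A. cover_area U)"

lemma hausdorff2_outer_eq: "hausdorff2_outer A = (SUP \<delta>\<in>{0<..}. hausdorff2_pre \<delta> A)"
  unfolding hausdorff2_outer_def hausdorff2_pre_def covers_def cover_area_def ..

lemma hausdorff2_pre_le: "0 < \<delta> \<Longrightarrow> hausdorff2_pre \<delta> A \<le> hausdorff2_outer A"
  unfolding hausdorff2_outer_eq by (rule SUP_upper) simp

lemma hausdorff2_pre_mono: "A \<subseteq> B \<Longrightarrow> hausdorff2_pre \<delta> A \<le> hausdorff2_pre \<delta> B"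
  unfolding hausdorff2_pre_def by (rule INF_superset_mono) (auto simp: covers_def)

lemma hausdorff2_pre_antimono: "\<delta> \<le> \<epsilon> \<Longrightarrow> hausdorff2_pre \<epsilon> A \<le> hausdorff2_pre \<delta> A"
  unfolding hausdorff2_pre_def by (rule INF_superset_mono) (auto simp: covers_def intro: order_trans)

lemma hausdorff2_pre_subadditive:
  "hausdorff2_pre \<delta> (\<Union>n. A n) \<le> (\<Sum>n. hausdorff2_pre \<delta> (A n))"
proof (rule ennreal_le_epsilon)
  fix e :: real assume e: "0 < e" and fin: "(\<Sum>n. hausdorff2_pre \<delta> (A n)) < top"
  have *: "hausdorff2_pre \<delta> (A n) < hausdorff2_pre \<delta> (A n) + e * (1/2)^Suc n" for n
    using fin e by (auto simp: less_top dest!: ennreal_suminf_lessD)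
  have "\<exists>U. U \<in> covers \<delta> (A n) \<and> cover_area U \<le> hausdorff2_pre \<delta> (A n) + e * (1/2)^Suc n" for n
    using *[of n] unfolding hausdorff2_pre_def INF_less_iff by (auto intro: less_imp_le)
  then obtain U where U: "\<And>n. U n \<in> covers \<delta> (A n)"
    "\<And>n. cover_area (U n) \<le> hausdorff2_pre \<delta> (A n) + e * (1/2)^Suc n" by metis
  define V where "V = case_prod U \<circ> prod_decode"
  have "V \<in> covers \<delta> (\<Union>n. A n)"
    using U(1) by (auto simp: covers_def V_def subset_eq split: prod.splits)
      (metis prod.case prod_encode_inverse)
  then have "hausdorff2_pre \<delta> (\<Union>n. A n) \<le> cover_area V"
    unfolding hausdorff2_pre_def by (rule INF_lower)
  also have "\<dots> = (\<Sum>n. cover_area (U n))"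
    unfolding cover_area_def V_def comp_def
    by (rule suminf_ennreal_2dimen[where f = "\<lambda>p. ennreal (pi / 4 * (diameter (case p of (a, b) \<Rightarrow> U a b))\<^sup>2)"]) auto
  also have "\<dots> \<le> (\<Sum>n. hausdorff2_pre \<delta> (A n) + e * (1/2)^Suc n)"
    by (intro suminf_le U(2)) auto
  also have "\<dots> = (\<Sum>n. hausdorff2_pre \<delta> (A n)) + (\<Sum>n. ennreal e * ennreal ((1/2) ^ Suc n))"
    using e by (subst suminf_add[symmetric])
      (auto simp del: ennreal_suminf_cmult simp add: ennreal_mult[symmetric])
  also have "\<dots> = (\<Sum>n. hausdorff2_pre \<delta> (A n)) + e"
    unfolding ennreal_suminf_cmult
    by (subst suminf_ennreal_eq[OF zero_le_power power_half_series]) auto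
  finally show "hausdorff2_pre \<delta> (\<Union>n. A n) \<le> (\<Sum>n. hausdorff2_pre \<delta> (A n)) + e" .
qed

lemma hausdorff2_outer_subadditive:
  "hausdorff2_outer (\<Union>n. A n) \<le> (\<Sum>n. hausdorff2_outer (A n))"
  unfolding hausdorff2_outer_eq[of "\<Union>n. A n"]
proof (rule SUP_least)
  fix \<delta> :: real assume "\<delta> \<in> {0<..}"
  then have "(\<Sum>n. hausdorff2_pre \<delta> (A n)) \<le> (\<Sum>n. hausdorff2_outer (A n))"
    by (intro suminf_le hausdorff2_pre_le) auto
  then show "hausdorff2_pre \<delta> (\<Union>n. A n) \<le> (\<Sum>n. hausdorff2_outer (A n))"
    by (rule order_trans[OF hausdorff2_pre_subadditive])
qed

lemma hausdorff2_outer_mono: "A \<subseteq> B \<Longrightarrow> hausdorff2_outer A \<le> hausdorff2_outer B"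
  unfolding hausdorff2_outer_eq by (intro SUP_mono) (auto intro: hausdorff2_pre_mono)

text \<open>
  A covering set of diameter less than \<open>\<rho>\<close> cannot meet both \<open>A\<close> and \<open>B\<close>, so every cover splits into two.
\<close>

lemma hausdorff2_pre_separated:
  assumes \<delta>: "\<delta> < \<rho>" and d: "\<And>a b. a \<in> A \<Longrightarrow> b \<in> B \<Longrightarrow> \<rho> \<le> dist a b" "0 < \<delta>"
  shows "hausdorff2_pre \<delta> A + hausdorff2_pre \<delta> B \<le> hausdorff2_pre \<delta> (A \<union> B)"
  unfolding hausdorff2_pre_def[of \<delta> "A \<union> B"]
proof (rule INF_greatest)
  fix U assume U: "U \<in> covers \<delta> (A \<union> B)"
  define UA where "UA = (\<lambda>i. if U i \<inter> A \<noteq> {} then U i else {})"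
  define UB where "UB = (\<lambda>i. if U i \<inter> A \<noteq> {} then {} else U i)"
  have "UA \<in> covers \<delta> A"
    unfolding covers_def
  proof (intro CollectI conjI allI subsetI)
    fix x assume "x \<in> A"
    then obtain i where "x \<in> U i" using U by (auto simp: covers_def)
    with \<open>x \<in> A\<close> show "x \<in> (\<Union>i. UA i)" by (auto simp: UA_def intro!: exI[of _ i])
  next
    fix i
    show "bounded (UA i)" "diameter (UA i) \<le> \<delta>"
      using U d(2) by (auto simp: UA_def covers_def)
  qed
  then have 1: "hausdorff2_pre \<delta> A \<le> cover_area UA"
    unfolding hausdorff2_pre_def by (rule INF_lower)
  have disj: "U i \<inter> B = {}" if "U i \<inter> A \<noteq> {}" for i
  proof (rule ccontr)
    assume "U i \<inter> B \<noteq> {}"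
    with that obtain a b where ab: "a \<in> A" "b \<in> B" "a \<in> U i" "b \<in> U i" by auto
    have "dist a b \<le> diameter (U i)"
      using U ab by (intro diameter_bounded_bound) (auto simp: covers_def)
    moreover have "diameter (U i) \<le> \<delta>" using U by (auto simp: covers_def)
    ultimately show False using d(1)[OF ab(1,2)] \<delta> by simp
  qed
  have "UB \<in> covers \<delta> B"
    unfolding covers_def
  proof (intro CollectI conjI allI subsetI)
    fix x assume "x \<in> B"
    then obtain i where i: "x \<in> U i" using U by (auto simp: covers_def)
    then have "U i \<inter> A = {}" using disj[of i] \<open>x \<in> B\<close> by blast
    with i show "x \<in> (\<Union>i. UB i)" by (auto simp: UB_def intro!: exI[of _ i])
  next
    fix i
    show "bounded (UB i)" "diameter (UB i) \<le> \<delta>"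
      using U d(2) by (auto simp: UB_def covers_def)
  qed
  then have 2: "hausdorff2_pre \<delta> B \<le> cover_area UB"
    unfolding hausdorff2_pre_def by (rule INF_lower)
  have "cover_area UA + cover_area UB = cover_area U"
    unfolding cover_area_def by (subst suminf_add) (auto intro!: suminf_cong simp: UA_def UB_def)
  with add_mono[OF 1 2] show "hausdorff2_pre \<delta> A + hausdorff2_pre \<delta> B \<le> cover_area U" by simp
qed

lemma hausdorff2_outer_seq: "hausdorff2_outer A = (SUP n. hausdorff2_pre (1 / real (Suc n)) A)"
proof (rule antisym)
  show "hausdorff2_outer A \<le> (SUP n. hausdorff2_pre (1 / real (Suc n)) A)"
    unfolding hausdorff2_outer_eq
  proof (rule SUP_least)
    fix \<delta> :: real assume "\<delta> \<in> {0<..}"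
    then obtain n where "1 / real (Suc n) < \<delta>" using nat_approx_posE by auto
    then have "hausdorff2_pre \<delta> A \<le> hausdorff2_pre (1 / real (Suc n)) A"
      by (intro hausdorff2_pre_antimono) simp
    then show "hausdorff2_pre \<delta> A \<le> (SUP n. hausdorff2_pre (1 / real (Suc n)) A)"
      by (rule order_trans) (rule SUP_upper, simp)
  qed
  show "(SUP n. hausdorff2_pre (1 / real (Suc n)) A) \<le> hausdorff2_outer A"
    by (intro SUP_least hausdorff2_pre_le) simp
qed

lemma hausdorff2_outer_separated:
  assumes \<rho>: "0 < \<rho>" and d: "\<And>a b. a \<in> A \<Longrightarrow> b \<in> B \<Longrightarrow> \<rho> \<le> dist a b"
  shows "hausdorff2_outer A + hausdorff2_outer B \<le> hausdorff2_outer (A \<union> B)"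
proof -
  have inc: "incseq (\<lambda>n. hausdorff2_pre (1 / real (Suc n)) C)" for C
    by (intro monoI hausdorff2_pre_antimono) (simp add: frac_le)
  have "hausdorff2_outer A + hausdorff2_outer B
     = (SUP n. hausdorff2_pre (1 / real (Suc n)) A + hausdorff2_pre (1 / real (Suc n)) B)"
    unfolding hausdorff2_outer_seq by (rule ennreal_SUP_add[OF inc inc, symmetric])
  also have "\<dots> \<le> hausdorff2_outer (A \<union> B)"
  proof (rule SUP_least)
    fix n
    define \<delta> where "\<delta> = min (1 / real (Suc n)) (\<rho> / 2)"
    have \<delta>: "0 < \<delta>" "\<delta> < \<rho>" "\<delta> \<le> 1 / real (Suc n)" using \<rho> by (auto simp: \<delta>_def)
    have "hausdorff2_pre (1 / real (Suc n)) A + hausdorff2_pre (1 / real (Suc n)) B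
       \<le> hausdorff2_pre \<delta> A + hausdorff2_pre \<delta> B"
      by (intro add_mono hausdorff2_pre_antimono \<delta>)
    also have "\<dots> \<le> hausdorff2_pre \<delta> (A \<union> B)"
      by (rule hausdorff2_pre_separated[OF \<delta>(2) d \<delta>(1)])
    also have "\<dots> \<le> hausdorff2_outer (A \<union> B)" by (rule hausdorff2_pre_le[OF \<delta>(1)])
    finally show "hausdorff2_pre (1 / real (Suc n)) A + hausdorff2_pre (1 / real (Suc n)) B
       \<le> hausdorff2_outer (A \<union> B)" .
  qed
  finally show ?thesis .
qed

lemma hausdorff2_outer_empty: "hausdorff2_outer {} = 0"
proof -
  have "hausdorff2_pre \<delta> {} = 0" if "\<delta> > 0" for \<delta>
  proof -
    have "hausdorff2_pre \<delta> {} \<le> cover_area (\<lambda>i. {})"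
      unfolding hausdorff2_pre_def by (rule INF_lower) (use that in \<open>auto simp: covers_def\<close>)
    then show ?thesis by (simp add: cover_area_def)
  qed
  then show ?thesis unfolding hausdorff2_outer_eq by (auto intro!: antisym SUP_least)
qed

text \<open>
  The constant \<open>measure_of\<close> yields the null measure when it is applied to a set function that is not countably
  additive. The definition of the surface measure has content only because of Caratheodory's criterion.
\<close>

lemma emeasure_hausdorff2: "B \<in> sets borel \<Longrightarrow> emeasure hausdorff2 B = hausdorff2_outer B"
  and sets_hausdorff2: "sets hausdorff2 = sets borel"
  and space_hausdorff2: "space hausdorff2 = UNIV"
proof -
  have ms: "measure_space UNIV (sets borel) hausdorff2_outer"
    by (rule metric_outer_measure_borel[OF hausdorff2_outer_empty hausdorff2_outer_mono
          hausdorff2_outer_subadditive hausdorff2_outer_separated])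
  have sb: "sigma_sets UNIV (sets (borel :: (real^3) measure)) = sets borel"
    using sets.sigma_sets_eq[of "borel :: (real^3) measure"] by simp
  show "sets hausdorff2 = sets borel" "space hausdorff2 = UNIV"
    unfolding hausdorff2_def using sb by (auto simp: sets_measure_of_conv space_measure_of_conv)
  assume "B \<in> sets borel"
  then show "emeasure hausdorff2 B = hausdorff2_outer B"
    unfolding hausdorff2_def using ms sb by (simp add: emeasure_measure_of_conv)
qed

text \<open>
  \<open>N + 1\<close> balls of radius \<open>L / N\<close> cover a segment of length \<open>L\<close>, and the sum of their areas is of order \<open>1 / N\<close>.
\<close>

lemma hausdorff2_segment: "hausdorff2_outer (closed_segment a b) = 0"
proof -
  define L where "L = norm (b - a)"
  have L0: "0 \<le> L" by (simp add: L_def)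
  have "hausdorff2_pre \<delta> (closed_segment a b) = 0" if \<delta>: "\<delta> > 0" for \<delta>
  proof -
    have *: "hausdorff2_pre \<delta> (closed_segment a b) \<le> 0 + ennreal e" if e: "e > 0" for e
    proof -
      obtain N :: nat where N: "max (2 * L / \<delta>) (2 * pi * L\<^sup>2 / e) < real N"
        using reals_Archimedean2 by blast
      then have N1: "2 * L / \<delta> < real N" and N2: "2 * pi * L\<^sup>2 / e < real N" by auto
      have Npos: "real N > 0" using N1 L0 \<delta> by (smt (verit) divide_nonneg_pos mult_nonneg_nonneg)
      define p where "p = (\<lambda>k. a + (real k / real N) *\<^sub>R (b - a))"
      define U where "U = (\<lambda>k. if k \<le> N then cball (p k) (L / real N) else {})"
      have diam: "diameter (U k) = (if k \<le> N then 2 * (L / real N) else 0)" for k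
        using divide_nonneg_pos[OF L0 Npos] by (auto simp: U_def not_less[symmetric])
      have "U \<in> covers \<delta> (closed_segment a b)"
        unfolding covers_def
      proof (intro CollectI conjI allI subsetI)
        fix x assume "x \<in> closed_segment a b"
        then obtain t where t: "0 \<le> t" "t \<le> 1" "x = (1 - t) *\<^sub>R a + t *\<^sub>R b"
          by (auto simp: closed_segment_def)
        then have x: "x = a + t *\<^sub>R (b - a)" by (simp add: algebra_simps)
        define k where "k = nat \<lfloor>t * real N\<rfloor>"
        have k: "real k \<le> t * real N" "t * real N < real k + 1"
          using t(1) Npos by (auto simp: k_def)
        have "t * real N \<le> 1 * real N" using t(2) Npos by (intro mult_right_mono) auto
        then have "real k \<le> real N" using k(1) by simp
        then have kN: "k \<le> N" by simp
        have "p k - x = (real k / real N - t) *\<^sub>R (b - a)" by (simp add: p_def x algebra_simps)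
        then have "dist (p k) x = \<bar>real k / real N - t\<bar> * L" by (simp add: dist_norm L_def)
        also have "\<bar>real k / real N - t\<bar> \<le> 1 / real N"
        proof -
          have "real k / real N - t = (real k - t * real N) / real N"
            using Npos by (simp add: diff_divide_distrib)
          also have "\<bar>\<dots>\<bar> = \<bar>real k - t * real N\<bar> / real N" by simp
          also have "\<dots> \<le> 1 / real N" using k by (intro divide_right_mono) auto
          finally show ?thesis .
        qed
        finally have "dist (p k) x \<le> L / real N" using L0 by (simp add: mult_right_mono)
        then show "x \<in> (\<Union>i. U i)" using kN by (auto simp: U_def)
      next
        fix k
        show "bounded (U k)" by (simp add: U_def)
        show "diameter (U k) \<le> \<delta>"
          using N1 \<delta> Npos by (auto simp: diam field_simps)
      qed
      then have "hausdorff2_pre \<delta> (closed_segment a b) \<le> cover_area U"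
        unfolding hausdorff2_pre_def by (rule INF_lower)
      also have "cover_area U = (\<Sum>k\<le>N. ennreal (pi / 4 * (diameter (U k))\<^sup>2))"
        unfolding cover_area_def by (rule suminf_finite) (auto simp: diam)
      also have "\<dots> = ennreal (\<Sum>k\<le>N. pi / 4 * (diameter (U k))\<^sup>2)"
        by (rule sum_ennreal) simp
      also have "(\<Sum>k\<le>N. pi / 4 * (diameter (U k))\<^sup>2) = (real N + 1) * (pi * (L / real N)\<^sup>2)"
        by (simp add: diam power2_eq_square)
      also have "\<dots> \<le> (real N + real N) * (pi * (L / real N)\<^sup>2)"
        using Npos by (intro mult_right_mono) auto
      also have "\<dots> = 2 * pi * L\<^sup>2 / real N" using Npos by (simp add: field_simps power2_eq_square)
      also have "\<dots> \<le> e" using N2 e Npos by (simp add: field_simps)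
      finally show ?thesis by (simp add: ennreal_leI)
    qed
    have "hausdorff2_pre \<delta> (closed_segment a b) \<le> 0" by (rule ennreal_le_epsilon, rule *)
    then show ?thesis by simp
  qed
  then show ?thesis unfolding hausdorff2_outer_eq by (auto intro!: antisym SUP_least)
qed

text \<open>
  Here \<open>s z\<close> is the length by which the plane \<open>{x. m \<bullet> x = c}\<close> has to be translated along e to reach z. The
  cylinder of length \<open>\<tau>\<close> over a piece of the plane of diameter \<open>d \<le> \<tau>\<close> lies in a box with sides \<open>2 d\<close>, \<open>2 d\<close> and
  \<open>2 d + \<tau>\<close>, whose volume is at most \<open>12 * \<tau> * d\<^sup>2\<close>. Comparing with the area \<open>pi / 4 * d\<^sup>2\<close> gives the factor.
  Covers at scale \<open>\<tau>\<close> are enough, so no limit is taken.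
\<close>

lemma cylinder_le_hausdorff2:
  fixes m e :: "real^3" and c \<tau> :: real
  defines "s \<equiv> \<lambda>z. (m \<bullet> z - c) / (m \<bullet> e)"
  assumes e: "e \<in> Basis" and \<tau>: "0 < \<tau>"
  shows "ennreal (pi / (48 * \<tau>)) * emeasure lborel {z. 0 \<le> s z \<and> s z \<le> \<tau> \<and> z - s z *\<^sub>R e \<in> B}
     \<le> hausdorff2_outer B"
proof -
  let ?Z = "{z. 0 \<le> s z \<and> s z \<le> \<tau> \<and> z - s z *\<^sub>R e \<in> B}"
  have cs: "continuous_on UNIV s" unfolding s_def divide_inverse by (intro continuous_intros)
  have "ennreal (pi / (48 * \<tau>)) * emeasure lborel ?Z \<le> cover_area U" if U: "U \<in> covers \<tau> B" for U
  proof -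
    define x where "x = (\<lambda>i. SOME y. y \<in> U i)"
    define W where "W = (\<lambda>i. if U i = {} then {} else
        {z. 0 \<le> s z \<and> s z \<le> \<tau> \<and> dist (x i) (z - s z *\<^sub>R e) \<le> diameter (U i)})"
    have sub: "?Z \<subseteq> (\<Union>i. W i)"
    proof
      fix z assume z: "z \<in> ?Z"
      then obtain i where i: "z - s z *\<^sub>R e \<in> U i" using U by (auto simp: covers_def)
      then have "x i \<in> U i" unfolding x_def by (rule someI)
      then have "dist (x i) (z - s z *\<^sub>R e) \<le> diameter (U i)"
        using U i by (intro diameter_bounded_bound) (auto simp: covers_def)
      then show "z \<in> (\<Union>i. W i)" using z i by (auto simp: W_def)
    qed
    have "closed (W i)" for i
      unfolding W_def by (auto intro!: closed_Collect_conj closed_Collect_le continuous_intros cs)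
    then have Wb: "W i \<in> sets lborel" for i by auto
    have vol: "emeasure lborel (W i) \<le> ennreal (12 * \<tau> * (diameter (U i))\<^sup>2)" for i
    proof -
      let ?d = "diameter (U i)"
      have d: "0 \<le> ?d" "?d \<le> \<tau>" using U diameter_ge_0 by (auto simp: covers_def)
      let ?l = "x i - ?d *\<^sub>R One" and ?u = "x i + ?d *\<^sub>R One + \<tau> *\<^sub>R e"
      have "W i \<subseteq> cbox ?l ?u"
      proof
        fix z assume "z \<in> W i"
        then have z: "0 \<le> s z" "s z \<le> \<tau>" "norm (x i - (z - s z *\<^sub>R e)) \<le> ?d"
          by (auto simp: W_def dist_norm split: if_splits)
        show "z \<in> cbox ?l ?u"
          unfolding mem_box
        proof (intro ballI conjI)
          fix b :: "real^3" assume b: "b \<in> Basis"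
          have "\<bar>(x i - (z - s z *\<^sub>R e)) \<bullet> b\<bar> \<le> ?d" using Basis_le_norm[OF b] z(3) by (rule order_trans)
          then have "\<bar>x i \<bullet> b - z \<bullet> b + s z * (e \<bullet> b)\<bar> \<le> ?d" by (simp add: inner_diff_left)
          moreover have "0 \<le> s z * (e \<bullet> b)" "s z * (e \<bullet> b) \<le> \<tau> * (e \<bullet> b)"
            using z e b by (auto simp: inner_Basis)
          ultimately show "?l \<bullet> b \<le> z \<bullet> b" "z \<bullet> b \<le> ?u \<bullet> b"
            using b by (auto simp: inner_diff_left inner_add_left)
        qed
      qed
      then have "emeasure lborel (W i) \<le> emeasure lborel (cbox ?l ?u)"
        by (intro emeasure_mono) auto
      also have "\<dots> = ennreal (\<Prod>b\<in>Basis. (?u - ?l) \<bullet> b)"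
        by (rule emeasure_lborel_cbox) (use d \<tau> e in \<open>auto simp: inner_diff_left inner_add_left inner_Basis\<close>)
      also have "(\<Prod>b\<in>Basis. (?u - ?l) \<bullet> b) = (\<Prod>b\<in>Basis. if b = e then 2 * ?d + \<tau> else 2 * ?d)"
      proof (intro prod.cong refl)
        fix b :: "real^3" assume b: "b \<in> Basis"
        have "(?u - ?l) \<bullet> b = (x i \<bullet> b + ?d * (One \<bullet> b) + \<tau> * (e \<bullet> b)) - (x i \<bullet> b - ?d * (One \<bullet> b))"
          by (simp only: inner_diff_left inner_add_left inner_scaleR_left)
        then show "(?u - ?l) \<bullet> b = (if b = e then 2 * ?d + \<tau> else 2 * ?d)"
          using e b by (auto simp: inner_Basis)
      qed
      also have "\<dots> = (2 * ?d + \<tau>) * (\<Prod>b\<in>Basis - {e}. if b = e then 2 * ?d + \<tau> else 2 * ?d)"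
        using e by (subst prod.remove[of _ e]) auto
      also have "(\<Prod>b\<in>Basis - {e}. if b = e then 2 * ?d + \<tau> else 2 * ?d) = (\<Prod>b\<in>Basis - {e}. 2 * ?d)"
        by (intro prod.cong) auto
      also have "\<dots> = (2 * ?d)\<^sup>2" using e by (simp add: card_Diff_singleton)
      also have "(2 * ?d + \<tau>) * (2 * ?d)\<^sup>2 \<le> (3 * \<tau>) * (2 * ?d)\<^sup>2"
        using d by (intro mult_right_mono) auto
      also have "\<dots> = 12 * \<tau> * ?d\<^sup>2" by (simp add: power2_eq_square)
      finally show ?thesis by (simp add: ennreal_leI)
    qed
    have "emeasure lborel ?Z \<le> emeasure lborel (\<Union>i. W i)"
      using sub Wb by (intro emeasure_mono) auto
    also have "\<dots> \<le> (\<Sum>i. emeasure lborel (W i))"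
      using Wb by (intro emeasure_subadditive_countably) auto
    also have "\<dots> \<le> (\<Sum>i. ennreal (12 * \<tau> * (diameter (U i))\<^sup>2))"
      by (intro suminf_le vol) auto
    finally have "ennreal (pi / (48 * \<tau>)) * emeasure lborel ?Z
        \<le> ennreal (pi / (48 * \<tau>)) * (\<Sum>i. ennreal (12 * \<tau> * (diameter (U i))\<^sup>2))"
      by (intro mult_left_mono) auto
    also have "\<dots> = cover_area U"
      unfolding cover_area_def using \<tau>
      by (subst ennreal_suminf_cmult[symmetric])
         (auto simp: ennreal_mult[symmetric] intro!: suminf_cong arg_cong[where f = ennreal])
    finally show ?thesis .
  qed
  then have "ennreal (pi / (48 * \<tau>)) * emeasure lborel ?Z \<le> hausdorff2_pre \<tau> B"
    unfolding hausdorff2_pre_def by (intro INF_greatest)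
  also have "\<dots> \<le> hausdorff2_outer B" by (rule hausdorff2_pre_le[OF \<tau>])
  finally show ?thesis .
qed

section \<open>The boundary controls integrated derivatives\<close>

text \<open>
  The previous bound says that the image of Lebesgue measure on a slab, under projection along e onto the
  plane, is dominated by a multiple of the Hausdorff measure.
\<close>

lemma slab_nn_integral_le:
  fixes m e :: "real^3" and c \<tau> :: real and G :: "real^3 \<Rightarrow> ennreal"
  defines "s \<equiv> \<lambda>z. (m \<bullet> z - c) / (m \<bullet> e)"
  assumes e: "e \<in> Basis" and \<tau>: "0 < \<tau>" and G: "G \<in> borel_measurable borel"
  shows "ennreal (pi / (48 * \<tau>)) * (\<integral>\<^sup>+z. G (z - s z *\<^sub>R e) * indicator {z. 0 \<le> s z \<and> s z \<le> \<tau>} z \<partial>lborel)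
     \<le> (\<integral>\<^sup>+x. G x \<partial>hausdorff2)"
proof -
  let ?r = "ennreal (pi / (48 * \<tau>))"
  let ?Z = "{z. 0 \<le> s z \<and> s z \<le> \<tau>}"
  define q where "q = (\<lambda>z. z - s z *\<^sub>R e)"
  have cs: "continuous_on UNIV s" unfolding s_def divide_inverse by (intro continuous_intros)
  have "closed ?Z" by (auto intro!: closed_Collect_conj closed_Collect_le continuous_intros cs)
  then have Z: "?Z \<in> sets borel" by simp
  have "continuous_on UNIV q" unfolding q_def by (intro continuous_intros cs)
  then have q: "q \<in> borel_measurable borel" by (rule borel_measurable_continuous_onI)
  then have qr: "q \<in> measurable (restrict_space lborel ?Z) borel"
    by (intro measurable_restrict_space1) simp
  let ?\<nu> = "distr (restrict_space lborel ?Z) borel q"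
  have le: "scale_measure ?r ?\<nu> \<le> hausdorff2"
  proof (subst le_measure)
    show "sets (scale_measure ?r ?\<nu>) = sets hausdorff2" by (simp add: sets_hausdorff2)
    show "\<forall>B\<in>sets (scale_measure ?r ?\<nu>). emeasure (scale_measure ?r ?\<nu>) B \<le> emeasure hausdorff2 B"
    proof
      fix B assume "B \<in> sets (scale_measure ?r ?\<nu>)"
      then have B: "B \<in> sets borel" by simp
      have "emeasure ?\<nu> B = emeasure (restrict_space lborel ?Z) (q -` B \<inter> ?Z)"
        using qr B by (subst emeasure_distr) (auto simp: space_restrict_space)
      also have "\<dots> = emeasure lborel (q -` B \<inter> ?Z)"
        using Z by (intro emeasure_restrict_space) auto
      also have "q -` B \<inter> ?Z = {z. 0 \<le> s z \<and> s z \<le> \<tau> \<and> z - s z *\<^sub>R e \<in> B}"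
        by (auto simp: q_def)
      finally show "emeasure (scale_measure ?r ?\<nu>) B \<le> emeasure hausdorff2 B"
        using cylinder_le_hausdorff2[OF e \<tau>, of m c B] B
        by (simp add: emeasure_hausdorff2 s_def)
    qed
  qed
  have "?r * (\<integral>\<^sup>+z. G (q z) * indicator ?Z z \<partial>lborel) = ?r * (\<integral>\<^sup>+z. G (q z) \<partial>restrict_space lborel ?Z)"
    using Z by (subst nn_integral_restrict_space) auto
  also have "\<dots> = ?r * (\<integral>\<^sup>+x. G x \<partial>?\<nu>)"
    by (subst nn_integral_distr[OF qr]) (use G in auto)
  also have "\<dots> = (\<integral>\<^sup>+x. G x \<partial>scale_measure ?r ?\<nu>)"
    by (rule nn_integral_scale_measure[symmetric]) (use G in simp)
  also have "\<dots> \<le> (\<integral>\<^sup>+x. G x \<partial>hausdorff2)"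
    by (rule nn_integral_mono_measure[OF _ le]) (simp add: sets_hausdorff2)
  finally show ?thesis by (simp add: q_def)
qed

lemma hyperplane_null_sets:
  fixes m :: "real^3"
  assumes "m \<noteq> 0"
  shows "{z. m \<bullet> z = c} \<in> null_sets lborel"
proof -
  have "negligible {z. m \<bullet> z = c}" using assms by (intro negligible_hyperplane) auto
  moreover have "closed {z. m \<bullet> z = c}" by (rule closed_hyperplane)
  ultimately show ?thesis by (simp add: negligible_iff_null_sets null_sets_completion_iff)
qed

lemma slab_emeasure_tendsto_0:
  fixes m e :: "real^3" and c R :: real
  defines "s \<equiv> \<lambda>z. (m \<bullet> z - c) / (m \<bullet> e)"
  assumes me: "m \<bullet> e \<noteq> 0"
  shows "(\<lambda>n. emeasure lborel ({z. 0 \<le> s z \<and> s z \<le> 1 / real (Suc n)} \<inter> cball 0 R)) \<longlonglongrightarrow> 0"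
proof -
  let ?A = "\<lambda>n. {z. 0 \<le> s z \<and> s z \<le> 1 / real (Suc n)} \<inter> cball 0 R"
  have cs: "continuous_on UNIV s" unfolding s_def divide_inverse by (intro continuous_intros)
  have cl: "closed (?A n)" for n
    by (intro closed_Int closed_cball) (auto intro!: closed_Collect_conj closed_Collect_le continuous_intros cs)
  have lim: "(\<lambda>n. emeasure lborel (?A n)) \<longlonglongrightarrow> emeasure lborel (\<Inter>n. ?A n)"
  proof (rule Lim_emeasure_decseq)
    show "range ?A \<subseteq> sets lborel" using cl by auto
    have "1 / real (Suc k) \<le> 1 / real (Suc n)" if "n \<le> k" for n k
      using that by (simp add: frac_le)
    then show "decseq ?A"
      unfolding decseq_def by (auto intro: order_trans)
    fix n
    have "emeasure lborel (?A n) \<le> emeasure lborel (cball (0::real^3) R)"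
      by (rule emeasure_mono) auto
    then show "emeasure lborel (?A n) \<noteq> \<infinity>"
      using emeasure_bounded_finite[OF bounded_cball, of "0::real^3" R] by auto
  qed
  have sub: "(\<Inter>n. ?A n) \<subseteq> {z. m \<bullet> z = c}"
  proof
    fix z assume z: "z \<in> (\<Inter>n. ?A n)"
    then have "0 \<le> s z" and le: "s z \<le> 1 / real (Suc n)" for n by auto
    have "s z \<le> 0"
    proof (rule ccontr)
      assume "\<not> s z \<le> 0"
      then obtain n where "1 / real (Suc n) < s z" by (meson nat_approx_posE not_le)
      then show False using le[of n] by simp
    qed
    with \<open>0 \<le> s z\<close> have "s z = 0" by simp
    then show "z \<in> {z. m \<bullet> z = c}" using me by (simp add: s_def)
  qed
  have null: "{z. m \<bullet> z = c} \<in> null_sets lborel"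
    using me by (intro hyperplane_null_sets) auto
  have "emeasure lborel (\<Inter>n. ?A n) \<le> emeasure lborel {z. m \<bullet> z = c}"
    by (rule emeasure_mono[OF sub]) (simp add: closed_hyperplane)
  also have "\<dots> = 0" using null by (rule null_setsD1)
  finally have "emeasure lborel (\<Inter>n. ?A n) = 0" by simp
  with lim show ?thesis by (simp only:)
qed

text \<open>
  A point in exactly one of \<open>\<Omega>\<close> and \<open>\<Omega> + e / n\<close> lies in a cylinder of length \<open>1 / n\<close> over the boundary, which is part
  of finitely many planes. Planes parallel to e only contribute null sets. For the others, replacing the value
  of f by its value at the foot of the cylinder costs at most a Lipschitz constant times \<open>1 / n\<close>, and this error
  is integrated over a set of vanishing measure.
\<close>

lemma trace_inequality:
  fixes \<Omega> :: "(real^3) set" and P :: "((real^3) \<times> real) set"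
  assumes \<Omega>: "open \<Omega>" "bounded \<Omega>" and P: "finite P" "\<And>m c. (m, c) \<in> P \<Longrightarrow> m \<noteq> 0"
    and front: "\<And>x. x \<in> frontier \<Omega> \<Longrightarrow> \<exists>(m, c)\<in>P. m \<bullet> x = c"
    and e: "e \<in> Basis" and f: "C1_grad f f'"
  shows "ennreal \<bar>\<integral>x. f' x \<bullet> e \<partial>lebesgue_on \<Omega>\<bar>
     \<le> ennreal (real (card P) * (48 / pi)) * (\<integral>\<^sup>+x. ennreal \<bar>f x\<bar> \<partial>surface \<Omega>)"
proof -
  define P' where "P' = {p\<in>P. fst p \<bullet> e \<noteq> 0}"
  have P': "finite P'" "P' \<subseteq> P" using P(1) by (auto simp: P'_def)
  define s where "s = (\<lambda>p z. (fst p \<bullet> z - snd p) / (fst p \<bullet> e))"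
  define q where "q = (\<lambda>p z. z - s p z *\<^sub>R e)"
  define N where "N = (\<Union>p\<in>P - P'. {z. fst p \<bullet> z = snd p})"
  define \<tau> where "\<tau> = (\<lambda>n. 1 / real (Suc n))"
  have \<tau>: "0 < \<tau> n" "\<tau> n \<le> 1" for n by (auto simp: \<tau>_def)
  have ne: "norm e = 1" using e by simp
  obtain B where B: "\<And>x. x \<in> \<Omega> \<Longrightarrow> norm x \<le> B" using \<Omega>(2) bounded_iff by blast
  have "closure \<Omega> \<subseteq> cball 0 B" by (rule closure_minimal) (use B in auto)
  then have BF: "norm x \<le> B" if "x \<in> frontier \<Omega>" for x
    using that by (auto simp: frontier_def)
  obtain M where M: "M \<ge> 0" "\<And>x y. norm x \<le> B + 1 \<Longrightarrow> norm y \<le> B + 1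
       \<Longrightarrow> \<bar>f x - f y\<bar> \<le> M * norm (x - y)"
    using C1_grad_lipschitz_on_ball[OF f] by blast
  define Z where "Z = (\<lambda>n p. {z. 0 \<le> s p z \<and> s p z \<le> \<tau> n})"
  have cs: "continuous_on UNIV (s p)" for p
    unfolding s_def divide_inverse by (intro continuous_intros)
  have cf: "continuous_on UNIV f" using C1_gradD(3)[OF f] .
  have cq: "continuous_on UNIV (q p)" for p unfolding q_def by (intro continuous_intros cs)
  have "closed (Z n p)" for n p
    unfolding Z_def by (auto intro!: closed_Collect_conj closed_Collect_le continuous_intros cs)
  then have Zb: "Z n p \<in> sets borel" for n p by simp
  have Nnull: "N \<in> null_sets lborel"
  proof -
    have "{z. fst p \<bullet> z = snd p} \<in> null_sets lborel" if "p \<in> P" for p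
      using P(2)[of "fst p" "snd p"] that by (intro hyperplane_null_sets) auto
    then show ?thesis unfolding N_def using P(1) by (intro null_sets.finite_UN) auto
  qed
  define G where "G = (\<lambda>x. ennreal \<bar>f x\<bar> * indicator (frontier \<Omega>) x)"
  have [measurable]: "f \<in> borel_measurable borel" by (rule borel_measurable_continuous_onI[OF cf])
  have [measurable]: "frontier \<Omega> \<in> sets borel" by simp
  have G[measurable]: "G \<in> borel_measurable borel" unfolding G_def by measurable
  have [measurable]: "q p \<in> borel_measurable borel" for p by (rule borel_measurable_continuous_onI[OF cq])
  have Gsurf: "(\<integral>\<^sup>+x. G x \<partial>hausdorff2) = (\<integral>\<^sup>+x. ennreal \<bar>f x\<bar> \<partial>surface \<Omega>)"
    unfolding surface_def G_def
    by (rule nn_integral_restrict_space[symmetric]) (simp add: sets_hausdorff2 space_hausdorff2)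
  let ?D = "\<lambda>n. {x. (x - \<tau> n *\<^sub>R e \<in> \<Omega>) \<noteq> (x \<in> \<Omega>)}"
  \<comment> \<open>Moving back from z by at most \<open>\<tau> n\<close> in direction e one meets a boundary point, namely the
    projection of z along e onto one of the planes that are transversal to e.\<close>
  have pointwise: "indicator (?D n) z * ennreal \<bar>f z\<bar>
      \<le> (\<Sum>p\<in>P'. G (q p z) * indicator (Z n p) z
           + ennreal (M * \<tau> n) * indicator (Z n p \<inter> cball 0 (B + 1)) z)"
    if zN: "z \<notin> N" for n z
  proof (cases "z \<in> ?D n")
    case True
    let ?d = "\<tau> n *\<^sub>R e"
    let ?L = "closed_segment (z - ?d) z"
    have "?L \<inter> frontier \<Omega> \<noteq> {}"
      by (rule connected_Int_frontier) (use True in auto)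
    then obtain y where y: "y \<in> ?L" "y \<in> frontier \<Omega>" by auto
    then obtain t where t: "0 \<le> t" "t \<le> 1" "y = (1 - t) *\<^sub>R (z - ?d) + t *\<^sub>R z"
      by (auto simp: closed_segment_def)
    define t' where "t' = (1 - t) * \<tau> n"
    have t': "0 \<le> t'" "t' \<le> \<tau> n" using t \<tau>[of n] by (auto simp: t'_def mult_left_le_one_le)
    have yz: "y = z - t' *\<^sub>R e" using t(3) by (simp add: algebra_simps t'_def)
    obtain p where p: "p \<in> P" "fst p \<bullet> y = snd p" using front[OF y(2)] by auto
    have p': "p \<in> P'"
    proof (rule ccontr)
      assume "p \<notin> P'"
      then have "fst p \<bullet> e = 0" using p(1) by (auto simp: P'_def)
      then have "fst p \<bullet> z = snd p" using p(2) by (simp add: yz inner_diff_right)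
      then show False using zN p(1) \<open>p \<notin> P'\<close> by (auto simp: N_def)
    qed
    then have pe: "fst p \<bullet> e \<noteq> 0" by (simp add: P'_def)
    have "fst p \<bullet> z - snd p = t' * (fst p \<bullet> e)" using p(2) by (simp add: yz inner_diff_right)
    then have sz: "s p z = t'" using pe by (simp add: s_def)
    have qz: "q p z = y" by (simp add: q_def sz yz)
    have zZ: "z \<in> Z n p" using t' by (simp add: Z_def sz)
    have nzy: "norm (z - y) \<le> \<tau> n" using t' ne by (simp add: yz)
    have "norm z \<le> norm (z - y) + norm y" by (metis diff_add_cancel norm_triangle_ineq)
    then have nz: "norm z \<le> B + 1" using nzy \<tau>(2)[of n] BF[OF y(2)] by simp
    have "\<bar>f z - f y\<bar> \<le> M * norm (z - y)" using M(2)[OF nz, of y] BF[OF y(2)] by simp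
    also have "\<dots> \<le> M * \<tau> n" using nzy M(1) by (rule mult_left_mono)
    finally have "\<bar>f z\<bar> \<le> \<bar>f y\<bar> + M * \<tau> n" by simp
    then have "ennreal \<bar>f z\<bar> \<le> ennreal (\<bar>f y\<bar> + M * \<tau> n)" by (rule ennreal_leI)
    also have "\<dots> = ennreal \<bar>f y\<bar> + ennreal (M * \<tau> n)"
      using M(1) \<tau>[of n] by (intro ennreal_plus) auto
    also have "\<dots> = G (q p z) * indicator (Z n p) z
           + ennreal (M * \<tau> n) * indicator (Z n p \<inter> cball 0 (B + 1)) z"
      using zZ nz y(2) by (simp add: G_def qz)
    also have "\<dots> \<le> (\<Sum>p\<in>P'. G (q p z) * indicator (Z n p) z
           + ennreal (M * \<tau> n) * indicator (Z n p \<inter> cball 0 (B + 1)) z)"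
      using p' P'(1) by (intro member_le_sum) auto
    finally show ?thesis using True by simp
  qed simp
  \<comment> \<open>The error made by replacing the value of f at z by its value at the projection of z.\<close>
  define \<epsilon> where "\<epsilon> = (\<lambda>n. \<Sum>p\<in>P'. ennreal M * emeasure lborel (Z n p \<inter> cball 0 (B + 1)))"
  let ?X = "\<integral>\<^sup>+x. ennreal \<bar>f x\<bar> \<partial>surface \<Omega>"
  have bound: "ennreal \<bar>real (Suc n) * (\<integral>x. f (x + \<tau> n *\<^sub>R e) - f x \<partial>lebesgue_on \<Omega>)\<bar>
      \<le> ennreal (real (card P) * (48 / pi)) * ?X + \<epsilon> n" for n
  proof -
    let ?i = "\<integral>x. f (x + \<tau> n *\<^sub>R e) - f x \<partial>lebesgue_on \<Omega>"
    let ?g = "\<lambda>x. indicator (?D n) x * \<bar>f x\<bar>"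
    have "\<bar>?i\<bar> \<le> (\<integral>x. ?g x \<partial>lborel)"
      by (rule difference_integral_le_symdiff[OF cf \<Omega>(2)]) (use \<Omega>(1) in simp)
    then have "ennreal \<bar>?i\<bar> \<le> ennreal (\<integral>x. ?g x \<partial>lborel)" by (rule ennreal_leI)
    also have "\<dots> \<le> (\<integral>\<^sup>+x. ennreal (?g x) \<partial>lborel)"
    proof (cases "integrable lborel ?g")
      case True
      then show ?thesis by (subst nn_integral_eq_integral) auto
    next
      case False
      then show ?thesis by (simp add: not_integrable_integral_eq)
    qed
    also have "\<dots> \<le> (\<integral>\<^sup>+z. (\<Sum>p\<in>P'. G (q p z) * indicator (Z n p) z
           + ennreal (M * \<tau> n) * indicator (Z n p \<inter> cball 0 (B + 1)) z) \<partial>lborel)"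
    proof (rule nn_integral_mono_AE)
      have "AE z in lborel. z \<notin> N" by (rule AE_not_in[OF Nnull])
      then show "AE z in lborel. ennreal (?g z) \<le> (\<Sum>p\<in>P'. G (q p z) * indicator (Z n p) z
           + ennreal (M * \<tau> n) * indicator (Z n p \<inter> cball 0 (B + 1)) z)"
      proof eventually_elim
        case (elim z)
        have "ennreal (?g z) = indicator (?D n) z * ennreal \<bar>f z\<bar>"
          by (simp add: indicator_def)
        then show ?case using pointwise[OF elim, of n] by presburger
      qed
    qed
    also have "\<dots> = (\<Sum>p\<in>P'. (\<integral>\<^sup>+z. G (q p z) * indicator (Z n p) z \<partial>lborel)
           + ennreal (M * \<tau> n) * emeasure lborel (Z n p \<inter> cball 0 (B + 1)))"
    proof -
      note [measurable] = Zb
      have meas: "(\<lambda>z. G (q p z) * indicator (Z n p) z) \<in> borel_measurable lborel"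
        "(\<lambda>z. ennreal (M * \<tau> n) * indicator (Z n p \<inter> cball 0 (B + 1)) z) \<in> borel_measurable lborel" for p
        by (intro borel_measurable_times_ennreal measurable_compose[OF _ G]
              borel_measurable_const borel_measurable_indicator; auto intro: sets.Int Zb)+
      have c: "(\<integral>\<^sup>+z. ennreal (M * \<tau> n) * indicator (Z n p \<inter> cball 0 (B + 1)) z \<partial>lborel)
          = ennreal (M * \<tau> n) * emeasure lborel (Z n p \<inter> cball 0 (B + 1))" for p
        by (rule nn_integral_cmult_indicator) (simp add: Zb)
      show ?thesis
      proof (subst nn_integral_sum)
        show "(\<lambda>z. G (q p z) * indicator (Z n p) z
            + ennreal (M * \<tau> n) * indicator (Z n p \<inter> cball 0 (B + 1)) z) \<in> borel_measurable lborel" for p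
          by (intro borel_measurable_add meas)
      qed (simp only: nn_integral_add[OF meas] c)
    qed
    finally have le: "ennreal \<bar>?i\<bar> \<le> (\<Sum>p\<in>P'. (\<integral>\<^sup>+z. G (q p z) * indicator (Z n p) z \<partial>lborel)
           + ennreal (M * \<tau> n) * emeasure lborel (Z n p \<inter> cball 0 (B + 1)))" .
    have "ennreal \<bar>real (Suc n) * ?i\<bar> = ennreal (real (Suc n)) * ennreal \<bar>?i\<bar>"
      by (simp add: abs_mult ennreal_mult del: of_nat_Suc)
    also have "\<dots> \<le> ennreal (real (Suc n)) * (\<Sum>p\<in>P'. (\<integral>\<^sup>+z. G (q p z) * indicator (Z n p) z \<partial>lborel)
           + ennreal (M * \<tau> n) * emeasure lborel (Z n p \<inter> cball 0 (B + 1)))"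
      by (rule mult_left_mono[OF le]) simp
    also have "\<dots> = (\<Sum>p\<in>P'. ennreal (real (Suc n)) * (\<integral>\<^sup>+z. G (q p z) * indicator (Z n p) z \<partial>lborel)
           + ennreal M * emeasure lborel (Z n p \<inter> cball 0 (B + 1)))"
    proof -
      have "ennreal (real (Suc n)) * ennreal (M * \<tau> n) = ennreal M"
        using M(1) \<tau>[of n] by (subst ennreal_mult[symmetric]) (auto simp: \<tau>_def simp del: of_nat_Suc)
      then show ?thesis
        by (simp add: sum_distrib_left distrib_left mult.assoc[symmetric] del: of_nat_Suc)
    qed
    also have "\<dots> = (\<Sum>p\<in>P'. ennreal (real (Suc n)) * (\<integral>\<^sup>+z. G (q p z) * indicator (Z n p) z \<partial>lborel)) + \<epsilon> n"
      by (simp add: sum.distrib \<epsilon>_def)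
    also have "(\<Sum>p\<in>P'. ennreal (real (Suc n)) * (\<integral>\<^sup>+z. G (q p z) * indicator (Z n p) z \<partial>lborel))
        \<le> (\<Sum>p\<in>P'. ennreal (48 / pi) * ?X)"
    proof (rule sum_mono)
      fix p assume "p \<in> P'"
      have "ennreal (pi / (48 * \<tau> n)) * (\<integral>\<^sup>+z. G (q p z) * indicator (Z n p) z \<partial>lborel) \<le> ?X"
        using slab_nn_integral_le[OF e \<tau>(1) G, of n "fst p" "snd p"] Gsurf
        by (simp add: q_def s_def Z_def)
      then have "ennreal (48 / pi) * (ennreal (pi / (48 * \<tau> n)) * (\<integral>\<^sup>+z. G (q p z) * indicator (Z n p) z \<partial>lborel))
         \<le> ennreal (48 / pi) * ?X" by (rule mult_left_mono) simp
      moreover have "ennreal (48 / pi) * ennreal (pi / (48 * \<tau> n)) = ennreal (real (Suc n))"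
        by (subst ennreal_mult[symmetric]) (auto simp: \<tau>_def simp del: of_nat_Suc)
      ultimately show "ennreal (real (Suc n)) * (\<integral>\<^sup>+z. G (q p z) * indicator (Z n p) z \<partial>lborel)
         \<le> ennreal (48 / pi) * ?X"
        by (simp add: mult.assoc[symmetric] del: of_nat_Suc)
    qed
    also have "(\<Sum>p\<in>P'. ennreal (48 / pi) * ?X) = of_nat (card P') * (ennreal (48 / pi) * ?X)" by simp
    also have "\<dots> \<le> of_nat (card P) * (ennreal (48 / pi) * ?X)"
      using card_mono[OF P(1) P'(2)] by (intro mult_right_mono) auto
    also have "\<dots> = ennreal (real (card P) * (48 / pi)) * ?X"
      unfolding ennreal_of_nat_eq_real_of_nat
      by (subst ennreal_mult) (auto simp: mult.assoc simp del: times_divide_eq_right)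
    finally show ?thesis by (simp add: add_right_mono)
  qed
  have \<epsilon>0: "\<epsilon> \<longlonglongrightarrow> 0"
  proof -
    have "(\<lambda>n. ennreal M * emeasure lborel (Z n p \<inter> cball 0 (B + 1))) \<longlonglongrightarrow> ennreal M * 0" if "p \<in> P'" for p
    proof (rule ennreal_tendsto_cmult)
      show "(\<lambda>n. emeasure lborel (Z n p \<inter> cball 0 (B + 1))) \<longlonglongrightarrow> 0"
        using slab_emeasure_tendsto_0[of "fst p" e "snd p" "B + 1"] that
        by (simp add: Z_def s_def \<tau>_def P'_def del: of_nat_Suc)
    qed simp
    then have "\<epsilon> \<longlonglongrightarrow> (\<Sum>p\<in>P'. 0)" unfolding \<epsilon>_def by (intro tendsto_sum) auto
    then show ?thesis by simp
  qed
  have "(\<lambda>n. \<bar>real (Suc n) * (\<integral>x. f (x + \<tau> n *\<^sub>R e) - f x \<partial>lebesgue_on \<Omega>)\<bar>)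
      \<longlonglongrightarrow> \<bar>\<integral>x. f' x \<bullet> e \<partial>lebesgue_on \<Omega>\<bar>"
    unfolding \<tau>_def
    by (intro tendsto_rabs difference_quotient_integral_tendsto[OF f \<Omega>(2)]) (use \<Omega>(1) in auto)
  then have L: "(\<lambda>n. ennreal \<bar>real (Suc n) * (\<integral>x. f (x + \<tau> n *\<^sub>R e) - f x \<partial>lebesgue_on \<Omega>)\<bar>)
      \<longlonglongrightarrow> ennreal \<bar>\<integral>x. f' x \<bullet> e \<partial>lebesgue_on \<Omega>\<bar>"
    by (rule tendsto_ennrealI)
  have Rr: "(\<lambda>n. ennreal (real (card P) * (48 / pi)) * ?X + \<epsilon> n)
      \<longlonglongrightarrow> ennreal (real (card P) * (48 / pi)) * ?X + 0"
    by (intro tendsto_add tendsto_const \<epsilon>0)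
  show ?thesis
    using LIMSEQ_le[OF L Rr] bound by auto
qed

section \<open>Square-integrable functions and integration by parts\<close>

lemma L2D:
  assumes "f \<in> L2 \<omega>"
  shows "f \<in> borel_measurable (lebesgue_on \<omega>)" "integrable (lebesgue_on \<omega>) (\<lambda>x. f x \<bullet> f x)"
  using assms by (auto simp: L2_def power2_norm_eq_inner)

lemma L2I:
  assumes "f \<in> borel_measurable (lebesgue_on \<omega>)" "integrable (lebesgue_on \<omega>) (\<lambda>x. f x \<bullet> f x)"
  shows "f \<in> L2 \<omega>"
  using assms by (auto simp: L2_def power2_norm_eq_inner)

lemma L2_integrable_inner:
  assumes f: "f \<in> L2 \<omega>" and g: "g \<in> L2 \<omega>"
  shows "integrable (lebesgue_on \<omega>) (\<lambda>x. f x \<bullet> g x)"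
proof (rule Bochner_Integration.integrable_bound)
  show "integrable (lebesgue_on \<omega>) (\<lambda>x. f x \<bullet> f x + g x \<bullet> g x)"
    using L2D(2)[OF f] L2D(2)[OF g] by simp
  show "(\<lambda>x. f x \<bullet> g x) \<in> borel_measurable (lebesgue_on \<omega>)"
    using L2D(1)[OF f] L2D(1)[OF g] by (rule borel_measurable_inner)
  show "AE x in lebesgue_on \<omega>. norm (f x \<bullet> g x) \<le> norm (f x \<bullet> f x + g x \<bullet> g x)"
  proof (intro AE_I2)
    fix x
    have "0 \<le> (f x + g x) \<bullet> (f x + g x)" "0 \<le> (f x - g x) \<bullet> (f x - g x)" by simp_all
    then have "\<bar>f x \<bullet> g x\<bar> * 2 \<le> f x \<bullet> f x + g x \<bullet> g x"
      by (simp add: inner_add_left inner_add_right inner_diff_left inner_diff_right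
            inner_commute[of "g x" "f x"] abs_le_iff)
    then show "norm (f x \<bullet> g x) \<le> norm (f x \<bullet> f x + g x \<bullet> g x)" by simp
  qed
qed

lemma L2_add:
  assumes f: "f \<in> L2 \<omega>" and g: "g \<in> L2 \<omega>"
  shows "(\<lambda>x. f x + g x) \<in> L2 \<omega>"
proof (rule L2I)
  show "(\<lambda>x. f x + g x) \<in> borel_measurable (lebesgue_on \<omega>)"
    using L2D(1)[OF f] L2D(1)[OF g] by (rule borel_measurable_add)
  show "integrable (lebesgue_on \<omega>) (\<lambda>x. (f x + g x) \<bullet> (f x + g x))"
    unfolding inner_add_left inner_add_right
    by (intro Bochner_Integration.integrable_add L2_integrable_inner f g)
qed

lemma L2_scaleR:
  assumes f: "f \<in> L2 \<omega>"
  shows "(\<lambda>x. c *\<^sub>R f x) \<in> L2 \<omega>"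
proof (rule L2I)
  show "(\<lambda>x. c *\<^sub>R f x) \<in> borel_measurable (lebesgue_on \<omega>)"
    using L2D(1)[OF f] by (intro borel_measurable_scaleR) auto
  show "integrable (lebesgue_on \<omega>) (\<lambda>x. (c *\<^sub>R f x) \<bullet> (c *\<^sub>R f x))"
    using L2D(2)[OF f] by simp
qed

lemma L2_diff: "f \<in> L2 \<omega> \<Longrightarrow> g \<in> L2 \<omega> \<Longrightarrow> (\<lambda>x. f x - g x) \<in> L2 \<omega>"
  using L2_add[OF _ L2_scaleR, of f \<omega> g "-1"] by simp

lemma l2_inner_commute: "l2_inner \<omega> f g = l2_inner \<omega> g f"
  by (simp add: l2_inner_def inner_commute)

lemma l2_inner_add_left:
  "f \<in> L2 \<omega> \<Longrightarrow> g \<in> L2 \<omega> \<Longrightarrow> h \<in> L2 \<omega> \<Longrightarrow>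
    l2_inner \<omega> (\<lambda>x. f x + g x) h = l2_inner \<omega> f h + l2_inner \<omega> g h"
  unfolding l2_inner_def inner_add_left
  by (intro Bochner_Integration.integral_add L2_integrable_inner)

lemma l2_inner_diff_left:
  "f \<in> L2 \<omega> \<Longrightarrow> g \<in> L2 \<omega> \<Longrightarrow> h \<in> L2 \<omega> \<Longrightarrow>
    l2_inner \<omega> (\<lambda>x. f x - g x) h = l2_inner \<omega> f h - l2_inner \<omega> g h"
  unfolding l2_inner_def inner_diff_left
  by (intro Bochner_Integration.integral_diff L2_integrable_inner)

lemma l2_inner_diff_right:
  "f \<in> L2 \<omega> \<Longrightarrow> g \<in> L2 \<omega> \<Longrightarrow> h \<in> L2 \<omega> \<Longrightarrow>
    l2_inner \<omega> h (\<lambda>x. f x - g x) = l2_inner \<omega> h f - l2_inner \<omega> h g"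
  unfolding l2_inner_def inner_diff_right
  by (intro Bochner_Integration.integral_diff L2_integrable_inner)

lemma l2_inner_scaleR_left: "l2_inner \<omega> (\<lambda>x. c *\<^sub>R f x) g = c * l2_inner \<omega> f g"
  by (simp add: l2_inner_def)

lemma l2_inner_self_nonneg: "0 \<le> l2_inner \<omega> f f"
  unfolding l2_inner_def by (intro integral_nonneg_AE AE_I2) simp

lemma l2_norm_nonneg: "0 \<le> l2_norm \<omega> f"
  unfolding l2_norm_def using l2_inner_self_nonneg by simp

lemma l2_norm_sq: "(l2_norm \<omega> f)\<^sup>2 = l2_inner \<omega> f f"
  unfolding l2_norm_def using l2_inner_self_nonneg by simp

lemma l2_Cauchy_Schwarz:
  assumes f: "f \<in> L2 \<omega>" and g: "g \<in> L2 \<omega>"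
  shows "\<bar>l2_inner \<omega> f g\<bar> \<le> l2_norm \<omega> f * l2_norm \<omega> g"
proof -
  let ?a = "l2_inner \<omega> f f" and ?b = "l2_inner \<omega> f g" and ?c = "l2_inner \<omega> g g"
  have quad: "0 \<le> ?a - 2 * t * ?b + t\<^sup>2 * ?c" for t
  proof -
    note L = f L2_scaleR[OF g, of t] L2_diff[OF f L2_scaleR[OF g, of t]]
    have "0 \<le> l2_inner \<omega> (\<lambda>x. f x - t *\<^sub>R g x) (\<lambda>x. f x - t *\<^sub>R g x)" by (rule l2_inner_self_nonneg)
    also have "\<dots> = ?a - t * ?b - (t * ?b - t * (t * ?c))"
      using L g
      by (simp add: l2_inner_diff_left l2_inner_diff_right l2_inner_scaleR_left
            l2_inner_commute[of \<omega> _ "\<lambda>x. t *\<^sub>R g x"] l2_inner_commute[of \<omega> g f] right_diff_distrib)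
    finally show ?thesis by (simp add: power2_eq_square algebra_simps)
  qed
  have "?b\<^sup>2 \<le> ?a * ?c"
  proof (cases "?c = 0")
    case True
    have "?b = 0"
    proof (rule ccontr)
      assume "?b \<noteq> 0"
      then show False using quad[of "(?a + 1) / (2 * ?b)"] True by (simp add: field_simps)
    qed
    then show ?thesis using True by simp
  next
    case False
    then have c: "?c > 0" using l2_inner_self_nonneg[of \<omega> g] by simp
    have "0 \<le> (?a - 2 * (?b / ?c) * ?b + (?b / ?c)\<^sup>2 * ?c) * ?c"
      using quad[of "?b / ?c"] c by (intro mult_nonneg_nonneg) auto
    also have "\<dots> = ?a * ?c - ?b\<^sup>2" using c by (simp add: field_simps power2_eq_square)
    finally show ?thesis by simp
  qed
  then have "sqrt (?b\<^sup>2) \<le> sqrt (?a * ?c)" by (rule real_sqrt_le_mono)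
  then show ?thesis by (simp add: l2_norm_def real_sqrt_mult)
qed

lemma measurable_vec_nth:
  fixes f :: "'a \<Rightarrow> 'b::euclidean_space^3"
  assumes "f \<in> borel_measurable M"
  shows "(\<lambda>x. f x $ k) \<in> borel_measurable M"
proof -
  have "(\<lambda>y::'b^3. y $ k) \<in> borel_measurable borel"
    by (intro borel_measurable_continuous_onI continuous_intros)
  with assms show ?thesis by (rule measurable_compose)
qed

lemma L2_component:
  fixes f :: "real^3 \<Rightarrow> 'b::euclidean_space^3"
  assumes f: "f \<in> L2 \<omega>"
  shows "(\<lambda>x. f x $ k) \<in> L2 \<omega>"
proof (rule L2I)
  show m: "(\<lambda>x. f x $ k) \<in> borel_measurable (lebesgue_on \<omega>)"
    using L2D(1)[OF f] by (rule measurable_vec_nth)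
  show "integrable (lebesgue_on \<omega>) (\<lambda>x. f x $ k \<bullet> f x $ k)"
  proof (rule Bochner_Integration.integrable_bound[OF L2D(2)[OF f]])
    show "(\<lambda>x. f x $ k \<bullet> f x $ k) \<in> borel_measurable (lebesgue_on \<omega>)"
      using m m by (rule borel_measurable_inner)
    show "AE x in lebesgue_on \<omega>. norm (f x $ k \<bullet> f x $ k) \<le> norm (f x \<bullet> f x)"
    proof (intro AE_I2)
      fix x
      have "f x $ k \<bullet> f x $ k \<le> (\<Sum>i\<in>UNIV. f x $ i \<bullet> f x $ i)"
        by (rule member_le_sum) auto
      then show "norm (f x $ k \<bullet> f x $ k) \<le> norm (f x \<bullet> f x)" by (simp add: inner_vec_def)
    qed
  qed
qed

lemma L2_vec:
  fixes f :: "real^3 \<Rightarrow> 'b::euclidean_space^3"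
  assumes f: "\<And>k. (\<lambda>x. f x $ k) \<in> L2 \<omega>"
  shows "f \<in> L2 \<omega>"
proof (rule L2I)
  show "f \<in> borel_measurable (lebesgue_on \<omega>)"
    unfolding borel_measurable_euclidean_space[of f]
    using L2D(1)[OF f] by (auto simp: Basis_vec_def inner_axis intro!: borel_measurable_inner)
  show "integrable (lebesgue_on \<omega>) (\<lambda>x. f x \<bullet> f x)"
    unfolding inner_vec_def using L2D(2)[OF f] by (intro Bochner_Integration.integrable_sum)
qed

lemma l2_inner_vec:
  fixes f g :: "real^3 \<Rightarrow> 'b::euclidean_space^3"
  assumes "f \<in> L2 \<omega>" "g \<in> L2 \<omega>"
  shows "l2_inner \<omega> f g = (\<Sum>k\<in>UNIV. l2_inner \<omega> (\<lambda>x. f x $ k) (\<lambda>x. g x $ k))"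
  unfolding l2_inner_def inner_vec_def
  by (intro Bochner_Integration.integral_sum L2_integrable_inner L2_component assms)

lemma l2_inner_cong_AE:
  assumes "f \<in> L2 \<omega>" "g \<in> L2 \<omega>" "f' \<in> L2 \<omega>" "g' \<in> L2 \<omega>"
    and "AE x in lebesgue_on \<omega>. f x = f' x" "AE x in lebesgue_on \<omega>. g x = g' x"
  shows "l2_inner \<omega> f g = l2_inner \<omega> f' g'"
  unfolding l2_inner_def
proof (rule integral_cong_AE)
  show "AE x in lebesgue_on \<omega>. f x \<bullet> g x = f' x \<bullet> g' x"
    using assms(5,6) by eventually_elim simp
qed (use assms L2_integrable_inner borel_measurable_integrable in blast)+

lemma l2_inner_tendsto:
  assumes f: "\<And>n. F n \<in> L2 \<omega>" "f \<in> L2 \<omega>" "(\<lambda>n. l2_norm \<omega> (\<lambda>x. F n x - f x)) \<longlonglongrightarrow> 0"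
    and g: "\<And>n. G n \<in> L2 \<omega>" "g \<in> L2 \<omega>" "(\<lambda>n. l2_norm \<omega> (\<lambda>x. G n x - g x)) \<longlonglongrightarrow> 0"
  shows "(\<lambda>n. l2_inner \<omega> (F n) (G n)) \<longlonglongrightarrow> l2_inner \<omega> f g"
proof -
  note L = L2_diff[OF f(1) f(2)] L2_diff[OF g(1) g(2)]
  have eq: "l2_inner \<omega> (F n) (G n) - l2_inner \<omega> f g
     = l2_inner \<omega> (\<lambda>x. F n x - f x) (\<lambda>x. G n x - g x) + l2_inner \<omega> (\<lambda>x. F n x - f x) g
       + l2_inner \<omega> f (\<lambda>x. G n x - g x)" for n
    using L f g by (simp add: l2_inner_diff_left l2_inner_diff_right)
  have "\<bar>l2_inner \<omega> (F n) (G n) - l2_inner \<omega> f g\<bar>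
     \<le> l2_norm \<omega> (\<lambda>x. F n x - f x) * l2_norm \<omega> (\<lambda>x. G n x - g x)
       + l2_norm \<omega> (\<lambda>x. F n x - f x) * l2_norm \<omega> g + l2_norm \<omega> f * l2_norm \<omega> (\<lambda>x. G n x - g x)" for n
    unfolding eq
    using l2_Cauchy_Schwarz[OF L(1)[of n] L(2)[of n]] l2_Cauchy_Schwarz[OF L(1)[of n] g(2)]
      l2_Cauchy_Schwarz[OF f(2) L(2)[of n]] by linarith
  moreover have "(\<lambda>n. l2_norm \<omega> (\<lambda>x. F n x - f x) * l2_norm \<omega> (\<lambda>x. G n x - g x)
       + l2_norm \<omega> (\<lambda>x. F n x - f x) * l2_norm \<omega> g + l2_norm \<omega> f * l2_norm \<omega> (\<lambda>x. G n x - g x))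
     \<longlonglongrightarrow> 0 * 0 + 0 * l2_norm \<omega> g + l2_norm \<omega> f * 0"
    by (intro tendsto_intros f g)
  ultimately have "(\<lambda>n. l2_inner \<omega> (F n) (G n) - l2_inner \<omega> f g) \<longlonglongrightarrow> 0"
    by (intro Lim_null_comparison[of "\<lambda>n. l2_inner \<omega> (F n) (G n) - l2_inner \<omega> f g"]) auto
  then show ?thesis by (rule LIM_zero_cancel)
qed

lemma L2_subset:
  assumes f: "f \<in> L2 \<omega>" and K: "K \<subseteq> \<omega>" "K \<in> sets lebesgue" "\<omega> \<in> sets lebesgue"
  shows "f \<in> L2 K"
proof (rule L2I)
  show "f \<in> borel_measurable (lebesgue_on K)"
    using measurable_restrict_mono[OF L2D(1)[OF f] K(1)] .
  have "set_integrable lebesgue \<omega> (\<lambda>x. f x \<bullet> f x)"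
    using L2D(2)[OF f] K by (simp add: integrable_restrict_space set_integrable_def)
  then have "set_integrable lebesgue K (\<lambda>x. f x \<bullet> f x)"
    by (rule set_integrable_subset) (use K in auto)
  then show "integrable (lebesgue_on K) (\<lambda>x. f x \<bullet> f x)"
    using K by (simp add: integrable_restrict_space set_integrable_def)
qed

lemma L2_continuous:
  fixes f :: "real^3 \<Rightarrow> 'b::euclidean_space"
  assumes "continuous_on UNIV f" and B: "bounded \<omega>" "\<omega> \<in> sets lebesgue"
  shows "f \<in> L2 \<omega>"
proof (rule L2I)
  have "f \<in> borel_measurable borel" by (rule borel_measurable_continuous_onI[OF assms(1)])
  then have "f \<in> borel_measurable lborel" by simp
  then have "f \<in> borel_measurable lebesgue" by (rule measurable_completion)
  then show "f \<in> borel_measurable (lebesgue_on \<omega>)" by (rule measurable_restrict_space1)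
  show "integrable (lebesgue_on \<omega>) (\<lambda>x. f x \<bullet> f x)"
    by (intro integrable_bounded_continuous B continuous_intros assms)
qed

lemma test_functions_mono: "\<omega> \<subseteq> \<omega>' \<Longrightarrow> test_functions \<omega> \<subseteq> test_functions \<omega>'"
  by (auto simp: test_functions_def)

lemma smooth_pderiv3: "smooth f \<Longrightarrow> smooth (pderiv3 i f)"
  unfolding smooth_def by (metis C_k.simps(2))

lemma smooth_differentiable: "smooth f \<Longrightarrow> f differentiable (at x)"
  unfolding smooth_def by (metis C_k.simps(2) UNIV_I differentiable_on_def)

lemma smooth_continuous: "smooth f \<Longrightarrow> continuous_on UNIV f"
  unfolding smooth_def by (metis C_k.simps(1))

lemma differentiable_grad:
  assumes "f differentiable (at x)"
  shows "(f has_derivative (\<lambda>h. grad f x \<bullet> h)) (at x)"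
proof -
  have d: "(f has_derivative frechet_derivative f (at x)) (at x)"
    using assms frechet_derivative_works by blast
  then interpret bounded_linear "frechet_derivative f (at x)" by (rule has_derivative_bounded_linear)
  have "frechet_derivative f (at x) = (\<lambda>h. grad f x \<bullet> h)"
  proof (rule ext)
    fix h
    have "frechet_derivative f (at x) h = frechet_derivative f (at x) (\<Sum>i\<in>UNIV. h $ i *\<^sub>R axis i 1)"
      using basis_expansion[of h] by (simp add: scalar_mult_eq_scaleR)
    also have "\<dots> = grad f x \<bullet> h" by (simp add: sum scaleR inner_vec_def grad_def pderiv3_def mult.commute)
    finally show "frechet_derivative f (at x) h = grad f x \<bullet> h" .
  qed
  then show ?thesis using d by simp
qed

lemma smooth_C1_grad:
  assumes f: "smooth f"
  shows "C1_grad f (grad f)"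
  unfolding C1_grad_def
proof (intro conjI allI)
  show "(f has_derivative (\<bullet>) (grad f x)) (at x)" for x
    by (rule differentiable_grad[OF smooth_differentiable[OF f]])
  show "continuous_on UNIV (grad f)"
    unfolding grad_def by (intro continuous_on_vec_lambda smooth_continuous smooth_pderiv3 f)
qed

lemma test_function_smooth: "\<phi> \<in> test_functions \<omega> \<Longrightarrow> smooth \<phi>"
  by (simp add: test_functions_def)

lemma H1D:
  assumes "f \<in> H1 \<omega>"
  shows "f \<in> L2 \<omega>" "has_weak_grad \<omega> f (weak_grad \<omega> f)" "weak_grad \<omega> f \<in> L2 \<omega>"
proof -
  show "f \<in> L2 \<omega>" using assms by (simp add: H1_def)
  show *: "has_weak_grad \<omega> f (weak_grad \<omega> f)"
    unfolding weak_grad_def using assms someI_ex[of "has_weak_grad \<omega> f"] by (simp add: H1_def)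
  then show "weak_grad \<omega> f \<in> L2 \<omega>" by (simp add: has_weak_grad_def)
qed

lemma l2_norm_component_le:
  fixes f :: "real^3 \<Rightarrow> 'b::euclidean_space^3"
  assumes f: "f \<in> L2 \<omega>"
  shows "l2_norm \<omega> (\<lambda>x. f x $ k) \<le> l2_norm \<omega> f"
proof -
  have "l2_inner \<omega> (\<lambda>x. f x $ k) (\<lambda>x. f x $ k) \<le> (\<Sum>k\<in>UNIV. l2_inner \<omega> (\<lambda>x. f x $ k) (\<lambda>x. f x $ k))"
    by (rule member_le_sum) (auto intro: l2_inner_self_nonneg)
  then show ?thesis unfolding l2_norm_def l2_inner_vec[OF f f] by simp
qed

lemma ennreal_power2_tendsto_0:
  fixes Y :: "'a \<Rightarrow> ennreal"
  assumes "((\<lambda>n. (Y n)\<^sup>2) \<longlongrightarrow> 0) F"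
  shows "(Y \<longlongrightarrow> 0) F"
proof (rule order_tendstoI)
  fix a :: ennreal assume "0 < a"
  then have "0 < a\<^sup>2" by (simp add: zero_less_iff_neq_zero)
  then have "\<forall>\<^sub>F n in F. (Y n)\<^sup>2 < a\<^sup>2" using assms by (simp add: order_tendsto_iff)
  then show "\<forall>\<^sub>F n in F. Y n < a"
    by eventually_elim (meson not_le power_mono zero_le)
qed simp

text \<open>
  Expand the product around \<open>g x * h x = 0\<close> and apply the Cauchy-Schwarz inequality to the three remaining terms.
\<close>

lemma nn_integral_product_tendsto_0:
  fixes \<phi> \<psi> :: "nat \<Rightarrow> 'a \<Rightarrow> real" and g h :: "'a \<Rightarrow> real"
  assumes g: "g \<in> borel_measurable M" "integrable M (\<lambda>x. (g x)\<^sup>2)"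
    and h: "h \<in> borel_measurable M" "integrable M (\<lambda>x. (h x)\<^sup>2)"
    and m: "\<And>n. \<phi> n \<in> borel_measurable M" "\<And>n. \<psi> n \<in> borel_measurable M"
    and A: "(\<lambda>n. \<integral>\<^sup>+x. ennreal ((\<phi> n x - g x)\<^sup>2) \<partial>M) \<longlonglongrightarrow> 0"
    and B: "(\<lambda>n. \<integral>\<^sup>+x. ennreal ((\<psi> n x - h x)\<^sup>2) \<partial>M) \<longlonglongrightarrow> 0"
    and gh: "AE x in M. g x * h x = 0"
  shows "(\<lambda>n. \<integral>\<^sup>+x. ennreal \<bar>\<phi> n x * \<psi> n x\<bar> \<partial>M) \<longlonglongrightarrow> 0"
proof -
  let ?I = "\<lambda>a b. \<integral>\<^sup>+x. ennreal \<bar>a x\<bar> * ennreal \<bar>b x\<bar> \<partial>M"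
  let ?S = "\<lambda>a. \<integral>\<^sup>+x. ennreal ((a x)\<^sup>2) \<partial>M"
  have CS: "(?I a b)\<^sup>2 \<le> ?S a * ?S b"
    if "a \<in> borel_measurable M" "b \<in> borel_measurable M" for a b :: "'a \<Rightarrow> real"
  proof -
    have "(?I a b)\<^sup>2 \<le> (\<integral>\<^sup>+x. (ennreal \<bar>a x\<bar>)\<^sup>2 \<partial>M) * (\<integral>\<^sup>+x. (ennreal \<bar>b x\<bar>)\<^sup>2 \<partial>M)"
      by (rule Cauchy_Schwarz_nn_integral) (use that in auto)
    then show ?thesis by (simp add: ennreal_power)
  qed
  have fin: "?S g < top" "?S h < top"
    using g(2) h(2) by (auto simp: nn_integral_eq_integral)
  let ?a = "\<lambda>n x. \<phi> n x - g x" and ?b = "\<lambda>n x. \<psi> n x - h x"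
  have ma: "?a n \<in> borel_measurable M" and mb: "?b n \<in> borel_measurable M" for n
    using g h m by auto
  have me: "(\<lambda>x. ennreal \<bar>a x\<bar> * ennreal \<bar>b x\<bar>) \<in> borel_measurable M"
    if "a \<in> borel_measurable M" "b \<in> borel_measurable M" for a b :: "'a \<Rightarrow> real"
    using that by simp
  have z: "(\<lambda>n. ?I (u n) (v n)) \<longlonglongrightarrow> 0"
    if "\<And>n. u n \<in> borel_measurable M" "\<And>n. v n \<in> borel_measurable M" "(\<lambda>n. ?S (u n) * ?S (v n)) \<longlonglongrightarrow> 0"
    for u v :: "nat \<Rightarrow> 'a \<Rightarrow> real"
  proof (rule ennreal_power2_tendsto_0)
    show "(\<lambda>n. (?I (u n) (v n))\<^sup>2) \<longlonglongrightarrow> 0"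
      by (rule tendsto_sandwich[OF _ _ tendsto_const that(3)]) (auto intro!: always_eventually CS that)
  qed
  have 1: "(\<lambda>n. ?I (?a n) (?b n)) \<longlonglongrightarrow> 0"
    by (rule z[OF ma mb]) (use tendsto_mult_ennreal[OF A B] in simp)
  have 2: "(\<lambda>n. ?I g (?b n)) \<longlonglongrightarrow> 0"
    by (rule z[OF g(1) mb]) (use ennreal_tendsto_cmult[OF fin(1) B] in simp)
  have 3: "(\<lambda>n. ?I (?a n) h) \<longlonglongrightarrow> 0"
    by (rule z[OF ma h(1)]) (use ennreal_tendsto_cmult[OF fin(2) A] in \<open>simp add: mult.commute\<close>)
  have le: "(\<integral>\<^sup>+x. ennreal \<bar>\<phi> n x * \<psi> n x\<bar> \<partial>M) \<le> ?I (?a n) (?b n) + ?I g (?b n) + ?I (?a n) h" for n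
  proof -
    have "(\<integral>\<^sup>+x. ennreal \<bar>\<phi> n x * \<psi> n x\<bar> \<partial>M) \<le> (\<integral>\<^sup>+x. (ennreal \<bar>?a n x\<bar> * ennreal \<bar>?b n x\<bar>
        + ennreal \<bar>g x\<bar> * ennreal \<bar>?b n x\<bar>) + ennreal \<bar>?a n x\<bar> * ennreal \<bar>h x\<bar> \<partial>M)"
    proof (rule nn_integral_mono_AE)
      show "AE x in M. ennreal \<bar>\<phi> n x * \<psi> n x\<bar> \<le> (ennreal \<bar>?a n x\<bar> * ennreal \<bar>?b n x\<bar>
        + ennreal \<bar>g x\<bar> * ennreal \<bar>?b n x\<bar>) + ennreal \<bar>?a n x\<bar> * ennreal \<bar>h x\<bar>"
        using gh
      proof eventually_elim
        case (elim x)
        have "\<phi> n x * \<psi> n x = ?a n x * ?b n x + g x * ?b n x + ?a n x * h x + g x * h x"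
          by (simp add: algebra_simps)
        then have "\<bar>\<phi> n x * \<psi> n x\<bar> \<le> \<bar>?a n x * ?b n x\<bar> + \<bar>g x * ?b n x\<bar> + \<bar>?a n x * h x\<bar>"
          using elim by linarith
        then have "ennreal \<bar>\<phi> n x * \<psi> n x\<bar>
            \<le> ennreal (\<bar>?a n x\<bar> * \<bar>?b n x\<bar> + \<bar>g x\<bar> * \<bar>?b n x\<bar> + \<bar>?a n x\<bar> * \<bar>h x\<bar>)"
          by (intro ennreal_leI) (simp only: abs_mult)
        also have "\<dots> = (ennreal \<bar>?a n x\<bar> * ennreal \<bar>?b n x\<bar>
            + ennreal \<bar>g x\<bar> * ennreal \<bar>?b n x\<bar>) + ennreal \<bar>?a n x\<bar> * ennreal \<bar>h x\<bar>"
          by (simp add: ennreal_mult ennreal_plus)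
        finally show ?case .
      qed
    qed
    also have "\<dots> = ?I (?a n) (?b n) + ?I g (?b n) + ?I (?a n) h"
      by (simp only: nn_integral_add borel_measurable_add me ma mb g h)
    finally show ?thesis .
  qed
  have "(\<lambda>n. ?I (?a n) (?b n) + ?I g (?b n) + ?I (?a n) h) \<longlonglongrightarrow> 0 + 0 + 0"
    by (intro tendsto_add 1 2 3)
  then have s: "(\<lambda>n. ?I (?a n) (?b n) + ?I g (?b n) + ?I (?a n) h) \<longlonglongrightarrow> 0" by simp
  show ?thesis
  proof (rule tendsto_sandwich[OF _ _ tendsto_const s])
    show "\<forall>\<^sub>F n in sequentially. (\<integral>\<^sup>+x. ennreal \<bar>\<phi> n x * \<psi> n x\<bar> \<partial>M)
        \<le> ?I (?a n) (?b n) + ?I g (?b n) + ?I (?a n) h"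
      by (intro always_eventually allI le)
  qed simp
qed

text \<open>
  The form in which the polyhedral shape of the domain enters \<open>trace_inequality\<close>: the pairs \<open>(m, c)\<close> describe
  planes that together contain the boundary.
\<close>

definition planar_boundary :: "(real^3) set \<Rightarrow> bool" where
  "planar_boundary \<Omega> \<longleftrightarrow> open \<Omega> \<and> bounded \<Omega> \<and>
     (\<exists>P :: ((real^3) \<times> real) set. finite P \<and> (\<forall>(m, c)\<in>P. m \<noteq> 0) \<and>
        (\<forall>x\<in>frontier \<Omega>. \<exists>(m, c)\<in>P. m \<bullet> x = c))"

text \<open>
  For the smooth approximations \<open>\<phi> n\<close> and \<open>\<psi> n\<close> of u and v, \<open>trace_inequality\<close> bounds the sum of the two terms by the
  boundary integral of \<open>\<bar>\<phi> n x * \<psi> n x\<bar>\<close>, which tends to the integral of the vanishing product of the traces.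
\<close>

lemma integration_by_parts_traces:
  assumes \<Omega>: "planar_boundary \<Omega>"
    and u: "u \<in> H1 \<Omega>" "has_trace \<Omega> u g" and v: "v \<in> H1 \<Omega>" "has_trace \<Omega> v h"
    and gh: "AE x in surface \<Omega>. g x * h x = 0"
  shows "l2_inner \<Omega> u (\<lambda>x. weak_grad \<Omega> v x $ i) + l2_inner \<Omega> (\<lambda>x. weak_grad \<Omega> u x $ i) v = 0"
proof -
  obtain P :: "((real^3) \<times> real) set" where P: "finite P" "\<And>m c. (m, c) \<in> P \<Longrightarrow> m \<noteq> 0"
    "\<And>x. x \<in> frontier \<Omega> \<Longrightarrow> \<exists>(m, c)\<in>P. m \<bullet> x = c" and \<Omega>o: "open \<Omega>" "bounded \<Omega>"
    using \<Omega> unfolding planar_boundary_def by blast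
  have \<Omega>l: "\<Omega> \<in> sets lebesgue" using \<Omega>o(1) by simp
  obtain \<phi> where \<phi>: "\<And>n. \<phi> n \<in> test_functions UNIV"
    "(\<lambda>n. l2_norm \<Omega> (\<lambda>x. \<phi> n x - u x)) \<longlonglongrightarrow> 0"
    "(\<lambda>n. l2_norm \<Omega> (\<lambda>x. grad (\<phi> n) x - weak_grad \<Omega> u x)) \<longlonglongrightarrow> 0"
    "(\<lambda>n. \<integral>\<^sup>+x. ennreal ((\<phi> n x - g x)\<^sup>2) \<partial>surface \<Omega>) \<longlonglongrightarrow> 0"
    using u(2) unfolding has_trace_def by blast
  obtain \<psi> where \<psi>: "\<And>n. \<psi> n \<in> test_functions UNIV"
    "(\<lambda>n. l2_norm \<Omega> (\<lambda>x. \<psi> n x - v x)) \<longlonglongrightarrow> 0"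
    "(\<lambda>n. l2_norm \<Omega> (\<lambda>x. grad (\<psi> n) x - weak_grad \<Omega> v x)) \<longlonglongrightarrow> 0"
    "(\<lambda>n. \<integral>\<^sup>+x. ennreal ((\<psi> n x - h x)\<^sup>2) \<partial>surface \<Omega>) \<longlonglongrightarrow> 0"
    using v(2) unfolding has_trace_def by blast
  have C\<phi>: "C1_grad (\<phi> n) (grad (\<phi> n))" and C\<psi>: "C1_grad (\<psi> n) (grad (\<psi> n))" for n
    using \<phi>(1) \<psi>(1) by (auto intro: smooth_C1_grad test_function_smooth)
  note c = C1_gradD(2,3)[OF C\<phi>] C1_gradD(2,3)[OF C\<psi>]
  have L: "\<phi> n \<in> L2 \<Omega>" "grad (\<phi> n) \<in> L2 \<Omega>" "\<psi> n \<in> L2 \<Omega>" "grad (\<psi> n) \<in> L2 \<Omega>" for n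
    by (intro L2_continuous c \<Omega>o(2) \<Omega>l)+
  note Lu = H1D(1,3)[OF u(1)] and Lv = H1D(1,3)[OF v(1)]
  have comp: "(\<lambda>n. l2_norm \<Omega> (\<lambda>x. F n x $ i - f x $ i)) \<longlonglongrightarrow> 0"
    if "\<And>n. F n \<in> L2 \<Omega>" "f \<in> L2 \<Omega>" "(\<lambda>n. l2_norm \<Omega> (\<lambda>x. F n x - f x)) \<longlonglongrightarrow> 0"
    for F :: "nat \<Rightarrow> real^3 \<Rightarrow> real^3" and f
  proof (rule tendsto_sandwich[OF _ _ tendsto_const that(3)])
    show "\<forall>\<^sub>F n in sequentially. l2_norm \<Omega> (\<lambda>x. F n x $ i - f x $ i) \<le> l2_norm \<Omega> (\<lambda>x. F n x - f x)"
      using l2_norm_component_le[OF L2_diff[OF that(1,2)], of _ i] by (simp add: always_eventually)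
  qed (auto intro: always_eventually l2_norm_nonneg)
  let ?I = "\<lambda>n. l2_inner \<Omega> (\<phi> n) (\<lambda>x. grad (\<psi> n) x $ i) + l2_inner \<Omega> (\<lambda>x. grad (\<phi> n) x $ i) (\<psi> n)"
  let ?L = "l2_inner \<Omega> u (\<lambda>x. weak_grad \<Omega> v x $ i) + l2_inner \<Omega> (\<lambda>x. weak_grad \<Omega> u x $ i) v"
  have lim: "?I \<longlonglongrightarrow> ?L"
    by (intro tendsto_add l2_inner_tendsto comp L2_component L Lu Lv \<phi> \<psi>)
  have I: "?I n = (\<integral>x. (\<phi> n x *\<^sub>R grad (\<psi> n) x + \<psi> n x *\<^sub>R grad (\<phi> n) x) \<bullet> axis i 1 \<partial>lebesgue_on \<Omega>)" for n
    unfolding l2_inner_def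
    by (subst Bochner_Integration.integral_add[symmetric])
       (auto intro!: L2_integrable_inner[where 'a = real, simplified] L L2_component
          simp: inner_axis algebra_simps L2_integrable_inner)
  let ?X = "\<lambda>n. \<integral>\<^sup>+x. ennreal \<bar>\<phi> n x * \<psi> n x\<bar> \<partial>surface \<Omega>"
  have bound: "ennreal \<bar>?I n\<bar> \<le> ennreal (real (card P) * (48 / pi)) * ?X n" for n
    unfolding I
    by (rule trace_inequality[OF \<Omega>o P _ C1_grad_mult[OF C\<phi> C\<psi>]]) (auto simp: axis_in_Basis_iff)
  have X: "?X \<longlonglongrightarrow> 0"
  proof (rule nn_integral_product_tendsto_0[OF _ _ _ _ _ _ \<phi>(4) \<psi>(4) gh])
    show "g \<in> borel_measurable (surface \<Omega>)" "integrable (surface \<Omega>) (\<lambda>x. (g x)\<^sup>2)"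
      "h \<in> borel_measurable (surface \<Omega>)" "integrable (surface \<Omega>) (\<lambda>x. (h x)\<^sup>2)"
      using u(2) v(2) unfolding has_trace_def by auto
    have "f \<in> borel_measurable (surface \<Omega>)" if "continuous_on UNIV f" for f :: "real^3 \<Rightarrow> real"
    proof -
      have "f \<in> borel_measurable hausdorff2"
        using borel_measurable_continuous_onI[OF that] measurable_cong_sets[OF sets_hausdorff2 refl] by blast
      then show ?thesis unfolding surface_def by (rule measurable_restrict_space1)
    qed
    then show "\<phi> n \<in> borel_measurable (surface \<Omega>)" "\<psi> n \<in> borel_measurable (surface \<Omega>)" for n
      using c by auto
  qed
  have "(\<lambda>n. ennreal \<bar>?I n\<bar>) \<longlonglongrightarrow> 0"
  proof (rule tendsto_sandwich[OF _ _ tendsto_const])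
    show "(\<lambda>n. ennreal (real (card P) * (48 / pi)) * ?X n) \<longlonglongrightarrow> 0"
      using ennreal_tendsto_cmult[OF _ X] by simp
    show "\<forall>\<^sub>F n in sequentially. ennreal \<bar>?I n\<bar> \<le> ennreal (real (card P) * (48 / pi)) * ?X n"
      by (intro always_eventually allI bound)
  qed simp
  moreover have "(\<lambda>n. ennreal \<bar>?I n\<bar>) \<longlonglongrightarrow> ennreal \<bar>?L\<bar>"
    by (intro tendsto_ennrealI tendsto_rabs lim)
  ultimately have "ennreal \<bar>?L\<bar> = 0" using LIMSEQ_unique by blast
  then show ?thesis by simp
qed

section \<open>Smooth bump functions and the fundamental lemma\<close>

lemma pderiv3_eqI:
  assumes "(f has_derivative (\<lambda>h. G \<bullet> h)) (at x)"
  shows "pderiv3 i f x = G $ i"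
  unfolding pderiv3_def frechet_derivative_at[OF assms, symmetric] by (simp add: inner_axis)

lemma C_k_SucI:
  assumes d: "\<And>x. (f has_derivative (\<lambda>h. G x \<bullet> h)) (at x)" and c: "\<And>i. C_k m (\<lambda>x. G x $ i)"
  shows "C_k (Suc m) f"
proof -
  have "pderiv3 i f = (\<lambda>x. G x $ i)" for i using pderiv3_eqI[OF d] by auto
  moreover have "f differentiable_on UNIV"
    using d by (auto simp: differentiable_on_def differentiable_def)
  ultimately show ?thesis using c by simp
qed

lemma C_k_SucD:
  assumes "C_k (Suc m) f"
  shows "(f has_derivative (\<lambda>h. grad f x \<bullet> h)) (at x)" "C_k m (pderiv3 i f)"
  using assms by (auto intro!: differentiable_grad simp: differentiable_on_def)

lemma C_k_Suc_imp: "C_k (Suc m) f \<Longrightarrow> C_k m f"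
proof (induction m arbitrary: f)
  case 0
  then show ?case by (simp add: differentiable_imp_continuous_on)
next
  case (Suc m)
  then show ?case by (metis C_k.simps(2))
qed

lemma C_k_const: "C_k m (\<lambda>x. c)"
proof (induction m arbitrary: c)
  case (Suc m)
  show ?case by (rule C_k_SucI[where G = "\<lambda>x. 0"]) (auto intro!: derivative_eq_intros Suc)
qed simp

lemma C_k_add: "C_k m f \<Longrightarrow> C_k m g \<Longrightarrow> C_k m (\<lambda>x. f x + g x)"
proof (induction m arbitrary: f g)
  case (Suc m)
  show ?case
  proof (rule C_k_SucI[where G = "\<lambda>x. grad f x + grad g x"])
    show "((\<lambda>x. f x + g x) has_derivative (\<bullet>) (grad f x + grad g x)) (at x)" for x
      by (rule has_derivative_eq_rhs[OF has_derivative_add[OF C_k_SucD(1)[OF Suc.prems(1)] C_k_SucD(1)[OF Suc.prems(2)]]])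
         (auto simp: inner_add_left)
    show "C_k m (\<lambda>x. (grad f x + grad g x) $ i)" for i
      using Suc.IH[OF C_k_SucD(2)[OF Suc.prems(1)] C_k_SucD(2)[OF Suc.prems(2)]]
      by (simp add: grad_def)
  qed
qed (simp add: continuous_on_add)

lemma C_k_mult: "C_k m f \<Longrightarrow> C_k m g \<Longrightarrow> C_k m (\<lambda>x. f x * g x)"
proof (induction m arbitrary: f g)
  case (Suc m)
  show ?case
  proof (rule C_k_SucI[where G = "\<lambda>x. f x *\<^sub>R grad g x + g x *\<^sub>R grad f x"])
    show "((\<lambda>x. f x * g x) has_derivative (\<bullet>) (f x *\<^sub>R grad g x + g x *\<^sub>R grad f x)) (at x)" for x
      by (rule has_derivative_eq_rhs[OF has_derivative_mult[OF C_k_SucD(1)[OF Suc.prems(1)] C_k_SucD(1)[OF Suc.prems(2)]]])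
         (auto simp: inner_add_left)
    show "C_k m (\<lambda>x. (f x *\<^sub>R grad g x + g x *\<^sub>R grad f x) $ i)" for i
      using C_k_add[OF Suc.IH[OF C_k_Suc_imp[OF Suc.prems(1)] C_k_SucD(2)[OF Suc.prems(2), of i]]
          Suc.IH[OF C_k_Suc_imp[OF Suc.prems(2)] C_k_SucD(2)[OF Suc.prems(1), of i]]]
      by (simp add: grad_def)
  qed
qed (simp add: continuous_on_mult)

lemma C_k_prod: "(\<And>i. i \<in> I \<Longrightarrow> C_k m (f i)) \<Longrightarrow> C_k m (\<lambda>x. \<Prod>i\<in>I. f i x)"
  by (induction I rule: infinite_finite_induct) (auto intro: C_k_const C_k_mult)

text \<open>
  The functions \<open>t\<^sup>-\<^sup>k exp (-1/t)\<close>, extended by zero. Up to linear combinations the family is closed under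
  differentiation, so all its members are smooth.
\<close>

definition flat_exp :: "nat \<Rightarrow> real \<Rightarrow> real" where
  "flat_exp k t = (if 0 < t then inverse t ^ k * exp (- inverse t) else 0)"

lemma flat_exp_tendsto_0: "(flat_exp k \<longlongrightarrow> 0) (at 0)"
proof -
  have "((\<lambda>t. inverse t ^ k / exp (inverse t)) \<longlongrightarrow> (0::real)) (at_right 0)"
    by (rule filterlim_compose[OF tendsto_power_div_exp_0 filterlim_inverse_at_top_right])
  moreover have "\<forall>\<^sub>F t in at_right 0. inverse t ^ k / exp (inverse t) = flat_exp k t"
    by (simp add: flat_exp_def eventually_at_filter exp_minus divide_inverse)
  ultimately have "(flat_exp k \<longlongrightarrow> 0) (at_right 0)" by (simp add: tendsto_cong)
  moreover have "(flat_exp k \<longlongrightarrow> 0) (at_left 0)"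
  proof -
    have "\<forall>\<^sub>F t in at_left 0. flat_exp k t = 0"
      by (simp add: flat_exp_def eventually_at_filter)
    then show ?thesis by (simp add: tendsto_cong)
  qed
  ultimately show ?thesis by (simp add: filterlim_split_at)
qed

lemma flat_exp_deriv:
  "(flat_exp k has_real_derivative (- real k * flat_exp (k + 1) t + flat_exp (k + 2) t)) (at t)"
proof -
  consider "t > 0" | "t < 0" | "t = 0" by linarith
  then show ?thesis
  proof cases
    case 1
    have i: "(inverse has_real_derivative - (inverse t)\<^sup>2) (at t)"
      using 1 DERIV_inverse[of t] by (simp add: numeral_2_eq_2)
    have "((\<lambda>t. inverse t ^ k * exp (- inverse t)) has_real_derivative
        real k * (- (inverse t)\<^sup>2 * inverse t ^ (k - Suc 0)) * exp (- inverse t)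
         + exp (- inverse t) * - (- (inverse t)\<^sup>2) * inverse t ^ k) (at t)"
      by (intro DERIV_mult DERIV_power DERIV_chain'[OF DERIV_minus DERIV_exp] i)
    moreover have "real k * (- (inverse t)\<^sup>2 * inverse t ^ (k - Suc 0)) * exp (- inverse t)
         + exp (- inverse t) * - (- (inverse t)\<^sup>2) * inverse t ^ k
         = - real k * flat_exp (k + 1) t + flat_exp (k + 2) t"
      using 1 by (cases k) (simp_all add: flat_exp_def power2_eq_square algebra_simps)
    ultimately have "((\<lambda>t. inverse t ^ k * exp (- inverse t)) has_real_derivative
        (- real k * flat_exp (k + 1) t + flat_exp (k + 2) t)) (at t)"
      by (simp only:)
    then show ?thesis
      by (rule has_field_derivative_transform_within_open[where S = "{0<..}"])
         (use 1 in \<open>auto simp: flat_exp_def\<close>)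
  next
    case 2
    have "((\<lambda>t. 0) has_real_derivative (- real k * flat_exp (k + 1) t + flat_exp (k + 2) t)) (at t)"
      using 2 by (simp add: flat_exp_def)
    then show ?thesis
      by (rule has_field_derivative_transform_within_open[where S = "{..<0}"])
         (use 2 in \<open>auto simp: flat_exp_def\<close>)
  next
    case 3
    \<comment> \<open>At 0 the difference quotient is itself a member of the family.\<close>
    have "\<forall>\<^sub>F h in at 0. flat_exp (k + 1) h = (flat_exp k (0 + h) - flat_exp k 0) / h"
      by (simp add: eventually_at_filter flat_exp_def field_simps)
    then have "((\<lambda>h. (flat_exp k (0 + h) - flat_exp k 0) / h) \<longlongrightarrow> 0) (at 0)"
      using flat_exp_tendsto_0[of "k + 1"] by (simp add: tendsto_cong)
    then show ?thesis using 3 by (simp add: DERIV_def flat_exp_def)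
  qed
qed

lemma C_k_flat_exp: "C_k m (\<lambda>x. flat_exp k (\<alpha> * x $ i + \<beta>))"
proof (induction m arbitrary: k)
  case 0
  have "continuous_on UNIV (flat_exp k)"
    using flat_exp_deriv DERIV_isCont by (blast intro: continuous_at_imp_continuous_on)
  then show ?case by (auto intro!: continuous_on_compose2[of UNIV "flat_exp k"] continuous_intros)
next
  case (Suc m)
  let ?t = "\<lambda>x::real^3. \<alpha> * x $ i + \<beta>"
  let ?d = "\<lambda>x. - real k * flat_exp (k + 1) (?t x) + flat_exp (k + 2) (?t x)"
  show ?case
  proof (rule C_k_SucI[where G = "\<lambda>x. (?d x * \<alpha>) *\<^sub>R axis i 1"])
    fix x
    have 1: "(?t has_derivative (\<lambda>h. \<alpha> * h $ i)) (at x)"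
      by (auto intro!: derivative_eq_intros bounded_linear_imp_has_derivative bounded_linear_vec_nth)
    have 2: "(flat_exp k has_derivative (\<lambda>h. ?d x * h)) (at (?t x))"
      using flat_exp_deriv[of k "?t x"] by (simp add: has_field_derivative_def)
    show "((\<lambda>x. flat_exp k (?t x)) has_derivative (\<bullet>) ((?d x * \<alpha>) *\<^sub>R axis i 1)) (at x)"
      by (rule has_derivative_eq_rhs[OF has_derivative_compose[OF 1 2]]) (auto simp: inner_axis')
    show "C_k m (\<lambda>x. ((?d x * \<alpha>) *\<^sub>R axis i 1) $ j)" for j
    proof -
      have "C_k m (\<lambda>x. ((- real k) * flat_exp (k + 1) (?t x) + flat_exp (k + 2) (?t x)) * (\<alpha> * axis i 1 $ j))"
        by (intro C_k_mult C_k_add C_k_const Suc.IH)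
      then show ?thesis by (simp add: mult.assoc)
    qed
  qed
qed

text \<open>
  A smooth function with values between 0 and 1 that is positive exactly on \<open>box a b\<close>. As n grows it
  converges to the indicator function of the box.
\<close>

definition bump :: "real \<Rightarrow> real^3 \<Rightarrow> real^3 \<Rightarrow> real^3 \<Rightarrow> real" where
  "bump n a b x = (\<Prod>i\<in>UNIV. flat_exp 0 (n * x $ i + (- n * a $ i)) * flat_exp 0 (- n * x $ i + n * b $ i))"

lemma smooth_bump: "smooth (bump n a b)"
  unfolding smooth_def
proof
  fix m
  have "C_k m (\<lambda>x. \<Prod>i\<in>UNIV. flat_exp 0 (n * x $ i + (- n * a $ i)) * flat_exp 0 (- n * x $ i + n * b $ i))"
    by (intro C_k_prod C_k_mult C_k_flat_exp)
  then show "C_k m (bump n a b)" by (simp add: bump_def[abs_def])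
qed

lemma flat_exp_bounds: "0 \<le> flat_exp 0 t" "flat_exp 0 t \<le> 1"
  by (auto simp: flat_exp_def)

lemma bump_bounds: "0 \<le> bump n a b x" "bump n a b x \<le> 1"
  unfolding bump_def by (auto intro!: prod_nonneg prod_le_1 mult_nonneg_nonneg mult_le_one flat_exp_bounds)

lemma bump_pos_iff:
  assumes "n > 0"
  shows "0 < bump n a b x \<longleftrightarrow> x \<in> box a b"
proof -
  have p: "0 < flat_exp 0 (n * s + (- n * t)) \<longleftrightarrow> t < s" for s t
  proof -
    have "n * s + (- n * t) = n * (s - t)" by (simp add: algebra_simps)
    then show ?thesis using assms by (simp add: flat_exp_def zero_less_mult_iff)
  qed
  have q: "- n * x $ i + n * b $ i = n * b $ i + (- n * x $ i)" for i by simp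
  have "bump n a b x \<noteq> 0 \<longleftrightarrow> (\<forall>i. a $ i < x $ i \<and> x $ i < b $ i)"
    unfolding bump_def q using p flat_exp_bounds(1) by (simp add: less_le)
  then show ?thesis using bump_bounds(1)[of n a b x] by (auto simp: mem_box_cart less_le)
qed

lemma bump_test_function:
  assumes "n > 0" "cbox a b \<subseteq> \<omega>"
  shows "bump n a b \<in> test_functions \<omega>"
proof -
  have "bump n a b x = 0" if "x \<notin> cbox a b" for x
    using bump_pos_iff[OF assms(1), of a b x] bump_bounds(1)[of n a b x] that box_subset_cbox[of a b] by force
  then show ?thesis
    unfolding test_functions_def using assms(2) smooth_bump by (auto intro!: exI[of _ "cbox a b"])
qed

lemma bump_tendsto: "(\<lambda>n. bump (real (Suc n)) a b x) \<longlonglongrightarrow> indicator (box a b) x"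
proof (cases "x \<in> box a b")
  case True
  have lim: "(\<lambda>n. flat_exp 0 (real (Suc n) * t)) \<longlonglongrightarrow> 1" if "t > 0" for t
  proof -
    have "(\<lambda>n. exp (- (inverse (real (Suc n)) * inverse t))) \<longlonglongrightarrow> exp (- (0 * inverse t))"
      by (intro tendsto_intros LIMSEQ_inverse_real_of_nat)
    moreover have "exp (- (inverse (real (Suc n)) * inverse t)) = flat_exp 0 (real (Suc n) * t)" for n
      using that by (simp add: flat_exp_def inverse_mult_distrib zero_less_mult_iff del: of_nat_Suc)
    ultimately show ?thesis by simp
  qed
  have "(\<lambda>n. \<Prod>i\<in>UNIV. flat_exp 0 (real (Suc n) * (x $ i - a $ i)) * flat_exp 0 (real (Suc n) * (b $ i - x $ i)))
      \<longlonglongrightarrow> (\<Prod>i\<in>(UNIV::3 set). 1 * 1)"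
    by (intro tendsto_prod tendsto_mult lim) (use True in \<open>auto simp: mem_box_cart\<close>)
  moreover have "bump (real (Suc n)) a b x
     = (\<Prod>i\<in>UNIV. flat_exp 0 (real (Suc n) * (x $ i - a $ i)) * flat_exp 0 (real (Suc n) * (b $ i - x $ i)))" for n
    unfolding bump_def by (intro prod.cong refl arg_cong2[where f = "(*)"] arg_cong[where f = "flat_exp 0"])
       (simp_all add: right_diff_distrib del: of_nat_Suc)
  ultimately show ?thesis using True by simp
next
  case False
  then have "bump (real (Suc n)) a b x = 0" for n
    using bump_pos_iff[of "real (Suc n)" a b x] bump_bounds(1)[of "real (Suc n)" a b x] by force
  then show ?thesis using False by simp
qed

text \<open>
  The positive and the negative part of f are densities of finite measures that agree on the boxes, an
  intersection-stable generator of the Borel sets.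
\<close>

lemma integrable_zero_on_boxes_imp_AE_0:
  fixes f :: "real^3 \<Rightarrow> real"
  assumes f: "integrable lborel f" and z: "\<And>a b. (\<integral>x. indicator (box a b) x * f x \<partial>lborel) = 0"
  shows "AE x in lborel. f x = 0"
proof -
  have m[measurable]: "f \<in> borel_measurable borel" using f by auto
  let ?p = "\<lambda>x. ennreal (f x)" and ?n = "\<lambda>x. ennreal (- f x)"
  have fin: "(\<integral>\<^sup>+x. ?p x \<partial>lborel) < \<infinity>" "(\<integral>\<^sup>+x. ?n x \<partial>lborel) < \<infinity>"
    using f unfolding real_integrable_def by (auto simp: less_top)
  have le: "(\<integral>\<^sup>+x. g x * indicator A x \<partial>lborel) \<le> (\<integral>\<^sup>+x. g x \<partial>lborel)" for g :: "real^3 \<Rightarrow> ennreal" and A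
    by (intro nn_integral_mono) (auto simp: indicator_def)
  have fin': "(\<integral>\<^sup>+x. ?p x * indicator A x \<partial>lborel) < \<infinity>" "(\<integral>\<^sup>+x. ?n x * indicator A x \<partial>lborel) < \<infinity>" for A
    using le fin by (meson order_le_less_trans)+
  have "density lborel ?p = density lborel ?n"
  proof (rule measure_eqI_generator_eq)
    let ?E = "range (\<lambda>(a, b). box a b :: (real^3) set)"
    show "Int_stable ?E" by (auto simp: Int_stable_def box_Int_box)
    show "?E \<subseteq> Pow UNIV" by simp
    show "sets (density lborel ?p) = sigma_sets UNIV ?E" "sets (density lborel ?n) = sigma_sets UNIV ?E"
      by (simp_all add: borel_eq_box)
    let ?A = "\<lambda>n::nat. box (- (real n *\<^sub>R One)) (real n *\<^sub>R One) :: (real^3) set"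
    show "range ?A \<subseteq> ?E" by auto
    show "(\<Union>i. ?A i) = UNIV" by (rule UN_box_eq_UNIV)
    show "emeasure (density lborel ?p) (?A i) \<noteq> \<infinity>" for i
      using fin'(1) by (simp add: emeasure_density less_top[symmetric])
    fix X assume "X \<in> ?E"
    then obtain a b where X: "X = box a b" by auto
    have eq1: "(\<integral>\<^sup>+x. ennreal (indicator (box a b) x * f x) \<partial>lborel) = (\<integral>\<^sup>+x. ?p x * indicator (box a b) x \<partial>lborel)"
      by (intro nn_integral_cong) (auto simp: indicator_def)
    have eq2: "(\<integral>\<^sup>+x. ennreal (- (indicator (box a b) x * f x)) \<partial>lborel) = (\<integral>\<^sup>+x. ?n x * indicator (box a b) x \<partial>lborel)"
      by (intro nn_integral_cong) (auto simp: indicator_def)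
    have "integrable lborel (\<lambda>x. indicator (box a b) x * f x)"
      unfolding real_integrable_def eq1 eq2 using fin' by (auto simp: less_top[symmetric])
    then have "(\<integral>x. indicator (box a b) x * f x \<partial>lborel)
       = enn2real (\<integral>\<^sup>+x. ?p x * indicator (box a b) x \<partial>lborel) - enn2real (\<integral>\<^sup>+x. ?n x * indicator (box a b) x \<partial>lborel)"
      using real_lebesgue_integral_def[of lborel "\<lambda>x. indicator (box a b) x * f x"] eq1 eq2 by simp
    then have "enn2real (\<integral>\<^sup>+x. ?p x * indicator (box a b) x \<partial>lborel) = enn2real (\<integral>\<^sup>+x. ?n x * indicator (box a b) x \<partial>lborel)"
      using z[of a b] by simp
    then have "(\<integral>\<^sup>+x. ?p x * indicator (box a b) x \<partial>lborel) = (\<integral>\<^sup>+x. ?n x * indicator (box a b) x \<partial>lborel)"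
      using fin'[of "box a b"] by (metis ennreal_enn2real infinity_ennreal_def)
    then show "emeasure (density lborel ?p) X = emeasure (density lborel ?n) X"
      by (simp add: X emeasure_density)
  qed
  then have "AE x in lborel. ?p x = ?n x"
    using fin by (subst (asm) finite_density_unique) auto
  then show ?thesis
    by eventually_elim (metis ennreal_eq_0_iff ennreal_neg linorder_le_cases neg_le_0_iff_le order_antisym)
qed

text \<open>
  Passing to the limit in bump functions, d has integral zero over every box whose closure lies in \<open>\<omega>\<close>. Hence
  it vanishes almost everywhere on each such box, and countably many of them exhaust \<open>\<omega>\<close>.
\<close>

lemma L2_orthogonal_test_functions_imp_0:
  fixes d :: "real^3 \<Rightarrow> real"
  assumes \<omega>: "open \<omega>" "bounded \<omega>" and d: "d \<in> L2 \<omega>"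
    and z: "\<And>\<phi>. \<phi> \<in> test_functions \<omega> \<Longrightarrow> l2_inner \<omega> d \<phi> = 0"
  shows "AE x in lebesgue_on \<omega>. d x = 0"
proof -
  have \<omega>l: "\<omega> \<in> sets lebesgue" using \<omega>(1) by simp
  have "(\<lambda>x. 1::real) \<in> L2 \<omega>" by (rule L2_continuous[OF _ \<omega>(2) \<omega>l]) simp
  from L2_integrable_inner[OF d this] have di: "integrable (lebesgue_on \<omega>) d" by simp
  have boxz: "(\<integral>x. indicator (box a b) x * d x \<partial>lebesgue_on \<omega>) = 0" if ab: "cbox a b \<subseteq> \<omega>" for a b
  proof -
    have "(\<lambda>n. \<integral>x. bump (real (Suc n)) a b x * d x \<partial>lebesgue_on \<omega>)
        \<longlonglongrightarrow> (\<integral>x. indicator (box a b) x * d x \<partial>lebesgue_on \<omega>)"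
    proof (rule integral_dominated_convergence[where w = "\<lambda>x. \<bar>d x\<bar>"])
      have [measurable]: "d \<in> borel_measurable (lebesgue_on \<omega>)" using di by auto
      have "(indicator (box a b) :: _ \<Rightarrow> real) \<in> borel_measurable (lebesgue_on \<omega>)"
        by (intro measurable_restrict_space1 borel_measurable_indicator) auto
      then show "(\<lambda>x. indicator (box a b) x * d x) \<in> borel_measurable (lebesgue_on \<omega>)"
        by (intro borel_measurable_times) auto
      have "bump (real (Suc n)) a b \<in> borel_measurable (lebesgue_on \<omega>)" for n
        by (rule borel_measurable_integrable[OF integrable_bounded_continuous[OF smooth_continuous[OF smooth_bump] \<omega>(2) \<omega>l]])
      then show "(\<lambda>x. bump (real (Suc n)) a b x * d x) \<in> borel_measurable (lebesgue_on \<omega>)" for n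
        by (intro borel_measurable_times) auto
      show "integrable (lebesgue_on \<omega>) (\<lambda>x. \<bar>d x\<bar>)" using di by auto
      show "AE x in lebesgue_on \<omega>. (\<lambda>n. bump (real (Suc n)) a b x * d x) \<longlonglongrightarrow> indicator (box a b) x * d x"
        by (intro AE_I2 tendsto_mult bump_tendsto tendsto_const)
      show "AE x in lebesgue_on \<omega>. norm (bump (real (Suc n)) a b x * d x) \<le> \<bar>d x\<bar>" for n
        using bump_bounds[of "real (Suc n)" a b] by (intro AE_I2) (simp add: abs_mult mult_left_le_one_le)
    qed
    moreover have "(\<integral>x. bump (real (Suc n)) a b x * d x \<partial>lebesgue_on \<omega>) = 0" for n
      using z[OF bump_test_function[OF _ ab, of "real (Suc n)"]]
      by (simp add: l2_inner_def mult.commute del: of_nat_Suc)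
    ultimately show ?thesis by (simp add: LIMSEQ_const_iff)
  qed
  have on_box: "AE x in lebesgue. x \<in> box a b \<longrightarrow> d x = 0" if ab: "cbox a b \<subseteq> \<omega>" for a b
  proof -
    define D where "D = (\<lambda>x. indicator (box a b) x * d x)"
    have b\<omega>: "box a b \<subseteq> \<omega>" using ab box_subset_cbox by blast
    have "integrable (lebesgue_on \<omega>) D"
    proof (rule Bochner_Integration.integrable_bound[OF di])
      have "(indicator (box a b) :: _ \<Rightarrow> real) \<in> borel_measurable (lebesgue_on \<omega>)"
        by (intro measurable_restrict_space1 borel_measurable_indicator) auto
      then show "D \<in> borel_measurable (lebesgue_on \<omega>)"
        unfolding D_def using di by (intro borel_measurable_times) auto
    qed (auto simp: D_def indicator_def)
    then have "integrable lebesgue (\<lambda>x. indicator \<omega> x * D x)"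
      using \<omega>l by (simp add: integrable_restrict_space)
    moreover have iD: "indicator \<omega> x * D x = D x" for x using b\<omega> by (auto simp: D_def indicator_def)
    ultimately have Di: "integrable lebesgue D" by simp
    obtain D' where D': "D' \<in> borel_measurable lborel" "AE x in lborel. D x = D' x"
      using completion_ex_borel_measurable_real[of D lborel] Di by auto
    have DD': "AE x in lebesgue. D x = D' x" using D'(2) by (rule AE_completion)
    have D'm: "D' \<in> borel_measurable lebesgue" using D'(1) by (rule measurable_completion)
    have "integrable lebesgue D'"
      using integrable_cong_AE[OF _ D'm DD'] Di by auto
    then have D'i: "integrable lborel D'" using D'(1) by (simp add: integrable_completion)
    have "(\<integral>x. indicator (box a' b') x * D' x \<partial>lborel) = 0" for a' b'
    proof -
      have "box a b \<inter> box a' b' = box (\<Sum>i\<in>Basis. max (a \<bullet> i) (a' \<bullet> i) *\<^sub>R i) (\<Sum>i\<in>Basis. min (b \<bullet> i) (b' \<bullet> i) *\<^sub>R i)"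
        by (rule box_Int_box)
      moreover have "cbox (\<Sum>i\<in>Basis. max (a \<bullet> i) (a' \<bullet> i) *\<^sub>R i) (\<Sum>i\<in>Basis. min (b \<bullet> i) (b' \<bullet> i) *\<^sub>R i) \<subseteq> cbox a b"
        unfolding Int_interval[symmetric] by (rule Int_lower1)
      ultimately obtain p q where pq: "box a b \<inter> box a' b' = box p q" "cbox p q \<subseteq> cbox a b"
        by blast
      have m': "(indicator (box a' b') :: _ \<Rightarrow> real) \<in> borel_measurable lborel" by simp
      have "(\<integral>x. indicator (box a' b') x * D' x \<partial>lborel) = (\<integral>x. indicator (box a' b') x * D' x \<partial>lebesgue)"
        using D'(1) by (intro integral_completion[symmetric] borel_measurable_times m')
      also have "\<dots> = (\<integral>x. indicator (box a' b') x * D x \<partial>lebesgue)"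
      proof (rule integral_cong_AE)
        show "AE x in lebesgue. indicator (box a' b') x * D' x = indicator (box a' b') x * D x"
          using DD' by eventually_elim simp
      qed (use Di D'm in \<open>auto intro!: borel_measurable_times measurable_completion[OF m']\<close>)
      also have "\<dots> = (\<integral>x. indicator \<omega> x * (indicator (box p q) x * d x) \<partial>lebesgue)"
      proof (intro Bochner_Integration.integral_cong refl)
        fix x
        have "x \<in> box p q \<longleftrightarrow> x \<in> box a b \<and> x \<in> box a' b'" using pq(1) by blast
        then show "indicator (box a' b') x * D x = indicator \<omega> x * (indicator (box p q) x * d x)"
          using b\<omega> by (auto simp: D_def indicator_def)
      qed
      also have "\<dots> = (\<integral>x. indicator (box p q) x * d x \<partial>lebesgue_on \<omega>)"
        using \<omega>l by (simp add: integral_restrict_space)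
      also have "\<dots> = 0" by (rule boxz) (use pq(2) ab in auto)
      finally show ?thesis .
    qed
    then have "AE x in lborel. D' x = 0" by (rule integrable_zero_on_boxes_imp_AE_0[OF D'i])
    then have "AE x in lebesgue. D' x = 0" by (rule AE_completion)
    with DD' show ?thesis by eventually_elim (auto simp: D_def)
  qed
  obtain Q where Q: "countable Q" "Q \<subseteq> Pow \<omega>" "\<And>X. X \<in> Q \<Longrightarrow> \<exists>a b. X = cbox a b" "\<Union>Q = \<omega>"
    using open_countable_Union_open_cbox[OF \<omega>(1)] by metis
  have "AE x in lebesgue. \<forall>X\<in>Q. x \<in> X \<longrightarrow> d x = 0"
  proof (subst AE_ball_countable[OF Q(1)], intro ballI)
    fix X assume X: "X \<in> Q"
    then obtain a b where ab: "X = cbox a b" using Q(3) by blast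
    have "cbox a b \<subseteq> \<omega>" using Q(2) X ab by blast
    note on_box[OF this]
    moreover have "AE x in lebesgue. x \<notin> cbox a b - box a b"
      using negligible_frontier_interval[of a b] by (intro AE_not_in) (simp add: negligible_iff_null_sets)
    ultimately show "AE x in lebesgue. x \<in> X \<longrightarrow> d x = 0"
      by eventually_elim (auto simp: ab)
  qed
  then have "AE x in lebesgue. x \<in> \<omega> \<longrightarrow> d x = 0"
    by eventually_elim (use Q(4) in blast)
  then show ?thesis using \<omega>l by (simp add: AE_restrict_space_iff)
qed

section \<open>Geometry of the domain and of the mesh\<close>

lemma frontier_Int_open: "open \<Omega> \<Longrightarrow> frontier \<Omega> \<inter> \<Omega> = {}"
  using frontier_disjoint_eq by auto

text \<open>
  Vanishing of a trace is imposed on \<open>\<Gamma>\<close> itself, while the complementary boundary part is formed with the closure of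
  \<open>\<Gamma>\<close>. The difference is contained in the relative boundaries of the polygons that make up \<open>\<Gamma>\<close>, that is, in
  finitely many segments. The polygons have dimension at most 2 because the boundary of an open set has
  empty interior.
\<close>

lemma polygonal_closure_diff_null:
  assumes \<Gamma>: "polygonal \<Gamma>" "\<Gamma> \<subseteq> frontier \<Omega>" and \<Omega>: "open \<Omega>"
  shows "AE x in surface \<Omega>. x \<notin> closure \<Gamma> - \<Gamma>"
proof -
  obtain F where F: "finite F" "\<And>P. P \<in> F \<Longrightarrow> polytope P" "\<Gamma> = (\<Union>P\<in>F. rel_interior P)"
    using \<Gamma>(1) unfolding polygonal_def by blast
  define N where "N = (\<Union>P\<in>F. \<Union>{G. G facet_of P})"
  have seg: "\<exists>a b. G = closed_segment a b" if P: "P \<in> F" and G: "G facet_of P" for P G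
  proof -
    have "aff_dim P \<le> 2"
    proof (rule ccontr)
      assume "\<not> aff_dim P \<le> 2"
      then have a3: "aff_dim P = int DIM(real^3)"
        using aff_dim_le_DIM[of P] by simp
      then have "interior P = rel_interior P" by (simp add: interior_rel_interior_gen)
      moreover have "rel_interior P \<noteq> {}"
        using F(2)[OF P] a3 by (auto simp: rel_interior_eq_empty polytope_imp_convex)
      moreover have "rel_interior P \<subseteq> frontier \<Omega>" using F(3) \<Gamma>(2) P by blast
      ultimately obtain y where y: "y \<in> interior P" "interior P \<subseteq> frontier \<Omega>" by blast
      then have "y \<in> closure \<Omega>" by (auto simp: frontier_def)
      then have "interior P \<inter> \<Omega> \<noteq> {}"
        using y(1) open_Int_closure_eq_empty[of "interior P" \<Omega>] by auto
      then show False using y(2) frontier_Int_open[OF \<Omega>] by blast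
    qed
    then have "aff_dim G \<le> 1" "G \<noteq> {}" "G face_of P" using G by (auto simp: facet_of_def)
    moreover have "polytope G" using face_of_polytope_polytope F(2)[OF P] calculation(3) by blast
    ultimately show ?thesis
      by (metis collinear_aff_dim compact_convex_collinear_segment polytope_imp_compact polytope_imp_convex)
  qed
  have fin: "finite (\<Union>P\<in>F. {G. G facet_of P})"
    using F(1,2) by (auto intro: finite_polytope_facets)
  have Neq: "N = (\<Union>G\<in>(\<Union>P\<in>F. {G. G facet_of P}). G)" by (auto simp: N_def)
  have "N \<in> null_sets hausdorff2"
    unfolding Neq
  proof (intro null_sets.finite_UN fin)
    fix G assume "G \<in> (\<Union>P\<in>F. {G. G facet_of P})"
    then obtain a b where "G = closed_segment a b" using seg by blast
    moreover have "closed_segment a b \<in> sets borel" by (simp add: borel_closed closed_segment)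
    ultimately show "G \<in> null_sets hausdorff2"
      by (simp add: null_sets_def sets_hausdorff2 emeasure_hausdorff2 hausdorff2_segment)
  qed
  then have "AE x in hausdorff2. x \<notin> N" by (rule AE_not_in)
  moreover have "closure \<Gamma> - \<Gamma> \<subseteq> N"
  proof -
    have "closed (\<Union>F)" using F(1,2) by (auto intro!: closed_Union intro: polytope_imp_closed)
    then have cl: "closure \<Gamma> \<subseteq> \<Union>F"
      unfolding F(3) by (intro closure_minimal) (use rel_interior_subset in blast)+
    have fac: "P - rel_interior P \<subseteq> \<Union>{G. G facet_of P}" if "P \<in> F" for P
    proof -
      have "P - rel_interior P \<subseteq> rel_frontier P" using closure_subset[of P] by (auto simp: rel_frontier_def)
      also have "\<dots> = \<Union>{G. G facet_of P}"
        by (rule rel_frontier_of_polyhedron[OF polytope_imp_polyhedron[OF F(2)[OF that]]])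
      finally show ?thesis .
    qed
    show ?thesis
    proof
      fix x assume x: "x \<in> closure \<Gamma> - \<Gamma>"
      then obtain P where P: "P \<in> F" "x \<in> P" using cl by auto
      then have "x \<notin> rel_interior P" using x F(3) by auto
      then have "x \<in> \<Union>{G. G facet_of P}" using fac[OF P(1)] P(2) by auto
      then show "x \<in> N" using P(1) unfolding N_def by auto
    qed
  qed
  ultimately have "AE x in hausdorff2. x \<in> frontier \<Omega> \<longrightarrow> x \<notin> closure \<Gamma> - \<Gamma>"
    by (auto elim!: eventually_mono)
  then show ?thesis
    unfolding surface_def by (subst AE_restrict_space_iff) (auto simp: sets_hausdorff2 space_hausdorff2)
qed

text \<open>
  A Lipschitz domain has no slits: below every boundary point, in the local graph coordinates, there are points
  arbitrarily near that are not in the closure.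
\<close>

lemma lipschitz_frontier_closure:
  assumes \<Omega>: "open \<Omega>" "lipschitz_boundary \<Omega>"
  shows "frontier \<Omega> \<subseteq> frontier (closure \<Omega>)"
proof
  fix x assume x: "x \<in> frontier \<Omega>"
  obtain U and Q :: "real^3 \<Rightarrow> real^3" and \<gamma> :: "real^2 \<Rightarrow> real" and L where
    U: "open U" "x \<in> U" "orthogonal_transformation Q" "L-lipschitz_on UNIV \<gamma>"
      "\<Omega> \<inter> U = {z \<in> U. \<gamma> (vector [Q z $ 1, Q z $ 2]) < Q z $ 3}"
    using \<Omega>(2) x unfolding lipschitz_boundary_def by meson
  have linQ: "linear Q" using U(3) by (rule orthogonal_transformation_linear)
  have surjQ: "surj Q" using U(3) by (rule orthogonal_transformation_surj)
  then obtain n where n: "Q n = axis 3 1" by (metis surjD)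
  let ?h = "\<lambda>z. \<gamma> (vector [Q z $ 1, Q z $ 2]) - Q z $ 3"
  have cQ: "continuous_on UNIV Q" using linQ by (rule linear_continuous_on[OF linear_conv_bounded_linear[THEN iffD1]])
  have cont: "continuous_on UNIV ?h"
  proof -
    have 1: "continuous_on UNIV (\<lambda>z. vector [Q z $ 1, Q z $ 2] :: real^2)"
    proof -
      have "vector [a, b] = (\<chi> i::2. if i = 1 then a else b)" for a b :: real
        by (simp add: vec_eq_iff forall_2)
      moreover have "continuous_on UNIV (\<lambda>z. if i = 1 then Q z $ 1 else Q z $ 2)" for i :: 2
        by (cases "i = 1") (auto intro!: continuous_intros cQ)
      ultimately show ?thesis by (simp add: continuous_on_vec_lambda)
    qed
    have 2: "continuous_on UNIV \<gamma>" using U(4) by (rule lipschitz_on_continuous_on)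
    have "continuous_on UNIV (\<lambda>z. \<gamma> (vector [Q z $ 1, Q z $ 2]))"
      by (rule continuous_on_compose2[OF 2 1]) auto
    then show ?thesis by (intro continuous_intros cQ)
  qed
  have "x \<notin> \<Omega>" using x frontier_Int_open[OF \<Omega>(1)] by blast
  then have "x \<notin> {z \<in> U. \<gamma> (vector [Q z $ 1, Q z $ 2]) < Q z $ 3}" unfolding U(5)[symmetric] by blast
  then have hx: "0 \<le> ?h x" using U(2) by simp
  show "x \<in> frontier (closure \<Omega>)"
    unfolding frontier_def closure_closure
  proof
    show "x \<in> closure \<Omega>" using x by (simp add: frontier_def)
    show "x \<notin> interior (closure \<Omega>)"
    proof
      assume "x \<in> interior (closure \<Omega>)"
      then have "open (interior (closure \<Omega>) \<inter> U)" "x \<in> interior (closure \<Omega>) \<inter> U" using U by auto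
      then obtain r where r: "r > 0" "ball x r \<subseteq> interior (closure \<Omega>) \<inter> U" by (meson openE)
      define s where "s = r / (2 * (norm n + 1))"
      have s: "s > 0" using r(1) by (simp add: s_def add_nonneg_pos)
      let ?y = "x - s *\<^sub>R n"
      have "norm (s *\<^sub>R n) < r"
      proof -
        have "norm (s *\<^sub>R n) = r * (norm n / (2 * (norm n + 1)))"
          using r(1) by (simp add: s_def)
        also have "\<dots> < r * 1"
          using r(1) by (intro mult_strict_left_mono) (auto simp: field_simps add_pos_nonneg intro: add_nonneg_pos)
        finally show ?thesis by simp
      qed
      then have y: "?y \<in> ball x r" by (simp add: dist_norm)
      have Qy: "Q ?y = Q x - s *\<^sub>R axis 3 1"
        by (simp add: linear_diff[OF linQ] linear_scale[OF linQ] n)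
      have "?h ?y = ?h x + s"
        unfolding Qy by (simp add: axis_def)
      then have hy: "0 < ?h ?y" using hx s by linarith
      have "open ({z. 0 < ?h z} \<inter> U)"
        by (intro open_Int U open_Collect_less continuous_intros cont)
      moreover have "?y \<in> {z. 0 < ?h z} \<inter> U"
      proof
        show "?y \<in> {z. 0 < ?h z}" using hy by (rule CollectI)
        show "?y \<in> U" using y r(2) by blast
      qed
      moreover have "?y \<in> closure \<Omega>" using y r(2) interior_subset by blast
      ultimately have "({z. 0 < ?h z} \<inter> U) \<inter> \<Omega> \<noteq> {}"
        using open_Int_closure_eq_empty by blast
      then obtain z where z: "0 < ?h z" "z \<in> U" "z \<in> \<Omega>" by blast
      then have "z \<in> {z \<in> U. \<gamma> (vector [Q z $ 1, Q z $ 2]) < Q z $ 3}"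
        unfolding U(5)[symmetric] by blast
      then show False using z(1) by simp
    qed
  qed
qed

lemma open_tetrahedronE:
  assumes "open_tetrahedron K"
  obtains S where "tetrahedron S" "K = tetrahedron.K S"
proof -
  obtain C where C: "3 simplex C" "K = interior C" using assms unfolding open_tetrahedron_def by blast
  then obtain S where S: "\<not> affine_dependent S" "int (card S) = 3 + 1" "C = convex hull S"
    unfolding simplex_def by blast
  have t: "tetrahedron S" by unfold_locales (use S in auto)
  show ?thesis
    by (rule that[OF t]) (simp add: tetrahedron.K_def[OF t] C S)
qed

lemma open_tetrahedron_facts:
  assumes "open_tetrahedron K"
  shows "open K" "bounded K" "convex K" "K \<noteq> {}" "interior (closure K) = K" "K \<in> sets lebesgue"
proof -
  obtain S where S: "tetrahedron S" "K = tetrahedron.K S" using open_tetrahedronE[OF assms] .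
  interpret tetrahedron S by (rule S(1))
  show "open K" "bounded K" "convex K" "K \<noteq> {}" "K \<in> sets lebesgue"
    unfolding S(2) by (rule open_K bounded_K convex_K K_nonempty K_lebesgue)+
  then show "interior (closure K) = K"
    by (simp add: convex_interior_closure interior_open)
qed

lemma open_tetrahedron_planes:
  assumes "open_tetrahedron K"
  shows "\<exists>P :: ((real^3) \<times> real) set. finite P \<and> (\<forall>(m, c)\<in>P. m \<noteq> 0) \<and>
    (\<forall>x\<in>frontier K. \<exists>(m, c)\<in>P. m \<bullet> x = c)"
proof -
  obtain S where S: "tetrahedron S" "K = tetrahedron.K S" using open_tetrahedronE[OF assms] .
  interpret tetrahedron S by (rule S(1))
  let ?P = "(\<lambda>v. (bary_grad v, bary_grad v \<bullet> v - 1)) ` S"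
  have "bary_grad v \<noteq> 0" if v: "v \<in> S" for v
  proof
    assume z: "bary_grad v = 0"
    have "S \<noteq> {v}" using card_S by auto
    then obtain w where "w \<in> S" "w \<noteq> v" using v by blast
    then show False using bary_grad_vertex[OF v, of w] z by simp
  qed
  moreover have "\<exists>(m, c)\<in>?P. m \<bullet> x = c" if "x \<in> frontier K" for x
  proof -
    have "x \<in> frontier local.K" using that S(2) by simp
    then obtain v where "v \<in> S" "bary v x = 0" using bary_frontier(2) by blast
    then show ?thesis by (auto simp: bary_def inner_diff_right intro!: bexI[of _ v])
  qed
  ultimately show ?thesis using finite_S by (intro exI[of _ ?P]) auto
qed

text \<open>
  The constant of \<open>poincare\<close> is \<open>diameter K / 4\<close>, and \<open>pi < 4\<close>.
\<close>

lemma open_tetrahedron_poincare: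
  assumes K: "open_tetrahedron K" and u: "C1_grad u u'"
  shows "\<exists>c. l2_norm K (\<lambda>x. u x - c) \<le> diameter K / pi * l2_norm K u'"
proof -
  obtain S where S: "tetrahedron S" "K = tetrahedron.K S" using open_tetrahedronE[OF K] .
  interpret tetrahedron S by (rule S(1))
  obtain c where c: "integral_K (\<lambda>x. (u x - c)\<^sup>2) \<le> (diameter (tetrahedron.K S) / 4)\<^sup>2 * integral_K (\<lambda>x. u' x \<bullet> u' x)"
    using poincare[OF u] by blast
  have d: "0 \<le> diameter K" using open_tetrahedron_facts(2)[OF K] by (rule diameter_ge_0)
  have "l2_norm K (\<lambda>x. u x - c) = sqrt (integral_K (\<lambda>x. (u x - c)\<^sup>2))"
    by (simp add: l2_norm_def l2_inner_def integral_K_def S(2) power2_eq_square)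
  also have "\<dots> \<le> sqrt ((diameter K / 4)\<^sup>2 * integral_K (\<lambda>x. u' x \<bullet> u' x))"
    using c unfolding S(2) by (rule real_sqrt_le_mono)
  also have "\<dots> = diameter K / 4 * l2_norm K u'"
    using d by (simp add: real_sqrt_mult l2_norm_def l2_inner_def integral_K_def S(2))
  also have "\<dots> \<le> diameter K / pi * l2_norm K u'"
    using d pi_less_4 by (intro mult_right_mono divide_left_mono l2_norm_nonneg) auto
  finally show ?thesis by blast
qed

text \<open>
  The mesh determines the closure of the domain only. Since the domain has no slits, the boundary is contained in
  the faces of the elements, the open elements lie in the domain, and they exhaust it up to a null set.
\<close>

lemma
  assumes domain: "lipschitz_polyhedral_domain \<Omega>" and mesh: "conforming_mesh \<Omega> \<Gamma>D \<Gamma>N T"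
  shows mesh_planar_boundary: "planar_boundary \<Omega>"
    and mesh_subset: "K \<in> T \<Longrightarrow> K \<subseteq> \<Omega>"
    and mesh_disjoint: "K \<in> T \<Longrightarrow> K' \<in> T \<Longrightarrow> K \<noteq> K' \<Longrightarrow> K \<inter> K' = {}"
    and mesh_null: "negligible (\<Omega> - \<Union>T)"
proof -
  have \<Omega>: "open \<Omega>" "lipschitz_boundary \<Omega>"
    using domain unfolding lipschitz_polyhedral_domain_def by auto
  have T': "finite T" "\<forall>K\<in>T. open_tetrahedron K" "(\<Union>K\<in>T. closure K) = closure \<Omega>"
    "\<forall>K\<in>T. \<forall>K'\<in>T. K \<noteq> K' \<longrightarrow>
        (closure K \<inter> closure K') face_of closure K \<and> (closure K \<inter> closure K') face_of closure K'"
    using mesh unfolding conforming_mesh_def by - (elim conjE, assumption)+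
  have T: "finite T" "\<And>K. K \<in> T \<Longrightarrow> open_tetrahedron K" "(\<Union>K\<in>T. closure K) = closure \<Omega>"
    "\<And>K K'. K \<in> T \<Longrightarrow> K' \<in> T \<Longrightarrow> K \<noteq> K' \<Longrightarrow>
        (closure K \<inter> closure K') face_of closure K \<and> (closure K \<inter> closure K') face_of closure K'"
    by - (rule T'(1), rule T'(2)[rule_format], assumption, rule T'(3), rule T'(4)[rule_format], assumption+)
  have fr: "frontier \<Omega> \<subseteq> frontier (closure \<Omega>)" by (rule lipschitz_frontier_closure[OF \<Omega>])
  have frK: "frontier (closure \<Omega>) \<subseteq> (\<Union>K\<in>T. frontier K)"
  proof -
    have "frontier (closure \<Omega>) \<subseteq> (\<Union>C\<in>closure ` T. frontier C)"
      unfolding T(3)[symmetric] by (rule frontier_Union_subset) (use T(1) in simp)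
    also have "\<dots> \<subseteq> (\<Union>K\<in>T. frontier K)"
      unfolding SUP_image comp_def
    proof (intro UN_mono order_refl)
      fix K
      show "frontier (closure K) \<subseteq> frontier K"
        using interior_mono[OF closure_subset[of K]] by (auto simp: frontier_def)
    qed
    finally show ?thesis .
  qed
  have bd: "bounded \<Omega>"
  proof -
    have "bounded (closure \<Omega>)"
      unfolding T(3)[symmetric] using T(1,2) open_tetrahedron_facts(2) by (auto intro!: bounded_UN bounded_closure)
    then show ?thesis using bounded_subset closure_subset by blast
  qed
  have "\<exists>P. \<forall>K\<in>T. finite (P K) \<and> (\<forall>(m, c)\<in>P K. m \<noteq> (0::real^3)) \<and>
    (\<forall>x\<in>frontier K. \<exists>(m, c)\<in>P K. m \<bullet> x = (c::real))"
    by (rule bchoice) (use open_tetrahedron_planes T(2) in blast)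
  then obtain P where P: "\<forall>K\<in>T. finite (P K) \<and> (\<forall>(m, c)\<in>P K. m \<noteq> (0::real^3)) \<and>
    (\<forall>x\<in>frontier K. \<exists>(m, c)\<in>P K. m \<bullet> x = (c::real))" ..
  show "planar_boundary \<Omega>"
    unfolding planar_boundary_def
  proof (intro conjI exI[of _ "\<Union>K\<in>T. P K"])
    show "finite (\<Union>K\<in>T. P K)" using T(1) P by blast
    show "\<forall>(m, c)\<in>\<Union>K\<in>T. P K. m \<noteq> 0" using P by blast
    show "\<forall>x\<in>frontier \<Omega>. \<exists>(m, c)\<in>\<Union>K\<in>T. P K. m \<bullet> x = c"
    proof
      fix x assume "x \<in> frontier \<Omega>"
      then obtain K where K: "K \<in> T" "x \<in> frontier K" using fr frK by blast
      then obtain m c where "(m, c) \<in> P K" "m \<bullet> x = c" using P by blast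
      then show "\<exists>(m, c)\<in>\<Union>K\<in>T. P K. m \<bullet> x = c" using K(1) by blast
    qed
  qed (use \<Omega> bd in auto)
  show sub: "K \<subseteq> \<Omega>" if K: "K \<in> T" for K
  proof
    fix x assume x: "x \<in> K"
    have "K \<subseteq> closure \<Omega>" using T(3) K closure_subset by blast
    then have "K \<subseteq> interior (closure \<Omega>)"
      using open_tetrahedron_facts(1)[OF T(2)[OF K]] by (rule interior_maximal)
    then have "x \<in> interior (closure \<Omega>)" "x \<in> closure \<Omega>" using x interior_subset by blast+
    then have "x \<notin> frontier \<Omega>" using fr by (auto simp: frontier_def)
    then show "x \<in> \<Omega>" using \<open>x \<in> closure \<Omega>\<close> \<Omega>(1) by (auto simp: frontier_def interior_open)
  qed
  show "K \<inter> K' = {}" if K: "K \<in> T" "K' \<in> T" "K \<noteq> K'" for K K'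
  proof (rule ccontr)
    assume ne: "K \<inter> K' \<noteq> {}"
    let ?F = "closure K \<inter> closure K'"
    note iK = open_tetrahedron_facts(5)[OF T(2)[OF K(1)]] and iK' = open_tetrahedron_facts(5)[OF T(2)[OF K(2)]]
    have F: "?F face_of closure K" "?F face_of closure K'" using T(4)[OF K] by auto
    have "?F \<inter> interior (closure K) \<noteq> {}" "?F \<inter> interior (closure K') \<noteq> {}"
      using ne closure_subset[of K] closure_subset[of K'] unfolding iK iK' by auto
    then have "?F = closure K" "?F = closure K'"
      using face_of_disjoint_interior F by blast+
    then have "closure K = closure K'" by simp
    then show False using iK iK' K(3) by metis
  qed
  have "\<Omega> - \<Union>T \<subseteq> (\<Union>K\<in>T. frontier K)"
  proof
    fix x assume x: "x \<in> \<Omega> - \<Union>T"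
    then have "x \<in> (\<Union>K\<in>T. closure K)" using T(3) closure_subset by blast
    then obtain K where "K \<in> T" "x \<in> closure K" by blast
    then show "x \<in> (\<Union>K\<in>T. frontier K)"
      using x T(2) open_tetrahedron_facts(1) by (auto simp: frontier_def interior_open)
  qed
  moreover have "negligible (\<Union>K\<in>T. frontier K)"
    using T(1,2) open_tetrahedron_facts(3) by (auto intro!: negligible_Union negligible_convex_frontier)
  ultimately show "negligible (\<Omega> - \<Union>T)" using negligible_subset by blast
qed

section \<open>The weak curl of fields with components in H1\<close>

text \<open>
  The curl as a function of the Jacobian matrix, with entry \<open>M $ i $ j\<close> the j-th derivative of the i-th component.
\<close>

definition curl_matrix :: "real^3^3 \<Rightarrow> real^3" where
  "curl_matrix M = vector [M $ 3 $ 2 - M $ 2 $ 3, M $ 1 $ 3 - M $ 3 $ 1, M $ 2 $ 1 - M $ 1 $ 2]"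

lemma curl_matrix_nth:
  "curl_matrix M $ 1 = M $ 3 $ 2 - M $ 2 $ 3"
  "curl_matrix M $ 2 = M $ 1 $ 3 - M $ 3 $ 1"
  "curl_matrix M $ 3 = M $ 2 $ 1 - M $ 1 $ 2"
  by (simp_all add: curl_matrix_def vector_3)

lemma curl_eq_curl_matrix: "curl \<phi> x = curl_matrix (\<chi> i. grad (\<lambda>y. \<phi> y $ i) x)"
  by (simp add: curl_def curl_matrix_def grad_def)

text \<open>
  \<open>(u\<^sup>k \<times> w) \<bullet> m = w \<bullet> (m \<times> u\<^sup>k)\<close>, and the curl is the sum of the gradients of the components crossed with \<open>u\<^sup>k\<close>.
\<close>

lemma cross3_curl_matrix: "(\<Sum>k\<in>UNIV. cross3 (axis k 1) w \<bullet> M $ k) = w \<bullet> curl_matrix M"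
  by (simp add: sum_3 inner_vec_def cross3_simps curl_matrix_nth axis_def)

lemma L2_curl_matrix:
  assumes M: "M \<in> L2 \<omega>"
  shows "(\<lambda>x. curl_matrix (M x)) \<in> L2 \<omega>"
proof (rule L2_vec)
  fix k :: 3
  have "(\<lambda>x. M x $ i $ j) \<in> L2 \<omega>" for i j
    using L2_component[OF L2_component[OF M, of i], of j] by simp
  then show "(\<lambda>x. curl_matrix (M x) $ k) \<in> L2 \<omega>"
    using exhaust_3[of k] by (auto simp: curl_matrix_nth intro!: L2_diff)
qed

text \<open>
  The same componentwise computation serves smooth test fields, where the hypothesis is the definition of weak
  derivatives, and fields with complementary boundary conditions, where it is \<open>integration_by_parts_traces\<close>.
\<close>

lemma curl_by_parts:
  assumes L: "v \<in> L2 \<omega>" "p \<in> L2 \<omega>" "M \<in> L2 \<omega>" "N \<in> L2 \<omega>"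
    and ibp: "\<And>i j k. l2_inner \<omega> (\<lambda>x. v x $ i) (\<lambda>x. N x $ k $ j) = - l2_inner \<omega> (\<lambda>x. M x $ i $ j) (\<lambda>x. p x $ k)"
  shows "l2_inner \<omega> v (\<lambda>x. curl_matrix (N x)) = l2_inner \<omega> (\<lambda>x. curl_matrix (M x)) p"
proof -
  have LM: "(\<lambda>x. M x $ i $ j) \<in> L2 \<omega>" and LN: "(\<lambda>x. N x $ i $ j) \<in> L2 \<omega>" for i j
    using L2_component[OF L2_component[OF L(3), of i], of j] L2_component[OF L2_component[OF L(4), of i], of j]
    by simp_all
  note Lv = L2_component[OF L(1)] and Lp = L2_component[OF L(2)]
  show ?thesis
    by (subst (1 2) l2_inner_vec)
       (simp_all add: L L2_curl_matrix sum_3 curl_matrix_nth l2_inner_diff_left l2_inner_diff_right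
          LM LN Lv Lp ibp)
qed

lemma weak_grad_vec_L2:
  assumes "\<And>k. (\<lambda>x. v x $ k) \<in> H1 \<omega>"
  shows "v \<in> L2 \<omega>" "weak_grad_vec \<omega> v \<in> L2 \<omega>"
proof -
  show "v \<in> L2 \<omega>" by (rule L2_vec) (rule H1D(1)[OF assms])
  show "weak_grad_vec \<omega> v \<in> L2 \<omega>"
    by (rule L2_vec) (use H1D(3)[OF assms] in \<open>simp add: weak_grad_vec_def\<close>)
qed

lemma has_weak_curl_H1:
  assumes \<omega>: "open \<omega>" "bounded \<omega>" and v: "\<And>k. (\<lambda>x. v x $ k) \<in> H1 \<omega>"
  shows "has_weak_curl \<omega> v (\<lambda>x. curl_matrix (weak_grad_vec \<omega> v x))"
  unfolding has_weak_curl_def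
proof (intro conjI allI impI)
  have \<omega>l: "\<omega> \<in> sets lebesgue" using \<omega>(1) by simp
  note L = weak_grad_vec_L2[OF v]
  show "(\<lambda>x. curl_matrix (weak_grad_vec \<omega> v x)) \<in> L2 \<omega>" by (rule L2_curl_matrix[OF L(2)])
  fix \<phi> :: "real^3 \<Rightarrow> real^3" assume \<phi>: "\<forall>i. (\<lambda>x. \<phi> x $ i) \<in> test_functions \<omega>"
  let ?N = "\<lambda>x. \<chi> i. grad (\<lambda>y. \<phi> y $ i) x"
  have c: "continuous_on UNIV (\<lambda>x. \<phi> x $ i)" "continuous_on UNIV (grad (\<lambda>x. \<phi> x $ i))" for i
    using C1_gradD[OF smooth_C1_grad[OF test_function_smooth[OF \<phi>[rule_format]]]] by auto
  have "l2_inner \<omega> v (\<lambda>x. curl_matrix (?N x)) = l2_inner \<omega> (\<lambda>x. curl_matrix (weak_grad_vec \<omega> v x)) \<phi>"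
  proof (rule curl_by_parts[OF L(1) _ L(2)])
    show "\<phi> \<in> L2 \<omega>" by (intro L2_vec L2_continuous \<omega> \<omega>l c)
    show "?N \<in> L2 \<omega>" by (rule L2_vec) (simp add: L2_continuous \<omega> \<omega>l c)
    fix i j k
    have "l2_inner \<omega> (\<lambda>x. v x $ i) (pderiv3 j (\<lambda>x. \<phi> x $ k))
        = - l2_inner \<omega> (\<lambda>x. weak_grad \<omega> (\<lambda>x. v x $ i) x $ j) (\<lambda>x. \<phi> x $ k)"
      using H1D(2)[OF v] \<phi> unfolding has_weak_grad_def by blast
    then show "l2_inner \<omega> (\<lambda>x. v x $ i) (\<lambda>x. ?N x $ k $ j)
        = - l2_inner \<omega> (\<lambda>x. weak_grad_vec \<omega> v x $ i $ j) (\<lambda>x. \<phi> x $ k)"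
      by (simp add: weak_grad_vec_def grad_def)
  qed
  then show "l2_inner \<omega> v (curl \<phi>) = l2_inner \<omega> (\<lambda>x. curl_matrix (weak_grad_vec \<omega> v x)) \<phi>"
    by (simp add: curl_eq_curl_matrix[abs_def])
qed

lemma has_weak_curl_unique:
  assumes \<omega>: "open \<omega>" "bounded \<omega>" and c: "has_weak_curl \<omega> v c" "has_weak_curl \<omega> v c'"
  shows "AE x in lebesgue_on \<omega>. c x = c' x"
proof -
  have \<omega>l: "\<omega> \<in> sets lebesgue" using \<omega>(1) by simp
  have L: "c \<in> L2 \<omega>" "c' \<in> L2 \<omega>" using c by (auto simp: has_weak_curl_def)
  have comp: "AE x in lebesgue_on \<omega>. c x $ i - c' x $ i = 0" for i
  proof (rule L2_orthogonal_test_functions_imp_0[OF \<omega>])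
    show "(\<lambda>x. c x $ i - c' x $ i) \<in> L2 \<omega>" by (intro L2_diff L2_component L)
    fix \<phi> assume \<phi>: "\<phi> \<in> test_functions \<omega>"
    let ?\<phi> = "\<lambda>x. \<chi> j. if j = i then \<phi> x else 0"
    have z: "(\<lambda>x. 0) \<in> test_functions \<omega>"
      unfolding test_functions_def by (auto simp: smooth_def C_k_const)
    have t: "(\<lambda>x. ?\<phi> x $ j) \<in> test_functions \<omega>" for j
      using \<phi> z by (cases "j = i") auto
    have "l2_inner \<omega> c ?\<phi> = l2_inner \<omega> c' ?\<phi>"
      using c t unfolding has_weak_curl_def by metis
    moreover have "y \<bullet> ?\<phi> x = y $ i * \<phi> x" for x y
      by (simp add: inner_vec_def if_distrib cong: if_cong)
    ultimately have "l2_inner \<omega> (\<lambda>x. c x $ i) \<phi> = l2_inner \<omega> (\<lambda>x. c' x $ i) \<phi>"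
      by (simp add: l2_inner_def)
    moreover have "\<phi> \<in> L2 \<omega>"
      by (intro L2_continuous \<omega> \<omega>l smooth_continuous test_function_smooth[OF \<phi>])
    ultimately show "l2_inner \<omega> (\<lambda>x. c x $ i - c' x $ i) \<phi> = 0"
      using L by (simp add: l2_inner_diff_left L2_component)
  qed
  have "AE x in lebesgue_on \<omega>. c x $ 1 - c' x $ 1 = 0 \<and> c x $ 2 - c' x $ 2 = 0 \<and> c x $ 3 - c' x $ 3 = 0"
    using comp[of 1] comp[of 2] comp[of 3] by auto
  then show ?thesis by eventually_elim (simp add: vec_eq_iff forall_3)
qed

lemma HcurlD:
  assumes "v \<in> Hcurl \<omega>"
  shows "v \<in> L2 \<omega>" "has_weak_curl \<omega> v (weak_curl \<omega> v)" "weak_curl \<omega> v \<in> L2 \<omega>"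
proof -
  show "v \<in> L2 \<omega>" using assms by (simp add: Hcurl_def)
  show "has_weak_curl \<omega> v (weak_curl \<omega> v)"
    unfolding weak_curl_def using assms someI_ex[of "has_weak_curl \<omega> v"] by (simp add: Hcurl_def)
  then show "weak_curl \<omega> v \<in> L2 \<omega>" by (simp add: has_weak_curl_def)
qed

lemma H1_vec_Hcurl:
  assumes \<omega>: "open \<omega>" "bounded \<omega>" and v: "\<And>k. (\<lambda>x. v x $ k) \<in> H1 \<omega>"
  shows "v \<in> Hcurl \<omega>" "AE x in lebesgue_on \<omega>. weak_curl \<omega> v x = curl_matrix (weak_grad_vec \<omega> v x)"
proof -
  show *: "v \<in> Hcurl \<omega>"
    using has_weak_curl_H1[OF \<omega> v] weak_grad_vec_L2(1)[OF v] by (auto simp: Hcurl_def)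
  show "AE x in lebesgue_on \<omega>. weak_curl \<omega> v x = curl_matrix (weak_grad_vec \<omega> v x)"
    by (rule has_weak_curl_unique[OF \<omega> HcurlD(2)[OF *] has_weak_curl_H1[OF \<omega> v]])
qed

lemma weak_curl_diff:
  assumes \<omega>: "open \<omega>" "bounded \<omega>" and v: "v \<in> Hcurl \<omega>" "w \<in> Hcurl \<omega>"
  shows "(\<lambda>x. v x - w x) \<in> Hcurl \<omega>"
    "AE x in lebesgue_on \<omega>. weak_curl \<omega> (\<lambda>x. v x - w x) x = weak_curl \<omega> v x - weak_curl \<omega> w x"
proof -
  have \<omega>l: "\<omega> \<in> sets lebesgue" using \<omega>(1) by simp
  have h: "has_weak_curl \<omega> (\<lambda>x. v x - w x) (\<lambda>x. weak_curl \<omega> v x - weak_curl \<omega> w x)"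
    unfolding has_weak_curl_def
  proof (intro conjI allI impI)
    show "(\<lambda>x. weak_curl \<omega> v x - weak_curl \<omega> w x) \<in> L2 \<omega>" by (intro L2_diff HcurlD v)
    fix \<phi> :: "real^3 \<Rightarrow> real^3" assume \<phi>: "\<forall>i. (\<lambda>x. \<phi> x $ i) \<in> test_functions \<omega>"
    have c: "continuous_on UNIV (\<lambda>x. \<phi> x $ i)" "continuous_on UNIV (grad (\<lambda>x. \<phi> x $ i))" for i
      using C1_gradD[OF smooth_C1_grad[OF test_function_smooth[OF \<phi>[rule_format]]]] by auto
    have L1: "\<phi> \<in> L2 \<omega>" by (intro L2_vec L2_continuous \<omega> \<omega>l c)
    have "(\<lambda>x. \<chi> i. grad (\<lambda>y. \<phi> y $ i) x) \<in> L2 \<omega>" by (rule L2_vec) (simp add: L2_continuous \<omega> \<omega>l c)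
    then have L2: "curl \<phi> \<in> L2 \<omega>" using L2_curl_matrix by (simp add: curl_eq_curl_matrix[abs_def])
    have "l2_inner \<omega> v (curl \<phi>) = l2_inner \<omega> (weak_curl \<omega> v) \<phi>"
      "l2_inner \<omega> w (curl \<phi>) = l2_inner \<omega> (weak_curl \<omega> w) \<phi>"
      using HcurlD(2)[OF v(1)] HcurlD(2)[OF v(2)] \<phi> unfolding has_weak_curl_def by blast+
    then show "l2_inner \<omega> (\<lambda>x. v x - w x) (curl \<phi>) = l2_inner \<omega> (\<lambda>x. weak_curl \<omega> v x - weak_curl \<omega> w x) \<phi>"
      using L1 L2 HcurlD v by (simp add: l2_inner_diff_left)
  qed
  show *: "(\<lambda>x. v x - w x) \<in> Hcurl \<omega>"
    using h L2_diff[OF HcurlD(1)[OF v(1)] HcurlD(1)[OF v(2)]] by (auto simp: Hcurl_def)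
  show "AE x in lebesgue_on \<omega>. weak_curl \<omega> (\<lambda>x. v x - w x) x = weak_curl \<omega> v x - weak_curl \<omega> w x"
    by (rule has_weak_curl_unique[OF \<omega> HcurlD(2)[OF *] h])
qed

lemma Hcurl_0_diff:
  assumes \<omega>: "open \<omega>" "bounded \<omega>" and v: "v \<in> Hcurl_0 \<Gamma> \<omega>" "w \<in> Hcurl_0 \<Gamma> \<omega>"
  shows "(\<lambda>x. v x - w x) \<in> Hcurl_0 \<Gamma> \<omega>"
proof -
  have h: "v \<in> Hcurl \<omega>" "w \<in> Hcurl \<omega>" using v by (auto simp: Hcurl_0_def)
  note d = weak_curl_diff[OF \<omega> h]
  have "l2_inner \<omega> (\<lambda>x. v x - w x) (weak_curl \<omega> p) - l2_inner \<omega> (weak_curl \<omega> (\<lambda>x. v x - w x)) p = 0"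
    if p: "p \<in> H1_0_vec (frontier \<omega> - closure \<Gamma>) \<omega>" for p
  proof -
    have p1: "\<And>k. (\<lambda>x. p x $ k) \<in> H1 \<omega>" using p by (auto simp: H1_0_vec_def H1_0_def)
    have Lp: "p \<in> L2 \<omega>" "weak_curl \<omega> p \<in> L2 \<omega>"
      using weak_grad_vec_L2(1)[OF p1] HcurlD(3)[OF H1_vec_Hcurl(1)[OF \<omega> p1]] by auto
    note Lv = HcurlD(1,3)[OF h(1)] and Lw = HcurlD(1,3)[OF h(2)]
    have "l2_inner \<omega> (weak_curl \<omega> (\<lambda>x. v x - w x)) p = l2_inner \<omega> (\<lambda>x. weak_curl \<omega> v x - weak_curl \<omega> w x) p"
      by (rule l2_inner_cong_AE[OF HcurlD(3)[OF d(1)] Lp(1) L2_diff[OF Lv(2) Lw(2)] Lp(1) d(2)]) simp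
    moreover have "l2_inner \<omega> v (weak_curl \<omega> p) - l2_inner \<omega> (weak_curl \<omega> v) p = 0"
      "l2_inner \<omega> w (weak_curl \<omega> p) - l2_inner \<omega> (weak_curl \<omega> w) p = 0"
      using v p by (auto simp: Hcurl_0_def)
    ultimately show ?thesis using Lp Lv Lw by (simp add: l2_inner_diff_left)
  qed
  then show ?thesis using d(1) by (auto simp: Hcurl_0_def)
qed

text \<open>
  At almost every boundary point one of the traces of v and p vanishes, so the boundary terms of all products of
  components are zero.
\<close>

lemma H1_0_vec_subset_Hcurl_0:
  assumes \<Omega>: "planar_boundary \<Omega>" and null: "AE x in surface \<Omega>. x \<notin> closure \<Gamma> - \<Gamma>"
    and v: "v \<in> H1_0_vec \<Gamma> \<Omega>"
  shows "v \<in> Hcurl_0 \<Gamma> \<Omega>"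
proof -
  have \<omega>: "open \<Omega>" "bounded \<Omega>" using \<Omega> by (auto simp: planar_boundary_def)
  have v1: "\<And>k. (\<lambda>x. v x $ k) \<in> H1 \<Omega>" using v by (auto simp: H1_0_vec_def H1_0_def)
  note hv = H1_vec_Hcurl[OF \<omega> v1]
  have "l2_inner \<Omega> v (weak_curl \<Omega> p) - l2_inner \<Omega> (weak_curl \<Omega> v) p = 0"
    if p: "p \<in> H1_0_vec (frontier \<Omega> - closure \<Gamma>) \<Omega>" for p
  proof -
    have p1: "\<And>k. (\<lambda>x. p x $ k) \<in> H1 \<Omega>" using p by (auto simp: H1_0_vec_def H1_0_def)
    note hp = H1_vec_Hcurl[OF \<omega> p1]
    note Lv = weak_grad_vec_L2[OF v1] and Lp = weak_grad_vec_L2[OF p1]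
    have "l2_inner \<Omega> v (weak_curl \<Omega> p) = l2_inner \<Omega> v (\<lambda>x. curl_matrix (weak_grad_vec \<Omega> p x))"
      by (rule l2_inner_cong_AE[OF Lv(1) HcurlD(3)[OF hp(1)] Lv(1) L2_curl_matrix[OF Lp(2)] _ hp(2)]) simp
    also have "\<dots> = l2_inner \<Omega> (\<lambda>x. curl_matrix (weak_grad_vec \<Omega> v x)) p"
    proof (rule curl_by_parts[OF Lv(1) Lp(1) Lv(2) Lp(2)])
      fix i j k
      obtain g where g: "has_trace \<Omega> (\<lambda>x. v x $ i) g" "AE x in surface \<Omega>. x \<in> \<Gamma> \<longrightarrow> g x = 0"
        using v by (auto simp: H1_0_vec_def H1_0_def)
      obtain h where h: "has_trace \<Omega> (\<lambda>x. p x $ k) h"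
        "AE x in surface \<Omega>. x \<in> frontier \<Omega> - closure \<Gamma> \<longrightarrow> h x = 0"
        using p by (auto simp: H1_0_vec_def H1_0_def)
      have "AE x in surface \<Omega>. x \<in> frontier \<Omega>"
        by (rule AE_I2) (simp add: surface_def space_restrict_space)
      with g(2) h(2) null have "AE x in surface \<Omega>. g x * h x = 0" by eventually_elim auto
      from integration_by_parts_traces[OF \<Omega> v1 g(1) p1 h(1) this, of j]
      show "l2_inner \<Omega> (\<lambda>x. v x $ i) (\<lambda>x. weak_grad_vec \<Omega> p x $ k $ j)
          = - l2_inner \<Omega> (\<lambda>x. weak_grad_vec \<Omega> v x $ i $ j) (\<lambda>x. p x $ k)"
        by (simp add: weak_grad_vec_def)
    qed
    also have "\<dots> = l2_inner \<Omega> (weak_curl \<Omega> v) p"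
      by (rule l2_inner_cong_AE[OF L2_curl_matrix[OF Lv(2)] Lp(1) HcurlD(3)[OF hv(1)] Lp(1)])
         (use hv(2) in \<open>auto elim!: eventually_mono\<close>)
    finally show ?thesis by simp
  qed
  then show ?thesis using hv(1) by (auto simp: Hcurl_0_def)
qed

lemma has_weak_grad_unique:
  assumes \<omega>: "open \<omega>" "bounded \<omega>" and G: "has_weak_grad \<omega> f G" "has_weak_grad \<omega> f H"
  shows "AE x in lebesgue_on \<omega>. G x = H x"
proof -
  have \<omega>l: "\<omega> \<in> sets lebesgue" using \<omega>(1) by simp
  have L: "G \<in> L2 \<omega>" "H \<in> L2 \<omega>" using G by (auto simp: has_weak_grad_def)
  have comp: "AE x in lebesgue_on \<omega>. G x $ i - H x $ i = 0" for i
  proof (rule L2_orthogonal_test_functions_imp_0[OF \<omega>])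
    show "(\<lambda>x. G x $ i - H x $ i) \<in> L2 \<omega>" by (intro L2_diff L2_component L)
    fix \<phi> assume \<phi>: "\<phi> \<in> test_functions \<omega>"
    have "\<phi> \<in> L2 \<omega>"
      by (intro L2_continuous \<omega> \<omega>l smooth_continuous test_function_smooth[OF \<phi>])
    moreover have "l2_inner \<omega> f (pderiv3 i \<phi>) = - l2_inner \<omega> (\<lambda>x. G x $ i) \<phi>"
      "l2_inner \<omega> f (pderiv3 i \<phi>) = - l2_inner \<omega> (\<lambda>x. H x $ i) \<phi>"
      using G \<phi> unfolding has_weak_grad_def by blast+
    ultimately show "l2_inner \<omega> (\<lambda>x. G x $ i - H x $ i) \<phi> = 0"
      using L by (simp add: l2_inner_diff_left L2_component)
  qed
  have "AE x in lebesgue_on \<omega>. \<forall>i\<in>UNIV. G x $ i - H x $ i = 0"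
    by (rule AE_finite_allI) (use comp in auto)
  then show ?thesis by eventually_elim (simp add: vec_eq_iff)
qed

text \<open>
  The product of the two test functions vanishes on the boundary, so \<open>trace_inequality\<close> leaves no boundary term.
\<close>

lemma test_function_has_weak_grad:
  assumes \<Omega>: "planar_boundary \<Omega>" and \<phi>: "\<phi> \<in> test_functions \<Omega>"
  shows "has_weak_grad \<Omega> \<phi> (grad \<phi>)"
proof -
  have \<omega>: "open \<Omega>" "bounded \<Omega>" using \<Omega> by (auto simp: planar_boundary_def)
  have \<omega>l: "\<Omega> \<in> sets lebesgue" using \<omega>(1) by simp
  obtain C where C: "compact C" "C \<subseteq> \<Omega>" "\<And>x. x \<notin> C \<Longrightarrow> \<phi> x = 0"
    using \<phi> unfolding test_functions_def by blast
  have \<phi>U: "\<phi> \<in> test_functions UNIV" using \<phi> test_functions_mono[of \<Omega> UNIV] by blast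
  note c\<phi> = smooth_C1_grad[OF test_function_smooth[OF \<phi>]]
  have L: "\<phi> \<in> L2 \<Omega>" "grad \<phi> \<in> L2 \<Omega>" by (intro L2_continuous \<omega> \<omega>l C1_gradD[OF c\<phi>])+
  have zero: "\<phi> x = 0" if "x \<in> frontier \<Omega>" for x
    using C(2,3) that frontier_Int_open[OF \<omega>(1)] by blast
  show ?thesis
    unfolding has_weak_grad_def
  proof (intro conjI ballI allI)
    show "grad \<phi> \<in> L2 \<Omega>" by (rule L(2))
    fix \<psi> and i :: 3 assume \<psi>: "\<psi> \<in> test_functions \<Omega>"
    note c\<psi> = smooth_C1_grad[OF test_function_smooth[OF \<psi>]]
    have L\<psi>: "\<psi> \<in> L2 \<Omega>" "grad \<psi> \<in> L2 \<Omega>" by (intro L2_continuous \<omega> \<omega>l C1_gradD[OF c\<psi>])+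
    obtain P :: "((real^3) \<times> real) set" where P: "finite P" "\<And>m c. (m, c) \<in> P \<Longrightarrow> m \<noteq> 0"
      "\<And>x. x \<in> frontier \<Omega> \<Longrightarrow> \<exists>(m, c)\<in>P. m \<bullet> x = c"
      using \<Omega> unfolding planar_boundary_def by blast
    have "ennreal \<bar>\<integral>x. (\<phi> x *\<^sub>R grad \<psi> x + \<psi> x *\<^sub>R grad \<phi> x) \<bullet> axis i 1 \<partial>lebesgue_on \<Omega>\<bar>
       \<le> ennreal (real (card P) * (48 / pi)) * (\<integral>\<^sup>+x. ennreal \<bar>\<phi> x * \<psi> x\<bar> \<partial>surface \<Omega>)"
      by (rule trace_inequality[OF \<omega> P _ C1_grad_mult[OF c\<phi> c\<psi>]]) (auto simp: axis_in_Basis_iff)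
    also have "(\<integral>\<^sup>+x. ennreal \<bar>\<phi> x * \<psi> x\<bar> \<partial>surface \<Omega>) = (\<integral>\<^sup>+x. 0 \<partial>surface \<Omega>)"
      by (intro nn_integral_cong) (simp add: surface_def space_restrict_space zero)
    finally have "(\<integral>x. (\<phi> x *\<^sub>R grad \<psi> x + \<psi> x *\<^sub>R grad \<phi> x) \<bullet> axis i 1 \<partial>lebesgue_on \<Omega>) = 0" by simp
    moreover have "(\<integral>x. (\<phi> x *\<^sub>R grad \<psi> x + \<psi> x *\<^sub>R grad \<phi> x) \<bullet> axis i 1 \<partial>lebesgue_on \<Omega>)
       = l2_inner \<Omega> \<phi> (\<lambda>x. grad \<psi> x $ i) + l2_inner \<Omega> (\<lambda>x. grad \<phi> x $ i) \<psi>"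
      unfolding l2_inner_def
      by (subst Bochner_Integration.integral_add[symmetric])
         (auto intro!: L2_integrable_inner[where 'a = real, simplified] L L\<psi> L2_component
            simp: inner_axis algebra_simps L2_integrable_inner)
    ultimately show "l2_inner \<Omega> \<phi> (pderiv3 i \<psi>) = - l2_inner \<Omega> (\<lambda>x. grad \<phi> x $ i) \<psi>"
      by (simp add: grad_def)
  qed
qed

lemma test_function_H1_0:
  assumes \<Omega>: "planar_boundary \<Omega>" and \<phi>: "\<phi> \<in> test_functions \<Omega>"
  shows "\<phi> \<in> H1_0 \<Gamma> \<Omega>"
proof -
  have \<omega>: "open \<Omega>" "bounded \<Omega>" using \<Omega> by (auto simp: planar_boundary_def)
  have \<omega>l: "\<Omega> \<in> sets lebesgue" using \<omega>(1) by simp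
  obtain C where C: "C \<subseteq> \<Omega>" "\<And>x. x \<notin> C \<Longrightarrow> \<phi> x = 0"
    using \<phi> unfolding test_functions_def by blast
  have \<phi>U: "\<phi> \<in> test_functions UNIV" using \<phi> test_functions_mono[of \<Omega> UNIV] by blast
  note c\<phi> = smooth_C1_grad[OF test_function_smooth[OF \<phi>]]
  have L: "\<phi> \<in> L2 \<Omega>" "grad \<phi> \<in> L2 \<Omega>" by (intro L2_continuous \<omega> \<omega>l C1_gradD[OF c\<phi>])+
  have zero: "\<phi> x = 0" if "x \<in> frontier \<Omega>" for x
    using C that frontier_Int_open[OF \<omega>(1)] by blast
  have wg: "has_weak_grad \<Omega> \<phi> (grad \<phi>)" by (rule test_function_has_weak_grad[OF \<Omega> \<phi>])
  have H: "\<phi> \<in> H1 \<Omega>" using wg L by (auto simp: H1_def)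
  have ae: "AE x in lebesgue_on \<Omega>. grad \<phi> x = weak_grad \<Omega> \<phi> x"
    by (rule has_weak_grad_unique[OF \<omega> wg H1D(2)[OF H]])
  have "l2_inner \<Omega> (\<lambda>x. grad \<phi> x - weak_grad \<Omega> \<phi> x) (\<lambda>x. grad \<phi> x - weak_grad \<Omega> \<phi> x) = 0"
    unfolding l2_inner_def by (rule integral_eq_zero_AE) (use ae in eventually_elim, simp)
  then have g0: "l2_norm \<Omega> (\<lambda>x. grad \<phi> x - weak_grad \<Omega> \<phi> x) = 0"
    by (simp add: l2_norm_def)
  have "has_trace \<Omega> \<phi> (\<lambda>x. 0)"
    unfolding has_trace_def
  proof (intro conjI exI[of _ "\<lambda>n. \<phi>"] allI)
    have "(\<integral>\<^sup>+x. ennreal ((\<phi> x - 0)\<^sup>2) \<partial>surface \<Omega>) = (\<integral>\<^sup>+x. 0 \<partial>surface \<Omega>)"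
      by (intro nn_integral_cong) (simp add: surface_def space_restrict_space zero)
    then show "(\<lambda>n. \<integral>\<^sup>+x. ennreal ((\<phi> x - 0)\<^sup>2) \<partial>surface \<Omega>) \<longlonglongrightarrow> 0" by simp
  qed (use \<phi>U g0 in \<open>auto simp: l2_norm_def l2_inner_def\<close>)
  then show ?thesis using H by (auto simp: H1_0_def)
qed

lemma continuous_AE_0_imp_0:
  fixes f :: "real^3 \<Rightarrow> real"
  assumes \<omega>: "open \<omega>" and f: "continuous_on UNIV f" and ae: "AE x in lebesgue_on \<omega>. f x = 0" and x: "x \<in> \<omega>"
  shows "f x = 0"
proof (rule ccontr)
  assume nz: "f x \<noteq> 0"
  let ?U = "{y. f y \<noteq> 0} \<inter> \<omega>"
  have "open ?U" by (intro open_Int \<omega> open_Collect_neq f continuous_on_const)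
  moreover have "?U \<noteq> {}" using nz x by auto
  ultimately have "\<not> negligible ?U" by (rule open_not_negligible)
  moreover have "negligible ?U"
  proof -
    have "AE y in lebesgue. y \<in> \<omega> \<longrightarrow> f y = 0"
      using ae \<omega> by (simp add: AE_restrict_space_iff)
    then obtain N where N: "{y \<in> space lebesgue. \<not> (y \<in> \<omega> \<longrightarrow> f y = 0)} \<subseteq> N" "N \<in> null_sets lebesgue"
      unfolding eventually_ae_filter by auto
    then have "?U \<subseteq> N" by auto
    then show ?thesis using N(2) negligible_iff_null_sets negligible_subset by blast
  qed
  ultimately show False by blast
qed

text \<open>
  A bump function pointing in the third coordinate direction: if its curl vanished, the bump would not vary in the
  second coordinate direction. Consequently a constant that bounds norms of gradients by norms of curls cannot be
  negative.
\<close>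

lemma exists_nonzero_curl:
  assumes \<Omega>: "planar_boundary \<Omega>" "\<Omega> \<noteq> {}" and null: "AE x in surface \<Omega>. x \<notin> closure \<Gamma> - \<Gamma>"
  shows "\<exists>v\<in>Hcurl_0 \<Gamma> \<Omega>. 0 < l2_norm \<Omega> (weak_curl \<Omega> v)"
proof -
  have \<omega>: "open \<Omega>" "bounded \<Omega>" using \<Omega> by (auto simp: planar_boundary_def)
  obtain x0 where "x0 \<in> \<Omega>" using \<Omega>(2) by blast
  obtain a b where ab: "x0 \<in> box a b" "cbox a b \<subseteq> \<Omega>"
    by (rule open_contains_cbox[OF \<omega>(1) \<open>x0 \<in> \<Omega>\<close>])
  let ?\<phi> = "bump 1 a b"
  have \<phi>: "?\<phi> \<in> test_functions \<Omega>" by (rule bump_test_function) (use ab in auto)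
  note c\<phi> = smooth_C1_grad[OF test_function_smooth[OF \<phi>]]
  have z: "(\<lambda>x. 0) \<in> test_functions \<Omega>"
    unfolding test_functions_def by (auto simp: smooth_def C_k_const)
  define v where "v = (\<lambda>x. axis (3::3) (?\<phi> x))"
  have vt: "(\<lambda>x. v x $ k) \<in> test_functions \<Omega>" for k
    using \<phi> z by (cases "k = 3") (auto simp: v_def axis_def)
  have "v \<in> H1_0_vec \<Gamma> \<Omega>"
    unfolding H1_0_vec_def using test_function_H1_0[OF \<Omega>(1) vt] by auto
  then have v: "v \<in> Hcurl_0 \<Gamma> \<Omega>" by (rule H1_0_vec_subset_Hcurl_0[OF \<Omega>(1) null])
  then have vc: "v \<in> Hcurl \<Omega>" by (simp add: Hcurl_0_def)
  have "l2_norm \<Omega> (weak_curl \<Omega> v) \<noteq> 0"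
  proof
    assume "l2_norm \<Omega> (weak_curl \<Omega> v) = 0"
    then have i0: "l2_inner \<Omega> (weak_curl \<Omega> v) (weak_curl \<Omega> v) = 0"
      using l2_norm_sq[of \<Omega> "weak_curl \<Omega> v"] by simp
    have LC: "weak_curl \<Omega> v \<in> L2 \<Omega>" by (rule HcurlD(3)[OF vc])
    have H: "(\<lambda>x. v x $ k) \<in> H1 \<Omega>" for k
      using test_function_H1_0[OF \<Omega>(1) vt] by (auto simp: H1_0_def)
    have "AE x in lebesgue_on \<Omega>. weak_curl \<Omega> v x = 0"
    proof -
      have "AE x in lebesgue_on \<Omega>. weak_curl \<Omega> v x \<bullet> weak_curl \<Omega> v x = 0"
        using integral_nonneg_eq_0_iff_AE[OF L2D(2)[OF LC]] i0 by (simp add: l2_inner_def)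
      then show ?thesis by eventually_elim simp
    qed
    moreover have "AE x in lebesgue_on \<Omega>. weak_curl \<Omega> v x = curl_matrix (weak_grad_vec \<Omega> v x)"
      by (rule H1_vec_Hcurl(2)[OF \<omega> H])
    moreover have "AE x in lebesgue_on \<Omega>. \<forall>k\<in>UNIV. grad (\<lambda>y. v y $ k) x = weak_grad_vec \<Omega> v x $ k"
    proof (rule AE_finite_allI)
      fix k :: 3
      show "AE x in lebesgue_on \<Omega>. grad (\<lambda>y. v y $ k) x = weak_grad_vec \<Omega> v x $ k"
        using has_weak_grad_unique[OF \<omega> test_function_has_weak_grad[OF \<Omega>(1) vt] H1D(2)[OF H], of k]
        by (simp add: weak_grad_vec_def)
    qed simp
    ultimately have "AE x in lebesgue_on \<Omega>. grad ?\<phi> x $ 2 = 0"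
    proof eventually_elim
      case (elim x)
      have "curl_matrix (weak_grad_vec \<Omega> v x) $ 1 = 0" using elim(1,2) by simp
      then have "grad (\<lambda>y. v y $ 3) x $ 2 - grad (\<lambda>y. v y $ 2) x $ 3 = 0"
        using elim(3) by (simp add: curl_matrix_nth)
      moreover have "(\<lambda>y. v y $ 3) = ?\<phi>" "(\<lambda>y. v y $ 2) = (\<lambda>y. 0)" by (auto simp: v_def axis_def)
      moreover have "grad (\<lambda>y. 0) x = 0"
        using C1_grad_unique[OF smooth_C1_grad C1_grad_const[of 0]] by (simp add: smooth_def C_k_const fun_eq_iff)
      ultimately show ?case by simp
    qed
    then have g0: "grad ?\<phi> x $ 2 = 0" if "x \<in> \<Omega>" for x
      by (rule continuous_AE_0_imp_0[OF \<omega>(1) _ _ that, rotated])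
         (intro continuous_intros C1_gradD[OF c\<phi>])
    \<comment> \<open>The bump would then be constant on the segment in direction 2 from \<open>x0\<close>, where it is positive, to
      the face of its box, where it vanishes.\<close>
    define x1 where "x1 = x0 + (b $ 2 - x0 $ 2) *\<^sub>R axis 2 1"
    have seg: "closed_segment x0 x1 \<subseteq> cbox a b"
    proof (rule closed_segment_subset)
      show "x0 \<in> cbox a b" using ab(1) box_subset_cbox by blast
      have i: "a $ i < x0 $ i" "x0 $ i < b $ i" for i using ab(1) by (auto simp: mem_box_cart)
      have "x1 $ i = (if i = 2 then b $ 2 else x0 $ i)" for i by (auto simp: x1_def axis_def)
      moreover have "a $ 2 \<le> b $ 2" using i[of 2] by linarith
      ultimately show "x1 \<in> cbox a b" using i by (auto simp: mem_box_cart intro: less_imp_le)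
    qed (rule convex_box)
    have "\<exists>t\<in>{0<..<1::real}. ?\<phi> x1 - ?\<phi> x0 = grad ?\<phi> (x0 + t *\<^sub>R (x1 - x0)) \<bullet> (x1 - x0)"
    proof -
      have d: "((\<lambda>t. ?\<phi> (x0 + t *\<^sub>R (x1 - x0))) has_derivative (\<lambda>h. grad ?\<phi> (x0 + t *\<^sub>R (x1 - x0)) \<bullet> (h *\<^sub>R (x1 - x0)))) (at t)" for t
        by (rule has_derivative_compose[OF _ C1_gradD(1)[OF c\<phi>]]) (auto intro!: derivative_eq_intros)
      have "\<exists>t\<in>{0<..<1}. ?\<phi> (x0 + 1 *\<^sub>R (x1 - x0)) - ?\<phi> (x0 + 0 *\<^sub>R (x1 - x0))
          = grad ?\<phi> (x0 + t *\<^sub>R (x1 - x0)) \<bullet> ((1 - 0) *\<^sub>R (x1 - x0))"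
        by (rule mvt_simple[OF zero_less_one has_derivative_at_withinI[OF d]])
      then show ?thesis by simp
    qed
    then obtain t where t: "0 < t" "t < 1" "?\<phi> x1 - ?\<phi> x0 = grad ?\<phi> (x0 + t *\<^sub>R (x1 - x0)) \<bullet> (x1 - x0)" by auto
    have "x0 + t *\<^sub>R (x1 - x0) \<in> closed_segment x0 x1"
      using t by (auto simp: closed_segment_def algebra_simps intro!: exI[of _ t])
    then have "x0 + t *\<^sub>R (x1 - x0) \<in> \<Omega>" using seg ab(2) by blast
    from g0[OF this] have "?\<phi> x1 = ?\<phi> x0" using t(3) by (simp add: x1_def inner_axis)
    moreover have "x1 \<notin> box a b"
      by (auto simp: x1_def mem_box_cart axis_def)
    ultimately show False using bump_pos_iff[of 1 a b x0] bump_pos_iff[of 1 a b x1] ab(1) by simp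
  qed
  then show ?thesis using v l2_norm_nonneg[of \<Omega> "weak_curl \<Omega> v"] by (intro bexI[OF _ v]) simp
qed

lemma Hdiv_D:
  assumes "S \<in> Hdiv_0 \<Gamma> \<omega>"
  shows "S \<in> L2 \<omega>" "weak_div \<omega> S \<in> L2 \<omega>"
proof -
  have h: "S \<in> Hdiv \<omega>" using assms by (simp add: Hdiv_0_def)
  then show "S \<in> L2 \<omega>" by (simp add: Hdiv_def)
  have "has_weak_div \<omega> S (weak_div \<omega> S)"
    unfolding weak_div_def using h someI_ex[of "has_weak_div \<omega> S"] by (simp add: Hdiv_def)
  then show "weak_div \<omega> S \<in> L2 \<omega>" by (simp add: has_weak_div_def)
qed

section \<open>Summation over the mesh\<close>

text \<open>
  The indicator functions of disjoint elements add up to that of the domain, outside a null set.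
\<close>

lemma l2_inner_mesh:
  assumes T: "finite T" "\<And>K. K \<in> T \<Longrightarrow> K \<in> sets lebesgue" "\<And>K. K \<in> T \<Longrightarrow> K \<subseteq> \<Omega>"
    "\<And>K K'. K \<in> T \<Longrightarrow> K' \<in> T \<Longrightarrow> K \<noteq> K' \<Longrightarrow> K \<inter> K' = {}" "negligible (\<Omega> - \<Union>T)"
    and \<Omega>: "\<Omega> \<in> sets lebesgue" and f: "f \<in> L2 \<Omega>" and g: "g \<in> L2 \<Omega>"
  shows "l2_inner \<Omega> f g = (\<Sum>K\<in>T. l2_inner K f g)"
proof -
  have ind: "(\<Sum>K\<in>T. indicator K x) = (indicator (\<Union>T) x :: real)" for x
  proof (cases "x \<in> \<Union>T")
    case True
    then obtain K where K: "K \<in> T" "x \<in> K" by blast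
    have "(\<Sum>K'\<in>T. indicator K' x) = (\<Sum>K'\<in>T. if K' = K then 1 else (0::real))"
      using T(4) K by (intro sum.cong) (auto simp: indicator_def)
    then show ?thesis using K T(1) True by simp
  qed auto
  have int: "integrable lebesgue (\<lambda>x. indicator K x * (f x \<bullet> g x))" if "K \<in> T" for K
    using L2_integrable_inner[OF L2_subset[OF f T(3)[OF that] T(2)[OF that] \<Omega>] L2_subset[OF g T(3)[OF that] T(2)[OF that] \<Omega>]]
      T(2)[OF that] by (simp add: integrable_restrict_space)
  have "(\<Sum>K\<in>T. l2_inner K f g) = (\<Sum>K\<in>T. \<integral>x. indicator K x * (f x \<bullet> g x) \<partial>lebesgue)"
    unfolding l2_inner_def by (intro sum.cong) (auto simp: integral_restrict_space T(2))
  also have "\<dots> = (\<integral>x. (\<Sum>K\<in>T. indicator K x * (f x \<bullet> g x)) \<partial>lebesgue)"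
    by (rule Bochner_Integration.integral_sum[symmetric]) (rule int)
  also have "\<dots> = (\<integral>x. indicator \<Omega> x * (f x \<bullet> g x) \<partial>lebesgue)"
  proof (rule integral_cong_AE)
    show "(\<lambda>x. \<Sum>K\<in>T. indicator K x * (f x \<bullet> g x)) \<in> borel_measurable lebesgue"
      by (intro borel_measurable_integrable Bochner_Integration.integrable_sum int)
    show "(\<lambda>x. indicator \<Omega> x * (f x \<bullet> g x)) \<in> borel_measurable lebesgue"
      using L2_integrable_inner[OF f g] \<Omega> by (intro borel_measurable_integrable) (simp add: integrable_restrict_space)
    have "AE x in lebesgue. x \<notin> \<Omega> - \<Union>T"
      using T(5) by (intro AE_not_in) (simp add: negligible_iff_null_sets)
    then show "AE x in lebesgue. (\<Sum>K\<in>T. indicator K x * (f x \<bullet> g x)) = indicator \<Omega> x * (f x \<bullet> g x)"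
    proof eventually_elim
      case (elim x)
      have "(\<Sum>K\<in>T. indicator K x * (f x \<bullet> g x)) = indicator (\<Union>T) x * (f x \<bullet> g x)"
        by (simp add: sum_distrib_right[symmetric] ind)
      also have "indicator (\<Union>T) x = (indicator \<Omega> x :: real)"
        using elim T(3) by (auto simp: indicator_def)
      finally show ?case .
    qed
  qed
  also have "\<dots> = l2_inner \<Omega> f g"
    unfolding l2_inner_def using \<Omega> by (simp add: integral_restrict_space)
  finally show ?thesis by simp
qed

lemma l2_norm_mono:
  assumes h: "h \<in> L2 \<Omega>" and K: "K \<subseteq> \<Omega>" "K \<in> sets lebesgue" "\<Omega> \<in> sets lebesgue"
  shows "l2_norm K h \<le> l2_norm \<Omega> h"
  unfolding l2_norm_def
proof (rule real_sqrt_le_mono)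
  have "(\<integral>x. indicator K x * (h x \<bullet> h x) \<partial>lebesgue) \<le> (\<integral>x. indicator \<Omega> x * (h x \<bullet> h x) \<partial>lebesgue)"
  proof (rule integral_mono)
    show "integrable lebesgue (\<lambda>x. indicator K x * (h x \<bullet> h x))"
      using L2D(2)[OF L2_subset[OF h K]] K by (simp add: integrable_restrict_space)
    show "integrable lebesgue (\<lambda>x. indicator \<Omega> x * (h x \<bullet> h x))"
      using L2D(2)[OF h] K by (simp add: integrable_restrict_space)
  qed (use K(1) in \<open>auto simp: indicator_def\<close>)
  then show "l2_inner K h h \<le> l2_inner \<Omega> h h"
    unfolding l2_inner_def using K by (simp add: integral_restrict_space)
qed

text \<open>
  The Poincare inequality is known for continuously differentiable functions. The trace of w provides smooth
  functions that converge to w in the \<open>H1\<close> norm on the domain, hence on the element.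
\<close>

lemma element_orthogonal_bound:
  assumes \<Omega>: "open \<Omega>" "bounded \<Omega>" and K: "open_tetrahedron K" "K \<subseteq> \<Omega>"
    and f: "f \<in> L2 \<Omega>" and mean: "l2_inner K f (\<lambda>x. 1) = 0"
    and w: "w \<in> H1 \<Omega>" "has_trace \<Omega> w g"
  shows "\<bar>l2_inner K f w\<bar> \<le> diameter K / pi * l2_norm K f * l2_norm K (weak_grad \<Omega> w)"
proof -
  note Kf = open_tetrahedron_facts[OF K(1)]
  have \<Omega>l: "\<Omega> \<in> sets lebesgue" using \<Omega>(1) by simp
  obtain \<phi> where \<phi>: "\<And>n. \<phi> n \<in> test_functions UNIV"
    "(\<lambda>n. l2_norm \<Omega> (\<lambda>x. \<phi> n x - w x)) \<longlonglongrightarrow> 0"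
    "(\<lambda>n. l2_norm \<Omega> (\<lambda>x. grad (\<phi> n) x - weak_grad \<Omega> w x)) \<longlonglongrightarrow> 0"
    using w(2) unfolding has_trace_def by blast
  have C\<phi>: "C1_grad (\<phi> n) (grad (\<phi> n))" for n
    using \<phi>(1) by (auto intro: smooth_C1_grad test_function_smooth)
  note c = C1_gradD(2,3)[OF C\<phi>]
  note sub = L2_subset[OF _ K(2) Kf(6) \<Omega>l]
  have L: "\<phi> n \<in> L2 \<Omega>" "grad (\<phi> n) \<in> L2 \<Omega>" for n by (intro L2_continuous c \<Omega>(2) \<Omega>l)+
  note Lw = H1D(1,3)[OF w(1)]
  have le: "l2_norm K h \<le> l2_norm \<Omega> h" if "h \<in> L2 \<Omega>" for h :: "real^3 \<Rightarrow> 'b::euclidean_space"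
    by (rule l2_norm_mono[OF that K(2) Kf(6) \<Omega>l])
  have lim1: "(\<lambda>n. l2_norm K (\<lambda>x. \<phi> n x - w x)) \<longlonglongrightarrow> 0"
    by (rule tendsto_sandwich[OF _ _ tendsto_const \<phi>(2)])
       (intro always_eventually allI l2_norm_nonneg le L2_diff L Lw)+
  have lim2: "(\<lambda>n. l2_norm K (\<lambda>x. grad (\<phi> n) x - weak_grad \<Omega> w x)) \<longlonglongrightarrow> 0"
    by (rule tendsto_sandwich[OF _ _ tendsto_const \<phi>(3)])
       (intro always_eventually allI l2_norm_nonneg le L2_diff L Lw)+
  have lf: "(\<lambda>n. l2_norm K (\<lambda>x. f x - f x)) \<longlonglongrightarrow> 0" by (simp add: l2_norm_def l2_inner_def)
  have A: "(\<lambda>n. l2_inner K f (\<phi> n)) \<longlonglongrightarrow> l2_inner K f w"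
    by (rule l2_inner_tendsto[where F = "\<lambda>n. f", OF _ _ lf _ _ lim1]) (intro sub f L Lw)+
  have "(\<lambda>n. l2_inner K (grad (\<phi> n)) (grad (\<phi> n))) \<longlonglongrightarrow> l2_inner K (weak_grad \<Omega> w) (weak_grad \<Omega> w)"
    by (rule l2_inner_tendsto[OF _ _ lim2 _ _ lim2]) (intro sub L Lw)+
  then have B: "(\<lambda>n. l2_norm K (grad (\<phi> n))) \<longlonglongrightarrow> l2_norm K (weak_grad \<Omega> w)"
    unfolding l2_norm_def by (rule tendsto_real_sqrt)
  have bound: "\<bar>l2_inner K f (\<phi> n)\<bar> \<le> diameter K / pi * l2_norm K f * l2_norm K (grad (\<phi> n))" for n
  proof -
    obtain c0 where c0: "l2_norm K (\<lambda>x. \<phi> n x - c0) \<le> diameter K / pi * l2_norm K (grad (\<phi> n))"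
      using open_tetrahedron_poincare[OF K(1) C\<phi>] by blast
    have L1: "(\<lambda>x. c0) \<in> L2 K" by (rule L2_continuous[OF continuous_on_const Kf(2,6)])
    have "l2_inner K f (\<lambda>x. \<phi> n x - c0) = l2_inner K f (\<phi> n) - l2_inner K f (\<lambda>x. c0)"
      by (intro l2_inner_diff_right sub f L L1)
    moreover have "l2_inner K f (\<lambda>x. c0) = c0 * l2_inner K f (\<lambda>x. 1)"
      by (simp add: l2_inner_def mult.commute)
    ultimately have "\<bar>l2_inner K f (\<phi> n)\<bar> = \<bar>l2_inner K f (\<lambda>x. \<phi> n x - c0)\<bar>" using mean by simp
    also have "\<dots> \<le> l2_norm K f * l2_norm K (\<lambda>x. \<phi> n x - c0)"
      by (intro l2_Cauchy_Schwarz L2_diff sub f L L1)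
    also have "\<dots> \<le> l2_norm K f * (diameter K / pi * l2_norm K (grad (\<phi> n)))"
      by (intro mult_left_mono c0 l2_norm_nonneg)
    finally show ?thesis by (simp add: mult_ac)
  qed
  show ?thesis
    by (rule LIMSEQ_le[OF tendsto_rabs[OF A] tendsto_mult[OF tendsto_const B]]) (use bound in auto)
qed

section \<open>The error identity and the error estimate\<close>

lemma L2_cross3_axis:
  assumes w: "w \<in> L2 \<omega>"
  shows "(\<lambda>x. cross3 (axis k 1) (w x)) \<in> L2 \<omega>"
proof (rule L2_vec)
  fix i :: 3
  have "(\<lambda>x. w x $ j) \<in> L2 \<omega>" "(\<lambda>x. - w x $ j) \<in> L2 \<omega>" for j
    using L2_component[OF w, of j] L2_scaleR[OF L2_component[OF w, of j], of "-1"] by simp_all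
  moreover have "(\<lambda>x. 0 :: real) \<in> L2 \<omega>" by (rule L2I) auto
  ultimately show "(\<lambda>x. cross3 (axis k 1) (w x) $ i) \<in> L2 \<omega>"
    using exhaust_3[of k] exhaust_3[of i] by (auto simp: cross3_def vector_3 axis_def)
qed

lemma l2_inner_curl_matrix:
  assumes w: "w \<in> L2 \<omega>" and M: "M \<in> L2 \<omega>"
  shows "l2_inner \<omega> w (\<lambda>x. curl_matrix (M x))
    = (\<Sum>k\<in>UNIV. l2_inner \<omega> (\<lambda>x. cross3 (axis k 1) (w x)) (\<lambda>x. M x $ k))"
proof -
  have "l2_inner \<omega> w (\<lambda>x. curl_matrix (M x))
      = (\<integral>x. (\<Sum>k\<in>UNIV. cross3 (axis k 1) (w x) \<bullet> M x $ k) \<partial>lebesgue_on \<omega>)"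
    unfolding l2_inner_def cross3_curl_matrix ..
  also have "\<dots> = (\<Sum>k\<in>UNIV. l2_inner \<omega> (\<lambda>x. cross3 (axis k 1) (w x)) (\<lambda>x. M x $ k))"
    unfolding l2_inner_def
    by (intro Bochner_Integration.integral_sum L2_integrable_inner L2_cross3_axis w L2_component M)
  finally show ?thesis .
qed

theorem theorem5p1:
  fixes \<Omega> \<Gamma>D \<Gamma>N :: "(real^3) set"
    and T :: "(real^3) set set"
    and va vb :: "(real^3) set \<Rightarrow> real^3"
    and J A Ah :: "real^3 \<Rightarrow> real^3"
    and C\<^sub>L :: real
    and S :: "3 \<Rightarrow> real^3 \<Rightarrow> real^3"
  assumes domain: "lipschitz_polyhedral_domain \<Omega>"
    and split: "boundary_split \<Omega> \<Gamma>D \<Gamma>N"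
    and J_L2: "J \<in> L2 \<Omega>"
    and J_orth: "\<forall>v\<in>curl_free \<Gamma>D \<Omega>. l2_inner \<Omega> J v = 0"
    and A_space: "A \<in> Hcurl_0 \<Gamma>D \<Omega>"
    and A_orth: "\<forall>v\<in>curl_free \<Gamma>D \<Omega>. l2_inner \<Omega> A v = 0"
    and A_weak: "\<forall>v\<in>Hcurl_0 \<Gamma>D \<Omega>.
          l2_inner \<Omega> (weak_curl \<Omega> A) (weak_curl \<Omega> v) = l2_inner \<Omega> J v"
    and mesh: "conforming_mesh \<Omega> \<Gamma>D \<Gamma>N T"
    and edge_vertices: "\<forall>l\<in>mesh_edges T. l = closed_segment (va l) (vb l)"
    and Ah_space: "Ah \<in> Hcurl_0 \<Gamma>D \<Omega>"
    and Ah_poly: "\<forall>l\<in>mesh_edges T. \<exists>p. \<forall>K\<in>edge_patch T l. nedelec_on p K Ah"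
    and Ah_galerkin: "\<forall>l\<in>mesh_edges T. \<not> l \<subseteq> closure \<Gamma>D \<longrightarrow>
          l2_inner \<Omega> (weak_curl \<Omega> Ah) (weak_curl \<Omega> (edge_function \<Omega> T (va l) (vb l)))
          = l2_inner \<Omega> J (edge_function \<Omega> T (va l) (vb l))"
    and C_L: "\<forall>v\<in>Hcurl_0 \<Gamma>D \<Omega>. \<exists>w\<in>H1_0_vec \<Gamma>D \<Omega>.
          (AE x in lebesgue_on \<Omega>. weak_curl \<Omega> w x = weak_curl \<Omega> v x) \<and>
          l2_norm \<Omega> (weak_grad_vec \<Omega> w) \<le> C\<^sub>L * l2_norm \<Omega> (weak_curl \<Omega> v)"
    and S_space: "\<forall>k. S k \<in> Hdiv_0 \<Gamma>N \<Omega>"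
  shows "(\<forall>v\<in>H1_0_vec \<Gamma>D \<Omega>.
            l2_inner \<Omega> (weak_curl \<Omega> (\<lambda>x. A x - Ah x)) (weak_curl \<Omega> v)
            = (\<Sum>k\<in>UNIV.
                 l2_inner \<Omega> (\<lambda>x. J x $ k - weak_div \<Omega> (S k) x) (\<lambda>x. v x $ k)
                 - l2_inner \<Omega> (\<lambda>x. S k x + cross3 (axis k 1) (weak_curl \<Omega> Ah x))
                     (weak_grad \<Omega> (\<lambda>x. v x $ k))))
       \<and> ((\<forall>k. \<forall>r\<in>piecewise_constant T.
              l2_inner \<Omega> (\<lambda>x. weak_div \<Omega> (S k) x - J x $ k) r = 0) \<longrightarrow>
          l2_norm \<Omega> (weak_curl \<Omega> (\<lambda>x. A x - Ah x))
          \<le> C\<^sub>L * sqrt (\<Sum>K\<in>T. \<Sum>k\<in>UNIV.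
                (diameter K / pi * l2_norm K (\<lambda>x. J x $ k - weak_div \<Omega> (S k) x)
                 + l2_norm K (\<lambda>x. S k x + cross3 (axis k 1) (weak_curl \<Omega> Ah x)))\<^sup>2))"
proof -
  have pb: "planar_boundary \<Omega>" by (rule mesh_planar_boundary[OF domain mesh])
  then have \<omega>: "open \<Omega>" "bounded \<Omega>" by (auto simp: planar_boundary_def)
  have \<omega>l: "\<Omega> \<in> sets lebesgue" using \<omega>(1) by simp
  have split': "polygonal \<Gamma>D" "\<Gamma>D \<subseteq> frontier \<Omega>" "frontier \<Omega> = closure \<Gamma>D \<union> closure \<Gamma>N"
    using split openin_imp_subset unfolding boundary_split_def by blast+
  have null: "AE x in surface \<Omega>. x \<notin> closure \<Gamma>D - \<Gamma>D"
    by (rule polygonal_closure_diff_null[OF split'(1,2) \<omega>(1)])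
  have hA: "A \<in> Hcurl \<Omega>" "Ah \<in> Hcurl \<Omega>" using A_space Ah_space by (auto simp: Hcurl_0_def)
  have e: "(\<lambda>x. A x - Ah x) \<in> Hcurl_0 \<Gamma>D \<Omega>" by (rule Hcurl_0_diff[OF \<omega> A_space Ah_space])
  note LA = HcurlD(3)[OF hA(1)] and LAh = HcurlD(3)[OF hA(2)]
  let ?e = "weak_curl \<Omega> (\<lambda>x. A x - Ah x)"
  have Le: "?e \<in> L2 \<Omega>" using e by (intro HcurlD(3)) (simp add: Hcurl_0_def)
  note LS = Hdiv_D[OF S_space[rule_format]]
  have LJ: "(\<lambda>x. J x $ k) \<in> L2 \<Omega>" for k by (rule L2_component[OF J_L2])
  note Lc = L2_cross3_axis[OF LAh]
  let ?f = "\<lambda>k x. J x $ k - weak_div \<Omega> (S k) x"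
  let ?g = "\<lambda>k x. S k x + cross3 (axis k 1) (weak_curl \<Omega> Ah x)"
  have Lf: "?f k \<in> L2 \<Omega>" and Lg: "?g k \<in> L2 \<Omega>" for k
    by (intro L2_diff LJ LS) (intro L2_add LS Lc)
  have id: "l2_inner \<Omega> ?e (weak_curl \<Omega> v)
      = (\<Sum>k\<in>UNIV. l2_inner \<Omega> (?f k) (\<lambda>x. v x $ k) - l2_inner \<Omega> (?g k) (weak_grad \<Omega> (\<lambda>x. v x $ k)))"
    if v: "v \<in> H1_0_vec \<Gamma>D \<Omega>" for v
  proof -
    have v0: "(\<lambda>x. v x $ k) \<in> H1_0 \<Gamma>D \<Omega>" for k using v by (simp add: H1_0_vec_def)
    then have v1: "(\<lambda>x. v x $ k) \<in> H1 \<Omega>" for k by (simp add: H1_0_def)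
    note Lv = H1D(1,3)[OF v1] and Lvv = weak_grad_vec_L2[OF v1]
    note hv = H1_vec_Hcurl[OF \<omega> v1]
    note Lcv = HcurlD(3)[OF hv(1)]
    have vc: "v \<in> Hcurl_0 \<Gamma>D \<Omega>" by (rule H1_0_vec_subset_Hcurl_0[OF pb null v])
    have green: "l2_inner \<Omega> (S k) (weak_grad \<Omega> (\<lambda>x. v x $ k)) + l2_inner \<Omega> (weak_div \<Omega> (S k)) (\<lambda>x. v x $ k) = 0" for k
    proof -
      obtain g where g: "has_trace \<Omega> (\<lambda>x. v x $ k) g" "AE x in surface \<Omega>. x \<in> \<Gamma>D \<longrightarrow> g x = 0"
        using v0[of k] by (auto simp: H1_0_def)
      have "AE x in surface \<Omega>. x \<in> frontier \<Omega> - closure \<Gamma>N \<longrightarrow> g x = 0"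
        using g(2) null
      proof eventually_elim
        case (elim x)
        then show ?case using split'(3) by blast
      qed
      then have "(\<lambda>x. v x $ k) \<in> H1_0 (frontier \<Omega> - closure \<Gamma>N) \<Omega>"
        using v1[of k] g(1) unfolding H1_0_def by blast
      then show ?thesis using S_space unfolding Hdiv_0_def by blast
    qed
    have "l2_inner \<Omega> ?e (weak_curl \<Omega> v) = l2_inner \<Omega> (\<lambda>x. weak_curl \<Omega> A x - weak_curl \<Omega> Ah x) (weak_curl \<Omega> v)"
      by (rule l2_inner_cong_AE[OF Le Lcv L2_diff[OF LA LAh] Lcv weak_curl_diff(2)[OF \<omega> hA]]) simp
    also have "\<dots> = l2_inner \<Omega> J v - l2_inner \<Omega> (weak_curl \<Omega> Ah) (weak_curl \<Omega> v)"
      using A_weak vc by (simp add: l2_inner_diff_left LA LAh Lcv)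
    also have "l2_inner \<Omega> (weak_curl \<Omega> Ah) (weak_curl \<Omega> v)
        = l2_inner \<Omega> (weak_curl \<Omega> Ah) (\<lambda>x. curl_matrix (weak_grad_vec \<Omega> v x))"
      by (rule l2_inner_cong_AE[OF LAh Lcv LAh L2_curl_matrix[OF Lvv(2)] _ hv(2)]) simp
    also have "\<dots> = (\<Sum>k\<in>UNIV. l2_inner \<Omega> (\<lambda>x. cross3 (axis k 1) (weak_curl \<Omega> Ah x)) (weak_grad \<Omega> (\<lambda>x. v x $ k)))"
      by (subst l2_inner_curl_matrix[OF LAh Lvv(2)]) (simp add: weak_grad_vec_def)
    also have "l2_inner \<Omega> J v = (\<Sum>k\<in>UNIV. l2_inner \<Omega> (\<lambda>x. J x $ k) (\<lambda>x. v x $ k))"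
      by (rule l2_inner_vec[OF J_L2 Lvv(1)])
    also have "\<dots> - (\<Sum>k\<in>UNIV. l2_inner \<Omega> (\<lambda>x. cross3 (axis k 1) (weak_curl \<Omega> Ah x)) (weak_grad \<Omega> (\<lambda>x. v x $ k)))
        = (\<Sum>k\<in>UNIV. l2_inner \<Omega> (?f k) (\<lambda>x. v x $ k) - l2_inner \<Omega> (?g k) (weak_grad \<Omega> (\<lambda>x. v x $ k)))"
      unfolding sum_subtractf[symmetric]
    proof (rule sum.cong[OF refl])
      fix k :: 3
      have "l2_inner \<Omega> (?f k) (\<lambda>x. v x $ k) = l2_inner \<Omega> (\<lambda>x. J x $ k) (\<lambda>x. v x $ k) - l2_inner \<Omega> (weak_div \<Omega> (S k)) (\<lambda>x. v x $ k)"
        by (intro l2_inner_diff_left LJ LS Lv)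
      moreover have "l2_inner \<Omega> (?g k) (weak_grad \<Omega> (\<lambda>x. v x $ k)) = l2_inner \<Omega> (S k) (weak_grad \<Omega> (\<lambda>x. v x $ k))
          + l2_inner \<Omega> (\<lambda>x. cross3 (axis k 1) (weak_curl \<Omega> Ah x)) (weak_grad \<Omega> (\<lambda>x. v x $ k))"
        by (intro l2_inner_add_left Lc LS Lv)
      ultimately show "l2_inner \<Omega> (\<lambda>x. J x $ k) (\<lambda>x. v x $ k)
          - l2_inner \<Omega> (\<lambda>x. cross3 (axis k 1) (weak_curl \<Omega> Ah x)) (weak_grad \<Omega> (\<lambda>x. v x $ k))
          = l2_inner \<Omega> (?f k) (\<lambda>x. v x $ k) - l2_inner \<Omega> (?g k) (weak_grad \<Omega> (\<lambda>x. v x $ k))"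
        using green[of k] by linarith
    qed
    finally show ?thesis .
  qed
  have est: "l2_norm \<Omega> ?e \<le> C\<^sub>L * sqrt (\<Sum>K\<in>T. \<Sum>k\<in>UNIV. (diameter K / pi * l2_norm K (?f k) + l2_norm K (?g k))\<^sup>2)"
    if orth: "\<And>k r. r \<in> piecewise_constant T \<Longrightarrow> l2_inner \<Omega> (\<lambda>x. weak_div \<Omega> (S k) x - J x $ k) r = 0"
  proof -
    have T: "finite T" "\<And>K. K \<in> T \<Longrightarrow> open_tetrahedron K" using mesh unfolding conforming_mesh_def by auto
    have Tl: "\<And>K. K \<in> T \<Longrightarrow> K \<in> sets lebesgue" using open_tetrahedron_facts(6) T(2) by blast
    note Tsub = mesh_subset[OF domain mesh] and Tdis = mesh_disjoint[OF domain mesh]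
      and Tnull = mesh_null[OF domain mesh]
    note msum = l2_inner_mesh[OF T(1) Tl Tsub Tdis Tnull \<omega>l]
    define a where "a = (\<lambda>K k. diameter K / pi * l2_norm K (?f k) + l2_norm K (?g k))"
    define \<eta> where "\<eta> = sqrt (\<Sum>K\<in>T. \<Sum>k\<in>UNIV. (a K k)\<^sup>2)"
    have \<eta>0: "0 \<le> \<eta>" unfolding \<eta>_def by (intro real_sqrt_ge_zero sum_nonneg) auto
    \<comment> \<open>The sign matters only when the error vanishes, since the final division by its norm is then impossible.\<close>
    have CL0: "0 \<le> C\<^sub>L"
    proof -
      have "\<Omega> \<noteq> {}" using domain by (simp add: lipschitz_polyhedral_domain_def)
      then obtain v where v: "v \<in> Hcurl_0 \<Gamma>D \<Omega>" "0 < l2_norm \<Omega> (weak_curl \<Omega> v)"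
        using exists_nonzero_curl[OF pb _ null] by blast
      then obtain w where "l2_norm \<Omega> (weak_grad_vec \<Omega> w) \<le> C\<^sub>L * l2_norm \<Omega> (weak_curl \<Omega> v)"
        using C_L by blast
      then have "0 \<le> C\<^sub>L * l2_norm \<Omega> (weak_curl \<Omega> v)"
        using l2_norm_nonneg[of \<Omega> "weak_grad_vec \<Omega> w"] by linarith
      then show ?thesis using v(2) by (simp add: zero_le_mult_iff)
    qed
    obtain w where w: "w \<in> H1_0_vec \<Gamma>D \<Omega>" "AE x in lebesgue_on \<Omega>. weak_curl \<Omega> w x = ?e x"
      "l2_norm \<Omega> (weak_grad_vec \<Omega> w) \<le> C\<^sub>L * l2_norm \<Omega> ?e"
      using C_L e by blast
    have w1: "(\<lambda>x. w x $ k) \<in> H1 \<Omega>" for k using w(1) by (auto simp: H1_0_vec_def H1_0_def)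
    note Lw = H1D(1,3)[OF w1] and Lww = weak_grad_vec_L2[OF w1]
    define b where "b = (\<lambda>K k. l2_norm K (weak_grad \<Omega> (\<lambda>x. w x $ k)))"
    have mean: "l2_inner K (?f k) (\<lambda>x. 1) = 0" if K: "K \<in> T" for K k
    proof -
      have "(indicator K :: _ \<Rightarrow> real) \<in> piecewise_constant T"
        unfolding piecewise_constant_def
      proof (intro CollectI ballI)
        fix K' assume K': "K' \<in> T"
        show "\<exists>c. \<forall>x\<in>K'. indicator K x = (c::real)"
        proof (cases "K' = K")
          case False
          then show ?thesis using Tdis[OF K K'] by (auto simp: indicator_def intro!: exI[of _ 0])
        qed (auto intro!: exI[of _ 1])
      qed
      from orth[OF this, of k]
      have "0 = (\<integral>x. indicator \<Omega> x * ((weak_div \<Omega> (S k) x - J x $ k) * indicator K x) \<partial>lebesgue)"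
        by (simp add: l2_inner_def integral_restrict_space \<omega>l)
      also have "\<dots> = (\<integral>x. - (indicator K x * ?f k x) \<partial>lebesgue)"
        using Tsub[OF K] by (intro Bochner_Integration.integral_cong) (auto simp: indicator_def)
      also have "\<dots> = - l2_inner K (?f k) (\<lambda>x. 1)"
        by (simp add: l2_inner_def integral_restrict_space Tl[OF K])
      finally show ?thesis by simp
    qed
    have local: "l2_inner K (?f k) (\<lambda>x. w x $ k) - l2_inner K (?g k) (weak_grad \<Omega> (\<lambda>x. w x $ k)) \<le> a K k * b K k"
      if K: "K \<in> T" for K k
    proof -
      obtain g where g: "has_trace \<Omega> (\<lambda>x. w x $ k) g"
        using w(1) by (auto simp: H1_0_vec_def H1_0_def)
      have "\<bar>l2_inner K (?f k) (\<lambda>x. w x $ k)\<bar> \<le> diameter K / pi * l2_norm K (?f k) * b K k"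
        unfolding b_def
        by (rule element_orthogonal_bound[OF \<omega> T(2)[OF K] Tsub[OF K] Lf mean[OF K] w1 g])
      moreover have "\<bar>l2_inner K (?g k) (weak_grad \<Omega> (\<lambda>x. w x $ k))\<bar> \<le> l2_norm K (?g k) * b K k"
        unfolding b_def
        by (intro l2_Cauchy_Schwarz L2_subset[OF _ Tsub[OF K] Tl[OF K] \<omega>l] Lg Lw)
      ultimately show ?thesis by (simp add: a_def distrib_right)
    qed
    have hw: "w \<in> Hcurl \<Omega>" by (rule H1_vec_Hcurl(1)[OF \<omega> w1])
    have "(l2_norm \<Omega> ?e)\<^sup>2 = l2_inner \<Omega> ?e (weak_curl \<Omega> w)"
      unfolding l2_norm_sq
      by (rule l2_inner_cong_AE[OF Le Le Le HcurlD(3)[OF hw]]) (use w(2) in \<open>auto elim: eventually_mono\<close>)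
    also have "\<dots> = (\<Sum>k\<in>UNIV. l2_inner \<Omega> (?f k) (\<lambda>x. w x $ k) - l2_inner \<Omega> (?g k) (weak_grad \<Omega> (\<lambda>x. w x $ k)))"
      by (rule id[OF w(1)])
    also have "\<dots> = (\<Sum>k\<in>UNIV. \<Sum>K\<in>T. l2_inner K (?f k) (\<lambda>x. w x $ k) - l2_inner K (?g k) (weak_grad \<Omega> (\<lambda>x. w x $ k)))"
      unfolding sum_subtractf by (intro arg_cong2[where f = "(-)"] sum.cong refl msum Lf Lg Lw)
    also have "\<dots> \<le> (\<Sum>k\<in>UNIV. \<Sum>K\<in>T. a K k * b K k)"
      by (intro sum_mono local)
    also have "\<dots> = (\<Sum>K\<in>T. \<Sum>k\<in>UNIV. a K k * b K k)" by (rule sum.swap)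
    also have "\<dots> = (\<Sum>p\<in>T \<times> UNIV. a (fst p) (snd p) * b (fst p) (snd p))"
      by (simp add: sum.cartesian_product case_prod_beta)
    also have "\<dots> \<le> (\<Sum>p\<in>T \<times> UNIV. \<bar>a (fst p) (snd p)\<bar> * \<bar>b (fst p) (snd p)\<bar>)"
      by (intro sum_mono) (metis abs_ge_self abs_mult)
    also have "\<dots> \<le> L2_set (\<lambda>p. a (fst p) (snd p)) (T \<times> UNIV) * L2_set (\<lambda>p. b (fst p) (snd p)) (T \<times> UNIV)"
      by (rule L2_set_mult_ineq)
    also have "L2_set (\<lambda>p. a (fst p) (snd p)) (T \<times> UNIV) = \<eta>"
      by (simp add: L2_set_def \<eta>_def sum.cartesian_product case_prod_beta)
    also have "L2_set (\<lambda>p. b (fst p) (snd p)) (T \<times> UNIV) = l2_norm \<Omega> (weak_grad_vec \<Omega> w)"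
    proof -
      have "(\<Sum>p\<in>T \<times> UNIV. (b (fst p) (snd p))\<^sup>2) = (\<Sum>K\<in>T. \<Sum>k\<in>UNIV. (b K k)\<^sup>2)"
        by (simp add: sum.cartesian_product case_prod_beta)
      also have "\<dots> = (\<Sum>k\<in>UNIV. \<Sum>K\<in>T. (b K k)\<^sup>2)" by (rule sum.swap)
      also have "\<dots> = (\<Sum>k\<in>UNIV. l2_inner \<Omega> (weak_grad \<Omega> (\<lambda>x. w x $ k)) (weak_grad \<Omega> (\<lambda>x. w x $ k)))"
        unfolding b_def l2_norm_sq by (intro sum.cong refl msum[symmetric] Lw)
      also have "\<dots> = l2_inner \<Omega> (weak_grad_vec \<Omega> w) (weak_grad_vec \<Omega> w)"
        by (subst l2_inner_vec[OF Lww(2) Lww(2)]) (simp add: weak_grad_vec_def)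
      finally show ?thesis by (simp add: L2_set_def l2_norm_def)
    qed
    also have "\<eta> * l2_norm \<Omega> (weak_grad_vec \<Omega> w) \<le> \<eta> * (C\<^sub>L * l2_norm \<Omega> ?e)"
      by (intro mult_left_mono w(3) \<eta>0)
    finally have main: "l2_norm \<Omega> ?e * l2_norm \<Omega> ?e \<le> (C\<^sub>L * \<eta>) * l2_norm \<Omega> ?e"
      by (simp add: power2_eq_square mult_ac)
    have "l2_norm \<Omega> ?e \<le> C\<^sub>L * \<eta>"
    proof (cases "l2_norm \<Omega> ?e = 0")
      case True
      then show ?thesis using CL0 \<eta>0 by simp
    next
      case False
      then have "0 < l2_norm \<Omega> ?e" using l2_norm_nonneg[of \<Omega> ?e] by simp
      then show ?thesis using main by simp
    qed
    then show ?thesis by (simp add: \<eta>_def a_def)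
  qed
  show ?thesis using id est by blast
qed

end
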